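(* Let $\lambda,\mu$ be partitions of the same size and $k\in\mathbb{N}$. Then the set of points $$\bigcup_{p=1}^\infty \frac{1}{p}M_k(s_{p\lambda}*s_{p\mu})$$ is a convex subset of $\mathbb{Q}^k$.
   Context: For partitions $\lambda,\mu,\nu\vdash n$, the Kronecker coefficient $g(\lambda,\mu,\nu)$ is the multiplicity of the Specht module $\mathbb{S}_\nu$ in the $S_n$-module $\mathbb{S}_\lambda\otimes\mathbb{S}_\mu$ (over $\mathbb{C}$), and $s_\lambda * s_\mu := \sum_{\nu\vdash n} g(\lambda,\mu,\nu)s_\nu$. For a partition $\lambda$, $p\lambda=(p\lambda_1,p\lambda_2,\ldots)$. For a symmetric function $f$, $f(x_1,\ldots,x_k)=\sum_\alpha c_\alpha x^\alpha$ is its specialization with $x_m=0$ for $m\geq k+1$, and $M_k(f)=\{\alpha\in\mathbb{Z}_{\geq0}^k : c_\alpha\ne 0\}$ is the set of exponent vectors of monomials appearing (with positive coefficient, in the present case) in $f(x_1,\ldots,x_k)$. A set $X\subset\mathbb{Q}^k$ is a convex subset of $\mathbb{Q}^k$ if every point of $\mathbb{Q}^k$ that is a convex combination of finitely many points of $X$ lies in $X$. *)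

theory Defs
  imports
    Complex_Main
    "HOL-Library.Function_Algebras"
    "HOL-Library.FuncSet"
    "HOL-Library.Poly_Mapping"
    "HOL-Combinatorics.Permutations"
    "Jordan_Normal_Form.Matrix"
begin

section \<open>Partitions\<close>

definition is_partition :: "nat list \<Rightarrow> bool" where
  "is_partition lam \<longleftrightarrow> sorted_wrt (\<ge>) lam \<and> (\<forall>a\<in>set lam. 0 < a)"

definition partitions_of :: "nat \<Rightarrow> nat list set" where
  "partitions_of n = {lam. is_partition lam \<and> sum_list lam = n}"

definition scale_partition :: "nat \<Rightarrow> nat list \<Rightarrow> nat list" where
  "scale_partition p lam = map (\<lambda>a. p * a) lam"

text \<open>Cells are pairs (row, column), both counted from 0.\<close>

definition cells :: "nat list \<Rightarrow> (nat \<times> nat) set" where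
  "cells lam = {(i, j). i < length lam \<and> j < lam ! i}"


section \<open>Complex representations of the symmetric group\<close>

text \<open>
  All representation spaces are complex subspaces of function spaces \<open>'x \<Rightarrow> complex\<close>.
  The symmetric group \<open>S_n\<close> consists of the \<open>\<pi>\<close> with \<open>\<pi> permutes {..<n}\<close>. A representation is
  given by a subspace together with a map \<open>\<rho>\<close> that sends every permutation to an operator.
\<close>

definition cscale :: "complex \<Rightarrow> ('x \<Rightarrow> complex) \<Rightarrow> 'x \<Rightarrow> complex" where
  "cscale c f = (\<lambda>x. c * f x)"

global_interpretation cfun: vector_space cscale
  by unfold_locales (auto simp: cscale_def fun_eq_iff algebra_simps)

type_synonym 'x action = "(nat \<Rightarrow> nat) \<Rightarrow> ('x \<Rightarrow> complex) \<Rightarrow> 'x \<Rightarrow> complex"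

text \<open>
  The linear action on functions induced by an action \<open>a\<close> on points. The inverse makes it a left
  action, sending the indicator function of \<open>x\<close> to that of \<open>a \<pi> x\<close>.
\<close>

definition induced_action :: "((nat \<Rightarrow> nat) \<Rightarrow> 'x \<Rightarrow> 'x) \<Rightarrow> 'x action" where
  "induced_action a \<pi> f = (\<lambda>x. f (a (inv_into UNIV \<pi>) x))"

definition submodule_of :: "nat \<Rightarrow> 'x action \<Rightarrow> ('x \<Rightarrow> complex) set \<Rightarrow> bool" where
  "submodule_of n \<rho> V \<longleftrightarrow>
     cfun.subspace V \<and> (\<forall>\<pi>. \<pi> permutes {..<n} \<longrightarrow> (\<forall>v\<in>V. \<rho> \<pi> v \<in> V))"

definition irreducible_module :: "nat \<Rightarrow> 'x action \<Rightarrow> ('x \<Rightarrow> complex) set \<Rightarrow> bool" where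
  "irreducible_module n \<rho> V \<longleftrightarrow>
     submodule_of n \<rho> V \<and> V \<noteq> {0} \<and>
     (\<forall>W. submodule_of n \<rho> W \<and> W \<subseteq> V \<longrightarrow> W = {0} \<or> W = V)"

definition isomorphic_modules ::
  "nat \<Rightarrow> 'x action \<Rightarrow> ('x \<Rightarrow> complex) set \<Rightarrow> 'y action \<Rightarrow> ('y \<Rightarrow> complex) set \<Rightarrow> bool" where
  "isomorphic_modules n \<rho> V \<sigma> W \<longleftrightarrow>
     (\<exists>\<phi>. bij_betw \<phi> V W \<and>
        (\<forall>u\<in>V. \<forall>v\<in>V. \<phi> (u + v) = \<phi> u + \<phi> v) \<and>
        (\<forall>c. \<forall>v\<in>V. \<phi> (cscale c v) = cscale c (\<phi> v)) \<and>
        (\<forall>\<pi>. \<pi> permutes {..<n} \<longrightarrow> (\<forall>v\<in>V. \<phi> (\<rho> \<pi> v) = \<sigma> \<pi> (\<phi> v))))"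

text \<open>
  \<open>V\<close> is the internal direct sum of the irreducible submodules in the list \<open>Ws\<close>: every vector of
  \<open>V\<close> is in exactly one way a sum of one vector from each entry, and all such sums lie in \<open>V\<close>.
\<close>

definition irreducible_decomposition ::
  "nat \<Rightarrow> 'x action \<Rightarrow> ('x \<Rightarrow> complex) set \<Rightarrow> ('x \<Rightarrow> complex) set list \<Rightarrow> bool" where
  "irreducible_decomposition n \<rho> V Ws \<longleftrightarrow>
     (\<forall>W\<in>set Ws. irreducible_module n \<rho> W) \<and>
     bij_betw (\<lambda>w. \<Sum>i<length Ws. w i) (\<Pi>\<^sub>E i\<in>{..<length Ws}. Ws ! i) V"

text \<open>
  The multiplicity of the irreducible module \<open>U\<close> in \<open>V\<close> is the number of summands isomorphic to
  \<open>U\<close> in a decomposition of \<open>V\<close> into irreducible modules. For finite-dimensional \<open>V\<close>, a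
  decomposition exists by Maschke's theorem and this number does not depend on its choice.
\<close>

definition multiplicity_in ::
  "nat \<Rightarrow> 'y action \<Rightarrow> ('y \<Rightarrow> complex) set \<Rightarrow> 'x action \<Rightarrow> ('x \<Rightarrow> complex) set \<Rightarrow> nat" where
  "multiplicity_in n \<sigma> U \<rho> V =
     (SOME m. \<exists>Ws. irreducible_decomposition n \<rho> V Ws \<and>
        m = length (filter (\<lambda>W. isomorphic_modules n \<sigma> U \<rho> W) Ws))"

text \<open>
  For subspaces of the functions on \<open>X\<close> and on \<open>Y\<close>, the tensor product is realised in the functions
  on \<open>X \<times> Y\<close>; the pure tensor of \<open>v\<close> and \<open>w\<close> is \<open>(x, y) \<mapsto> v x * w y\<close>.
\<close>

definition tensor_space ::
  "('x \<Rightarrow> complex) set \<Rightarrow> ('y \<Rightarrow> complex) set \<Rightarrow> ('x \<times> 'y \<Rightarrow> complex) set" where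
  "tensor_space V W = cfun.span {\<lambda>(x, y). v x * w y | v w. v \<in> V \<and> w \<in> W}"


section \<open>Specht modules\<close>

text \<open>
  A tableau of shape \<open>lam\<close> is a bijective filling of the cells with \<open>0, \<dots>, n - 1\<close>, where \<open>n\<close> is the
  size of \<open>lam\<close>. Its tabloid (class under permutations within rows) is recorded as the list of the
  sets of entries of its rows.
\<close>

definition tableaux :: "nat list \<Rightarrow> (nat \<times> nat \<Rightarrow> nat) set" where
  "tableaux lam = {t \<in> extensional (cells lam). bij_betw t (cells lam) {..<sum_list lam}}"

definition tabloid :: "nat list \<Rightarrow> (nat \<times> nat \<Rightarrow> nat) \<Rightarrow> nat set list" where
  "tabloid lam t = map (\<lambda>i. (\<lambda>j. t (i, j)) ` {..<lam ! i}) [0..<length lam]"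

definition column :: "nat list \<Rightarrow> (nat \<times> nat \<Rightarrow> nat) \<Rightarrow> nat \<Rightarrow> nat set" where
  "column lam t j = {t (i, j) | i. (i, j) \<in> cells lam}"

definition column_stabilizer :: "nat list \<Rightarrow> (nat \<times> nat \<Rightarrow> nat) \<Rightarrow> (nat \<Rightarrow> nat) set" where
  "column_stabilizer lam t =
     {\<pi>. \<pi> permutes {..<sum_list lam} \<and> (\<forall>j. \<pi> ` column lam t j = column lam t j)}"

text \<open>
  The polytabloid of \<open>t\<close> is the signed sum of the tabloids of \<open>\<pi> \<circ> t\<close>, where \<open>\<pi>\<close> ranges over the
  column stabilizer; the formal combination of tabloids is encoded by its coefficient function.
\<close>

definition polytabloid :: "nat list \<Rightarrow> (nat \<times> nat \<Rightarrow> nat) \<Rightarrow> nat set list \<Rightarrow> complex" where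
  "polytabloid lam t =
     (\<lambda>X. \<Sum>\<pi>\<in>column_stabilizer lam t. if tabloid lam (\<pi> \<circ> t) = X then of_int (sign \<pi>) else 0)"

definition specht :: "nat list \<Rightarrow> (nat set list \<Rightarrow> complex) set" where
  "specht lam = cfun.span (polytabloid lam ` tableaux lam)"

definition tabloid_action :: "(nat \<Rightarrow> nat) \<Rightarrow> nat set list \<Rightarrow> nat set list" where
  "tabloid_action \<pi> X = map (\<lambda>R. \<pi> ` R) X"

definition specht_action :: "(nat set list) action" where
  "specht_action = induced_action tabloid_action"

text \<open>The diagonal action: on pure tensors it is \<open>\<pi> (v \<otimes> w) = \<pi> v \<otimes> \<pi> w\<close>.\<close>

definition specht_tensor_action :: "(nat set list \<times> nat set list) action" where
  "specht_tensor_action =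
     induced_action (\<lambda>\<pi>. map_prod (tabloid_action \<pi>) (tabloid_action \<pi>))"

text \<open>Only meaningful when the three partitions have the same size.\<close>

definition kronecker_coeff :: "nat list \<Rightarrow> nat list \<Rightarrow> nat list \<Rightarrow> nat" where
  "kronecker_coeff lam \<mu> \<nu> =
     multiplicity_in (sum_list lam) specht_action (specht \<nu>)
       specht_tensor_action (tensor_space (specht lam) (specht \<mu>))"


section \<open>Symmetric functions\<close>

text \<open>
  A formal power series in countably many variables is given by its coefficients; an exponent
  vector is a finitely supported function on the variable indices, which start at 0.
\<close>

type_synonym series = "(nat \<Rightarrow>\<^sub>0 nat) \<Rightarrow> int"

definition ssyt :: "nat list \<Rightarrow> (nat \<times> nat \<Rightarrow> nat) set" where
  "ssyt \<nu> = {T \<in> extensional (cells \<nu>).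
     (\<forall>i j j'. (i, j) \<in> cells \<nu> \<and> (i, j') \<in> cells \<nu> \<and> j < j' \<longrightarrow> T (i, j) \<le> T (i, j')) \<and>
     (\<forall>i i' j. (i, j) \<in> cells \<nu> \<and> (i', j) \<in> cells \<nu> \<and> i < i' \<longrightarrow> T (i, j) < T (i', j))}"

text \<open>The Schur function is the sum over semistandard tableaux of the monomials of their contents.\<close>

definition schur :: "nat list \<Rightarrow> series" where
  "schur \<nu> = (\<lambda>\<alpha>. int (card
     {T \<in> ssyt \<nu>. \<forall>m. Poly_Mapping.lookup \<alpha> m = card {c \<in> cells \<nu>. T c = m}}))"

definition kronecker_product :: "nat list \<Rightarrow> nat list \<Rightarrow> series" where
  "kronecker_product lam \<mu> =
     (\<lambda>\<alpha>. \<Sum>\<nu>\<in>partitions_of (sum_list lam). int (kronecker_coeff lam \<mu> \<nu>) * schur \<nu> \<alpha>)"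

text \<open>Setting all variables but the first \<open>k\<close> to zero.\<close>

definition specialize :: "nat \<Rightarrow> series \<Rightarrow> series" where
  "specialize k f = (\<lambda>\<alpha>. if Poly_Mapping.keys \<alpha> \<subseteq> {..<k} then f \<alpha> else 0)"

definition exponent_set :: "nat \<Rightarrow> series \<Rightarrow> nat vec set" where
  "exponent_set k f = {vec k (Poly_Mapping.lookup \<alpha>) | \<alpha>. specialize k f \<alpha> \<noteq> 0}"


section \<open>Convex subsets of rational space\<close>

text \<open>Convex combinations are taken with real coefficients.\<close>

definition convex_subset_rat :: "nat \<Rightarrow> rat vec set \<Rightarrow> bool" where
  "convex_subset_rat k X \<longleftrightarrow>
     X \<subseteq> carrier_vec k \<and>
     (\<forall>F (c :: rat vec \<Rightarrow> real) q.
        finite F \<and> F \<subseteq> X \<and> (\<forall>x\<in>F. 0 \<le> c x) \<and> (\<Sum>x\<in>F. c x) = 1 \<and> q \<in> carrier_vec k \<and>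
        (\<forall>i<k. of_rat (q $ i) = (\<Sum>x\<in>F. c x * of_rat (x $ i))) \<longrightarrow> q \<in> X)"

end

theory Submission
  imports Defs "HOL-Library.Nat_Bijection"
begin

text \<open>
  Let \<open>n\<close> be the size of \<open>lam\<close> and \<open>\<mu>\<close>, and let \<open>\<alpha>\<close> be an exponent vector of size \<open>n\<close>. The coefficient of
  \<open>x\<^sup>\<alpha>\<close> in \<open>s_lam * s_\<mu>\<close> is the dimension of the space of vectors in \<open>S_lam \<otimes> S_\<mu>\<close> that are fixed by
  the Young subgroup of \<open>\<alpha>\<close>. Only the vanishing of this number matters here, and it can be read off
  from polynomials. The Young subgroup permutes the elements of each block of a map \<open>blk\<close> from
  \<open>{..<n}\<close> whose fibres have the sizes \<open>\<alpha>\<close>. The fixed vectors are spanned by the averages of the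
  tensors \<open>e_t \<otimes> e_s\<close> of two polytabloids, and up to nonzero factors the values of such an average are
  the coefficients of

    \<open>F = (\<Sum>\<pi>. \<Sum>\<tau>. sign \<pi> * sign \<tau> * (\<Prod>a<n. z (row_t (\<pi>\<^sup>-\<^sup>1 a), row_s (\<tau>\<^sup>-\<^sup>1 a), blk a)))\<close>,

  where \<open>\<pi>\<close> and \<open>\<tau>\<close> run over the column stabilizers of \<open>t\<close> and \<open>s\<close>. So \<open>\<alpha>\<close> occurs if and only if some
  \<open>F\<close> is nonzero (\<open>kronecker_product_nonzero_iff\<close>).

  This criterion is multiplicative. A tableau of shape \<open>p lam\<close> and one of shape \<open>p' lam\<close> can be
  combined, by interleaving their columns, into a tableau of shape \<open>(p + p') lam\<close> whose columns are
  the columns of the two. The column stabilizer becomes a product, hence so does \<open>F\<close>, and since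
  polynomials over the integers form an integral domain the product of two nonzero \<open>F\<close> is nonzero.
  Therefore the pairs \<open>(p, \<alpha>)\<close> form a semigroup (\<open>kronecker_product_semigroup\<close>). The points \<open>\<alpha> / p\<close> of
  a semigroup are closed under convex combinations with rational coefficients: clear denominators
  and add. If a convex combination with real coefficients is rational, its coefficients can be replaced
  by rational ones (\<open>rational_convex_coefficients\<close>).

  The link between the Schur expansion and fixed vectors needs four facts on representations of the
  symmetric group, proved for modules of functions on finite sets: Maschke's theorem and Schur's
  lemma, the irreducibility of Specht modules (James's argument, \<open>irreducible_specht\<close>), the
  equivalence between the existence of a semistandard tableau of shape \<open>\<nu>\<close> and content \<open>\<alpha>\<close> and of a
  nonzero fixed vector in \<open>S_\<nu>\<close>, and the fact that every irreducible module is isomorphic to a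
  Specht module (\<open>irreducible_isomorphic_to_specht\<close>). The last one
  is proved without counting conjugacy classes. Choose a largest set \<open>A\<close> whose symmetric group has
  a nonzero fixed vector, make it the first row, and recurse on the complement with the fixed
  vectors of \<open>A\<close>. The maximality of \<open>A\<close> says that for \<open>a\<close> outside \<open>A\<close> the transpositions \<open>(a x)\<close>, \<open>x \<in> A\<close>,
  sum to \<open>-1\<close> on these vectors. Using this relation, the inner product of the antisymmetrisation
  over the new columns with the one over the old columns becomes a sum of squared norms with
  positive weights, so antisymmetrising over the new columns does not give zero.
\<close>


section \<open>Hermitian geometry of finitely supported functions\<close>

text \<open>
  The notation \<open>inv\<close> also denotes inverses in groups, so inverse permutations get a name of their own.
\<close>

abbreviation pinv :: "('a \<Rightarrow> 'a) \<Rightarrow> 'a \<Rightarrow> 'a" where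
  "pinv \<equiv> inv_into UNIV"

lemma sum_fun_apply: "(\<Sum>i\<in>A. f i) x = (\<Sum>i\<in>A. f i x)"
  by (induction A rule: infinite_finite_induct) auto

lemma cscale_apply [simp]: "cscale c f x = c * f x"
  by (simp add: cscale_def)

lemma cscale_cscale [simp]: "cscale c (cscale d f) = cscale (c * d) f"
  by (simp add: fun_eq_iff)

lemma cscale_one [simp]: "cscale 1 f = f"
  by (simp add: fun_eq_iff)

lemma cscale_zero [simp]: "cscale 0 f = 0" "cscale c 0 = 0"
  by (simp_all add: fun_eq_iff)

lemma cscale_sum: "cscale c (\<Sum>i\<in>A. f i) = (\<Sum>i\<in>A. cscale c (f i))"
  by (simp add: fun_eq_iff sum_fun_apply sum_distrib_left)

lemma cscale_add: "cscale c (f + g) = cscale c f + cscale c g"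
  by (simp add: fun_eq_iff algebra_simps)

lemma cscale_minus_one: "cscale (- 1) f = - f"
  by (simp add: fun_eq_iff)

lemma cscale_eq_0_iff: "cscale c f = 0 \<longleftrightarrow> c = 0 \<or> f = 0"
  by (auto simp add: fun_eq_iff)


definition funs_on :: "'x set \<Rightarrow> ('x \<Rightarrow> complex) set" where
  "funs_on X = {f. \<forall>x. x \<notin> X \<longrightarrow> f x = 0}"

definition inner_on :: "'x set \<Rightarrow> ('x \<Rightarrow> complex) \<Rightarrow> ('x \<Rightarrow> complex) \<Rightarrow> complex" where
  "inner_on X f g = (\<Sum>x\<in>X. f x * cnj (g x))"

definition point_mass :: "'x \<Rightarrow> 'x \<Rightarrow> complex" where
  "point_mass x = (\<lambda>y. if y = x then 1 else 0)"

lemma subspace_funs_on: "cfun.subspace (funs_on X)"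
  by (auto simp: cfun.subspace_def funs_on_def)

lemma inner_on_add: "inner_on X (f + g) h = inner_on X f h + inner_on X g h"
  by (simp add: inner_on_def algebra_simps sum.distrib)

lemma inner_on_scale: "inner_on X (cscale c f) h = c * inner_on X f h"
  by (simp add: inner_on_def sum_distrib_left mult_ac)

lemma inner_on_scale_right: "inner_on X f (cscale c h) = cnj c * inner_on X f h"
  by (simp add: inner_on_def sum_distrib_left mult_ac)

lemma inner_on_zero [simp]: "inner_on X 0 h = 0" "inner_on X f 0 = 0"
  by (simp_all add: inner_on_def)

lemma inner_on_add_right: "inner_on X f (g + h) = inner_on X f g + inner_on X f h"
  by (simp add: inner_on_def algebra_simps sum.distrib)

lemma inner_on_sum: "inner_on X (\<Sum>i\<in>A. f i) h = (\<Sum>i\<in>A. inner_on X (f i) h)"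
  by (induction A rule: infinite_finite_induct) (simp_all only: sum.infinite sum.empty sum.insert inner_on_add inner_on_zero not_False_eq_True)

lemma inner_on_sum_right: "inner_on X h (\<Sum>i\<in>A. f i) = (\<Sum>i\<in>A. inner_on X h (f i))"
  by (induction A rule: infinite_finite_induct) (simp_all only: sum.infinite sum.empty sum.insert inner_on_add_right inner_on_zero not_False_eq_True)

lemma inner_on_self: "inner_on X f f = complex_of_real (\<Sum>x\<in>X. (cmod (f x))\<^sup>2)"
  unfolding inner_on_def of_real_sum
  by (intro sum.cong refl) (simp only: complex_norm_square)

lemma inner_on_self_nonneg: "0 \<le> Re (inner_on X f f)"
  by (simp add: inner_on_self sum_nonneg)

lemma inner_on_self_eq_0:
  assumes "finite X" "f \<in> funs_on X" "inner_on X f f = 0"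
  shows "f = 0"
proof -
  have "(\<Sum>x\<in>X. (cmod (f x))\<^sup>2) = 0"
    using assms(3) unfolding inner_on_self of_real_eq_0_iff .
  then have "\<forall>x\<in>X. f x = 0"
    using assms(1) by (simp add: sum_nonneg_eq_0_iff)
  then show ?thesis
    using assms(2) by (auto simp: funs_on_def fun_eq_iff)
qed

lemma inner_on_self_pos:
  assumes "finite X" "f \<in> funs_on X" "f \<noteq> 0"
  shows "0 < Re (inner_on X f f)"
proof -
  have "inner_on X f f \<noteq> 0" using inner_on_self_eq_0[OF assms(1,2)] assms(3) by blast
  then have "Re (inner_on X f f) \<noteq> 0" unfolding inner_on_self by (simp del: of_real_sum)
  then show ?thesis using inner_on_self_nonneg[of X f] by linarith
qed

lemma point_mass_funs_on: "x \<in> X \<Longrightarrow> point_mass x \<in> funs_on X"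
  by (auto simp: point_mass_def funs_on_def)

lemma funs_on_expand:
  assumes "finite X" "f \<in> funs_on X"
  shows "f = (\<Sum>x\<in>X. cscale (f x) (point_mass x))"
proof
  fix y
  have "(\<Sum>x\<in>X. cscale (f x) (point_mass x)) y = (\<Sum>x\<in>X. if x = y then f x else 0)"
    unfolding sum_fun_apply by (intro sum.cong refl) (auto simp: point_mass_def)
  also have "\<dots> = f y"
    using assms by (auto simp: funs_on_def)
  finally show "f y = (\<Sum>x\<in>X. cscale (f x) (point_mass x)) y" ..
qed

lemma funs_on_subset_span:
  assumes "finite X"
  shows "funs_on X \<subseteq> cfun.span (point_mass ` X)"
proof
  fix f :: "'a \<Rightarrow> complex" assume f: "f \<in> funs_on X"
  show "f \<in> cfun.span (point_mass ` X)"
    by (subst funs_on_expand[OF assms f])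
      (intro cfun.span_sum cfun.span_scale cfun.span_base imageI)
qed

lemma finite_basis_in_funs_on:
  assumes "finite X" "cfun.subspace V" "V \<subseteq> funs_on X"
  obtains B where "finite B" "B \<subseteq> V" "cfun.independent B" "cfun.span B = V" "card B = cfun.dim V"
proof -
  obtain B where B: "B \<subseteq> V" "cfun.independent B" "V \<subseteq> cfun.span B" "card B = cfun.dim V"
    using cfun.basis_exists by blast
  have "finite B"
    using cfun.independent_span_bound[of "point_mass ` X" B] B assms funs_on_subset_span[OF assms(1)]
    by blast
  moreover have "cfun.span B = V"
    using B assms(2) by (simp add: cfun.span_minimal subset_antisym)
  ultimately show ?thesis using that B by blast
qed

text \<open>
  Gram-Schmidt: a new vector \<open>b\<close> is replaced by its component \<open>e\<close> orthogonal to the earlier ones, and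
  the projection is corrected along \<open>e\<close>.
\<close>

lemma orthogonal_projection_span:
  assumes "finite X" "finite B" "B \<subseteq> funs_on X"
  shows "\<exists>p\<in>cfun.span B. \<forall>w\<in>cfun.span B. inner_on X (v - p) w = 0"
  using assms(2,3)
proof (induction B arbitrary: v rule: finite_induct)
  case empty
  show ?case
  proof (rule bexI[of _ 0])
    show "\<forall>w\<in>cfun.span {}. inner_on X (v - 0) w = 0"
      unfolding cfun.span_empty by (simp only: ball_simps inner_on_zero)
  qed (rule cfun.span_zero)
next
  case (insert b B)
  obtain p where p: "p \<in> cfun.span B" "\<forall>w\<in>cfun.span B. inner_on X (v - p) w = 0"
    using insert by blast
  obtain q where q: "q \<in> cfun.span B" "\<forall>w\<in>cfun.span B. inner_on X (b - q) w = 0"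
    using insert by blast
  define e where "e = b - q"
  have sub: "cfun.span B \<subseteq> funs_on X"
    using insert.prems by (intro cfun.span_minimal subspace_funs_on) auto
  have eX: "e \<in> funs_on X"
    unfolding e_def using q(1) sub insert.prems by (intro cfun.subspace_diff[OF subspace_funs_on]) auto
  have spB: "cfun.span B \<subseteq> cfun.span (insert b B)" by (rule cfun.span_mono) auto
  have e_span: "e \<in> cfun.span (insert b B)"
    unfolding e_def by (intro cfun.span_diff[OF cfun.span_base subsetD[OF spB q(1)]]) simp
  define c where "c = inner_on X (v - p) e / inner_on X e e"
  have pe: "inner_on X (v - p) e = c * inner_on X e e"
    using inner_on_self_eq_0[OF assms(1) eX] by (cases "e = 0") (auto simp: c_def)
  define r where "r = p + cscale c e"
  have vr: "v - r = (v - p) + cscale (- c) e" by (simp add: r_def fun_eq_iff)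
  have r_e: "inner_on X (v - r) e = 0"
    unfolding vr inner_on_add inner_on_scale pe by simp
  have r_B: "inner_on X (v - r) w = 0" if "w \<in> cfun.span B" for w
    unfolding vr inner_on_add inner_on_scale using that p(2) q(2) by (simp add: e_def)
  have "inner_on X (v - r) w = 0" if w: "w \<in> cfun.span (insert b B)" for w
  proof -
    obtain k where k: "w - cscale k b \<in> cfun.span B"
      using w unfolding cfun.span_insert by blast
    have "w = (w - cscale k b + cscale k q) + cscale k e" by (simp add: e_def fun_eq_iff algebra_simps)
    moreover have "w - cscale k b + cscale k q \<in> cfun.span B"
      using k q(1) by (intro cfun.span_add cfun.span_scale)
    ultimately show ?thesis
      using r_B r_e by (metis inner_on_add_right inner_on_scale_right mult_zero_right add_0_left)
  qed
  moreover have "r \<in> cfun.span (insert b B)"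
    unfolding r_def by (intro cfun.span_add[OF subsetD[OF spB p(1)]] cfun.span_scale e_span)
  ultimately show ?case by blast
qed

lemma orthogonal_projection:
  assumes "finite X" "cfun.subspace W" "W \<subseteq> funs_on X"
  obtains p where "p \<in> W" "\<forall>w\<in>W. inner_on X (v - p) w = 0"
proof -
  obtain B where "finite B" "B \<subseteq> W" "cfun.span B = W"
    using finite_basis_in_funs_on[OF assms] by metis
  with orthogonal_projection_span[of X B v] assms that show ?thesis by blast
qed


section \<open>Permutation representations\<close>

lemma induced_action_add: "induced_action a \<pi> (f + g) = induced_action a \<pi> f + induced_action a \<pi> g"
  by (simp add: induced_action_def fun_eq_iff)

lemma induced_action_scale: "induced_action a \<pi> (cscale c f) = cscale c (induced_action a \<pi> f)"
  by (simp add: induced_action_def fun_eq_iff)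

lemma induced_action_zero [simp]: "induced_action a \<pi> 0 = 0"
  by (simp add: induced_action_def fun_eq_iff)

lemma induced_action_sum: "induced_action a \<pi> (\<Sum>i\<in>A. f i) = (\<Sum>i\<in>A. induced_action a \<pi> (f i))"
  by (induction A rule: infinite_finite_induct) (simp_all only: sum.infinite sum.empty sum.insert induced_action_add induced_action_zero not_False_eq_True)

text \<open>
  The action on points is only required to preserve \<open>X\<close> for permutations of \<open>{..<n}\<close>, but to be an
  action for all functions; both actions on tabloids used below satisfy this. Submodules of
  \<open>funs_on X\<close> are then unitary modules.
\<close>

locale permutation_rep =
  fixes n :: nat and X :: "'x set" and a :: "(nat \<Rightarrow> nat) \<Rightarrow> 'x \<Rightarrow> 'x"
  assumes finite_X: "finite X"
    and a_id: "\<And>x. a id x = x"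
    and a_comp: "\<And>\<pi> \<sigma> x. a (\<pi> \<circ> \<sigma>) x = a \<pi> (a \<sigma> x)"
    and a_closed: "\<And>\<pi> x. \<pi> permutes {..<n} \<Longrightarrow> x \<in> X \<Longrightarrow> a \<pi> x \<in> X"
begin

abbreviation act :: "(nat \<Rightarrow> nat) \<Rightarrow> ('x \<Rightarrow> complex) \<Rightarrow> 'x \<Rightarrow> complex" where
  "act \<equiv> induced_action a"

lemma act_id [simp]: "act id f = f"
  by (simp add: induced_action_def fun_eq_iff a_id)

lemma act_comp:
  assumes "\<pi> permutes {..<n}" "\<sigma> permutes {..<n}"
  shows "act (\<pi> \<circ> \<sigma>) f = act \<pi> (act \<sigma> f)"
proof -
  have "pinv (\<pi> \<circ> \<sigma>) = pinv \<sigma> \<circ> pinv \<pi>"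
    using assms by (simp add: o_inv_distrib permutes_bij)
  then show ?thesis unfolding induced_action_def by (simp only: a_comp)
qed

lemma a_inverse:
  assumes "\<pi> permutes {..<n}"
  shows "a (pinv \<pi>) (a \<pi> x) = x" "a \<pi> (a (pinv \<pi>) x) = x"
  using a_comp[of "pinv \<pi>" \<pi> x] a_comp[of \<pi> "pinv \<pi>" x] a_id permutes_inv_o[OF assms] by simp_all

lemma act_inverse:
  assumes "\<pi> permutes {..<n}"
  shows "act (pinv \<pi>) (act \<pi> f) = f" "act \<pi> (act (pinv \<pi>) f) = f"
  using act_comp[OF permutes_inv[OF assms] assms, of f] act_comp[OF assms permutes_inv[OF assms], of f]
    permutes_inv_o[OF assms] by simp_all

lemma a_closed_iff:
  assumes "\<pi> permutes {..<n}"
  shows "a \<pi> x \<in> X \<longleftrightarrow> x \<in> X"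
  using a_closed[OF assms] a_closed[OF permutes_inv[OF assms]] a_inverse[OF assms] by metis

lemma act_funs_on:
  assumes "\<pi> permutes {..<n}" "f \<in> funs_on X"
  shows "act \<pi> f \<in> funs_on X"
  using assms(2) a_closed_iff[OF permutes_inv[OF assms(1)]] by (simp add: funs_on_def induced_action_def)

lemma act_point_mass:
  assumes "\<pi> permutes {..<n}"
  shows "act \<pi> (point_mass x) = point_mass (a \<pi> x)"
  using a_inverse[OF assms] by (auto simp: induced_action_def point_mass_def fun_eq_iff)

lemma inner_act:
  assumes "\<pi> permutes {..<n}"
  shows "inner_on X (act \<pi> f) (act \<pi> g) = inner_on X f g"
proof -
  have "bij_betw (a (pinv \<pi>)) X X"
    by (rule bij_betwI[where g = "a \<pi>"])
      (use assms in \<open>auto simp: a_inverse a_closed permutes_inv\<close>)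
  then show ?thesis
    unfolding inner_on_def induced_action_def
    by (rule sum.reindex_bij_betw[where g = "\<lambda>x. f x * cnj (g x)"])
qed

lemma inner_act_left:
  assumes "\<pi> permutes {..<n}"
  shows "inner_on X (act \<pi> f) g = inner_on X f (act (pinv \<pi>) g)"
  using inner_act[OF assms, of f "act (pinv \<pi>) g"] act_inverse[OF assms] by simp

end


section \<open>Equivariant maps, Schur's lemma and Maschke's theorem\<close>

definition equivariant_map ::
  "nat \<Rightarrow> 'x action \<Rightarrow> ('x \<Rightarrow> complex) set \<Rightarrow> 'y action \<Rightarrow> ('y \<Rightarrow> complex) set \<Rightarrow>
    (('x \<Rightarrow> complex) \<Rightarrow> 'y \<Rightarrow> complex) \<Rightarrow> bool" where
  "equivariant_map n \<rho> V \<sigma> W \<phi> \<longleftrightarrow>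
     (\<forall>v\<in>V. \<phi> v \<in> W) \<and>
     (\<forall>u\<in>V. \<forall>v\<in>V. \<phi> (u + v) = \<phi> u + \<phi> v) \<and>
     (\<forall>c. \<forall>v\<in>V. \<phi> (cscale c v) = cscale c (\<phi> v)) \<and>
     (\<forall>\<pi>. \<pi> permutes {..<n} \<longrightarrow> (\<forall>v\<in>V. \<phi> (\<rho> \<pi> v) = \<sigma> \<pi> (\<phi> v)))"

lemma equivariant_mapD:
  assumes "equivariant_map n \<rho> V \<sigma> W \<phi>"
  shows "v \<in> V \<Longrightarrow> \<phi> v \<in> W"
    and "u \<in> V \<Longrightarrow> v \<in> V \<Longrightarrow> \<phi> (u + v) = \<phi> u + \<phi> v"
    and "v \<in> V \<Longrightarrow> \<phi> (cscale c v) = cscale c (\<phi> v)"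
    and "\<pi> permutes {..<n} \<Longrightarrow> v \<in> V \<Longrightarrow> \<phi> (\<rho> \<pi> v) = \<sigma> \<pi> (\<phi> v)"
  using assms unfolding equivariant_map_def by blast+

lemma equivariant_map_comp:
  assumes "equivariant_map n \<rho> U \<sigma> V \<phi>" "equivariant_map n \<sigma> V \<tau> W \<psi>"
  shows "equivariant_map n \<rho> U \<tau> W (\<psi> \<circ> \<phi>)"
  unfolding equivariant_map_def o_def
  by (intro conjI ballI allI impI)
    (simp_all only: equivariant_mapD[OF assms(1)] equivariant_mapD[OF assms(2)])

lemma equivariant_map_subset:
  assumes "equivariant_map n \<rho> V \<sigma> W \<phi>" "U \<subseteq> V"
  shows "equivariant_map n \<rho> U \<sigma> W \<phi>"
  using assms unfolding equivariant_map_def by blast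

lemma equivariant_map_zero:
  assumes "equivariant_map n \<rho> V \<sigma> W \<phi>" "cfun.subspace V"
  shows "\<phi> 0 = 0"
  using equivariant_mapD(3)[OF assms(1) cfun.subspace_0[OF assms(2)], of 0] by (simp only: cscale_zero)

lemma equivariant_map_diff:
  assumes "equivariant_map n \<rho> V \<sigma> W \<phi>" "cfun.subspace V" "u \<in> V" "v \<in> V"
  shows "\<phi> (u - v) = \<phi> u - \<phi> v"
proof -
  have "u - v = u + cscale (- 1) v" unfolding cscale_minus_one by simp
  moreover have "\<phi> (u + cscale (- 1) v) = \<phi> u + cscale (- 1) (\<phi> v)"
    using assms by (simp only: equivariant_mapD(2,3)[OF assms(1)] cfun.subspace_scale)
  ultimately show ?thesis unfolding cscale_minus_one by simp
qed

lemma submodule_ofD: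
  assumes "submodule_of n \<rho> V"
  shows "cfun.subspace V" "\<pi> permutes {..<n} \<Longrightarrow> v \<in> V \<Longrightarrow> \<rho> \<pi> v \<in> V"
  using assms by (auto simp: submodule_of_def)

lemma irreducible_moduleD:
  assumes "irreducible_module n \<rho> V"
  shows "submodule_of n \<rho> V" "V \<noteq> {0}"
    "submodule_of n \<rho> W \<Longrightarrow> W \<subseteq> V \<Longrightarrow> W \<noteq> {0} \<Longrightarrow> W = V"
  using assms by (auto simp: irreducible_module_def)

text \<open>
  The kernel and the image of an equivariant map are submodules.
\<close>

theorem schur_lemma:
  assumes U: "irreducible_module n (induced_action a) U"
    and W: "irreducible_module n (induced_action b) W"
    and hom: "equivariant_map n (induced_action a) U (induced_action b) W \<phi>"
    and nz: "u \<in> U" "\<phi> u \<noteq> 0"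
  shows "isomorphic_modules n (induced_action a) U (induced_action b) W"
proof -
  note subU = submodule_ofD[OF irreducible_moduleD(1)[OF U]]
  note h = equivariant_mapD[OF hom]
  define K where "K = {v\<in>U. \<phi> v = 0}"
  have "cfun.subspace K"
    unfolding K_def
  proof (rule cfun.subspaceI)
    show "0 \<in> {v \<in> U. \<phi> v = 0}"
      using equivariant_map_zero[OF hom subU(1)] cfun.subspace_0[OF subU(1)] by blast
    show "x + y \<in> {v \<in> U. \<phi> v = 0}" if "x \<in> {v \<in> U. \<phi> v = 0}" "y \<in> {v \<in> U. \<phi> v = 0}" for x y
      using that cfun.subspace_add[OF subU(1)] h(2)[of x y] by simp
    show "cscale c x \<in> {v \<in> U. \<phi> v = 0}" if "x \<in> {v \<in> U. \<phi> v = 0}" for c x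
      using that cfun.subspace_scale[OF subU(1)] h(3)[of x c] by (simp only: mem_Collect_eq cscale_zero)
  qed
  moreover have "induced_action a \<pi> x \<in> K" if "\<pi> permutes {..<n}" "x \<in> K" for \<pi> x
  proof -
    have x: "x \<in> U" "\<phi> x = 0" using that(2) unfolding K_def by blast+
    have "\<phi> (induced_action a \<pi> x) = 0"
      using h(4)[OF that(1) x(1)] unfolding x(2) by (simp only: induced_action_zero)
    then show ?thesis using subU(2)[OF that(1) x(1)] unfolding K_def by blast
  qed
  ultimately have "submodule_of n (induced_action a) K"
    unfolding submodule_of_def by blast
  moreover have "K \<subseteq> U" "K \<noteq> U" using nz by (auto simp: K_def)
  ultimately have K: "K = {0}" using irreducible_moduleD(3)[OF U] by blast
  have inj: "inj_on \<phi> U"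
  proof (rule inj_onI)
    fix x y assume xy: "x \<in> U" "y \<in> U" "\<phi> x = \<phi> y"
    then have "\<phi> (x - y) = 0" using equivariant_map_diff[OF hom subU(1)] by simp
    then have "x - y \<in> K" using xy cfun.subspace_diff[OF subU(1)] unfolding K_def by blast
    then show "x = y" unfolding K by simp
  qed
  have "cfun.subspace (\<phi> ` U)"
  proof (rule cfun.subspaceI)
    show "0 \<in> \<phi> ` U"
      using equivariant_map_zero[OF hom subU(1)] cfun.subspace_0[OF subU(1)] by (metis imageI)
    show "x + y \<in> \<phi> ` U" if xy: "x \<in> \<phi> ` U" "y \<in> \<phi> ` U" for x y
    proof -
      obtain u v where "u \<in> U" "x = \<phi> u" "v \<in> U" "y = \<phi> v" using xy by blast
      then have "x + y = \<phi> (u + v)" "u + v \<in> U"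
        using h(2)[of u v] cfun.subspace_add[OF subU(1)] by simp_all
      then show ?thesis by blast
    qed
    show "cscale c x \<in> \<phi> ` U" if x: "x \<in> \<phi> ` U" for c x
    proof -
      obtain u where "u \<in> U" "x = \<phi> u" using x by blast
      then have "cscale c x = \<phi> (cscale c u)" "cscale c u \<in> U"
        using h(3)[of u c] cfun.subspace_scale[OF subU(1)] by metis+
      then show ?thesis by blast
    qed
  qed
  moreover have "induced_action b \<pi> x \<in> \<phi> ` U" if p: "\<pi> permutes {..<n}" and x: "x \<in> \<phi> ` U" for \<pi> x
  proof -
    obtain u where "u \<in> U" "x = \<phi> u" using x by blast
    then have "induced_action b \<pi> x = \<phi> (induced_action a \<pi> u)" "induced_action a \<pi> u \<in> U"
      using h(4)[OF p] subU(2)[OF p] by metis+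
    then show ?thesis by blast
  qed
  ultimately have "submodule_of n (induced_action b) (\<phi> ` U)"
    unfolding submodule_of_def by blast
  moreover have "\<phi> ` U \<subseteq> W" using h(1) by blast
  moreover have "\<phi> ` U \<noteq> {0}" using nz by blast
  ultimately have "\<phi> ` U = W" using irreducible_moduleD(3)[OF W] by blast
  then have "bij_betw \<phi> U W" using inj by (simp add: bij_betw_def)
  then show ?thesis unfolding isomorphic_modules_def using h(2-4) by blast
qed

lemma isomorphic_modules_equivariant_map:
  assumes "isomorphic_modules n \<rho> U \<sigma> W"
  obtains \<phi> where "equivariant_map n \<rho> U \<sigma> W \<phi>" "bij_betw \<phi> U W"
  using assms unfolding isomorphic_modules_def equivariant_map_def
  by (metis bij_betwE)

context permutation_rep
begin

lemma decomposition_summand_subset: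
  assumes dec: "irreducible_decomposition n act V Ws" and W: "W \<in> set Ws"
  shows "W \<subseteq> V"
proof
  fix x assume x: "x \<in> W"
  obtain i where i: "i < length Ws" "Ws ! i = W" using W by (metis in_set_conv_nth)
  define w where "w = (\<lambda>j\<in>{..<length Ws}. if j = i then x else 0)"
  have zero: "0 \<in> Ws ! j" if "j < length Ws" for j
    using dec that unfolding irreducible_decomposition_def irreducible_module_def submodule_of_def
    by (metis cfun.subspace_0 nth_mem)
  have "w \<in> (\<Pi>\<^sub>E j\<in>{..<length Ws}. Ws ! j)"
    unfolding w_def using zero x i by (auto simp only: restrict_PiE_iff split: if_splits)
  moreover have "(\<Sum>j<length Ws. w j) = (\<Sum>j<length Ws. if j = i then x else 0)"
    unfolding w_def by (rule sum.cong) (simp_all only: restrict_apply if_True)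
  then have "(\<Sum>j<length Ws. w j) = x"
    using i by (simp only: sum.delta finite_lessThan lessThan_iff if_True)
  ultimately show "x \<in> V"
    using dec unfolding irreducible_decomposition_def bij_betw_def by blast
qed

text \<open>
  The components of a vector with respect to a decomposition are unique, hence depend linearly and
  equivariantly on the vector; a nonzero vector has a nonzero component.
\<close>

lemma decomposition_projection:
  assumes V: "submodule_of n act V" and dec: "irreducible_decomposition n act V Ws"
    and v: "v \<in> V" "v \<noteq> 0"
  obtains W p where "W \<in> set Ws" "equivariant_map n act V act W p" "p v \<noteq> 0"
proof -
  define P where "P = (\<Pi>\<^sub>E j\<in>{..<length Ws}. Ws ! j)"
  define s :: "(nat \<Rightarrow> 'x \<Rightarrow> complex) \<Rightarrow> 'x \<Rightarrow> complex" where "s w = (\<Sum>i<length Ws. w i)" for w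
  have bij: "bij_betw s P V"
    using dec unfolding irreducible_decomposition_def P_def s_def by blast
  have sub: "submodule_of n act (Ws ! j)" if "j < length Ws" for j
    using dec that unfolding irreducible_decomposition_def irreducible_module_def
    by (metis nth_mem)
  define comp where "comp = inv_into P s"
  have comp: "comp u \<in> P" "s (comp u) = u" if "u \<in> V" for u
    using that bij unfolding comp_def bij_betw_def by (auto intro: inv_into_into f_inv_into_f)
  have uniq: "comp (s w) = w" if "w \<in> P" for w
    using that bij unfolding comp_def bij_betw_def by simp
  have comp_in: "comp u j \<in> Ws ! j" if "u \<in> V" "j < length Ws" for u j
    using comp(1)[OF that(1)] that(2) unfolding P_def by blast
  have mk: "restrict w {..<length Ws} \<in> P" "s (restrict w {..<length Ws}) = (\<Sum>i<length Ws. w i)"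
    if "\<And>j. j < length Ws \<Longrightarrow> w j \<in> Ws ! j" for w
    using that unfolding P_def s_def by (auto simp only: restrict_PiE_iff lessThan_iff restrict_apply' intro!: sum.cong)
  have comp_eq: "comp (\<Sum>i<length Ws. w i) j = w j"
    if "\<And>j. j < length Ws \<Longrightarrow> w j \<in> Ws ! j" "j < length Ws" for w j
    using uniq[OF mk(1)[of w]] mk(2)[of w] that by simp
  have hom: "equivariant_map n act V act (Ws ! j) (\<lambda>u. comp u j)" if j: "j < length Ws" for j
    unfolding equivariant_map_def
  proof (intro conjI ballI allI impI)
    show "comp u j \<in> Ws ! j" if "u \<in> V" for u using comp_in that j by blast
    show "comp (u + u') j = comp u j + comp u' j" if "u \<in> V" "u' \<in> V" for u u'
    proof -
      have "u + u' = (\<Sum>i<length Ws. comp u i + comp u' i)"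
        using comp(2)[OF that(1)] comp(2)[OF that(2)] unfolding s_def sum.distrib by metis
      then show ?thesis
        using comp_eq[of "\<lambda>i. comp u i + comp u' i" j] comp_in that j sub submodule_ofD(1)
        by (metis cfun.subspace_add)
    qed
    show "comp (cscale c u) j = cscale c (comp u j)" if "u \<in> V" for c u
    proof -
      have "cscale c u = (\<Sum>i<length Ws. cscale c (comp u i))"
        using comp(2)[OF that] unfolding s_def cscale_sum[symmetric] by metis
      then show ?thesis
        using comp_eq[of "\<lambda>i. cscale c (comp u i)" j] comp_in that j sub submodule_ofD(1)
        by (metis cfun.subspace_scale)
    qed
    show "comp (act \<pi> u) j = act \<pi> (comp u j)" if "\<pi> permutes {..<n}" "u \<in> V" for \<pi> u
    proof -
      have "act \<pi> u = (\<Sum>i<length Ws. act \<pi> (comp u i))"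
        using comp(2)[OF that(2)] unfolding s_def induced_action_sum[symmetric] by metis
      then show ?thesis
        using comp_eq[of "\<lambda>i. act \<pi> (comp u i)" j] comp_in that j sub submodule_ofD(2)
        by metis
    qed
  qed
  have "\<exists>j<length Ws. comp v j \<noteq> 0"
  proof (rule ccontr)
    assume "\<not> ?thesis"
    then have "s (comp v) = 0" unfolding s_def by (intro sum.neutral) blast
    then show False using comp(2)[OF v(1)] v(2) by simp
  qed
  then show ?thesis using that hom by (metis nth_mem)
qed

lemma dim_strict_mono:
  assumes "cfun.subspace W" "cfun.subspace V" "W \<subset> V" "V \<subseteq> funs_on X"
  shows "cfun.dim W < cfun.dim V"
proof -
  obtain B where B: "finite B" "B \<subseteq> W" "cfun.independent B" "cfun.span B = W" "card B = cfun.dim W"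
    using finite_basis_in_funs_on[OF finite_X assms(1)] assms(3,4) by (metis psubset_imp_subset subset_trans)
  obtain C where C: "finite C" "C \<subseteq> V" "cfun.independent C" "cfun.span C = V" "card C = cfun.dim V"
    using finite_basis_in_funs_on[OF finite_X assms(2,4)] by metis
  obtain v where v: "v \<in> V" "v \<notin> W" using assms(3) by blast
  have "v \<notin> B" using v B by blast
  have "cfun.independent (insert v B)" using v B by (simp add: cfun.independent_insert)
  then have "card (insert v B) \<le> card C"
    using cfun.independent_span_bound[OF C(1)] B(2) C(4) v assms(3) by blast
  then show ?thesis using B C \<open>v \<notin> B\<close> by simp
qed

lemma orthogonal_complement_submodule:
  assumes V: "submodule_of n act V" and U: "submodule_of n act U"
  shows "submodule_of n act {v\<in>V. \<forall>u\<in>U. inner_on X v u = 0}"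
  unfolding submodule_of_def
proof (intro conjI allI impI ballI)
  note sV = submodule_ofD[OF V] and sU = submodule_ofD[OF U]
  show "cfun.subspace {v\<in>V. \<forall>u\<in>U. inner_on X v u = 0}"
    by (rule cfun.subspaceI)
      (auto simp only: mem_Collect_eq inner_on_zero inner_on_add inner_on_scale add_0_left mult_zero_right
        intro: cfun.subspace_0[OF sV(1)] cfun.subspace_add[OF sV(1)] cfun.subspace_scale[OF sV(1)])
  fix \<pi> v assume p: "\<pi> permutes {..<n}" and v: "v \<in> {v\<in>V. \<forall>u\<in>U. inner_on X v u = 0}"
  then show "act \<pi> v \<in> {v\<in>V. \<forall>u\<in>U. inner_on X v u = 0}"
    using sV(2)[OF p] sU(2)[OF permutes_inv[OF p]] inner_act_left[OF p] by auto
qed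

lemma exists_irreducible_submodule:
  assumes V: "submodule_of n act V" "V \<subseteq> funs_on X" "V \<noteq> {0}"
  obtains U where "irreducible_module n act U" "U \<subseteq> V"
proof -
  define Q where "Q U \<longleftrightarrow> submodule_of n act U \<and> U \<subseteq> V \<and> U \<noteq> {0}" for U
  have "Q V" using V unfolding Q_def by blast
  then obtain U where U: "Q U" "\<And>W. Q W \<Longrightarrow> cfun.dim U \<le> cfun.dim W"
    using ex_has_least_nat[of Q V cfun.dim] by blast
  have "W = {0} \<or> W = U" if W: "submodule_of n act W" "W \<subseteq> U" for W
  proof (rule ccontr)
    assume *: "\<not> ?thesis"
    then have "Q W" using W U(1) unfolding Q_def by blast
    moreover have "cfun.dim W < cfun.dim U"
      using * W U(1) V(2) unfolding Q_def
      by (intro dim_strict_mono) (auto simp: submodule_of_def)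
    ultimately show False using U(2) by fastforce
  qed
  then have "irreducible_module n act U"
    using U(1) unfolding irreducible_module_def Q_def by blast
  then show ?thesis using that U(1) unfolding Q_def by blast
qed

text \<open>
  Induction on the dimension: split off a submodule of minimal positive dimension, which is
  irreducible, and continue with its orthogonal complement, which is invariant because the action
  preserves the inner product.
\<close>

theorem maschke:
  assumes "submodule_of n act V" "V \<subseteq> funs_on X"
  shows "\<exists>Ws. irreducible_decomposition n act V Ws"
  using assms
proof (induction "cfun.dim V" arbitrary: V rule: less_induct)
  case less
  note sV = submodule_ofD[OF less.prems(1)]
  show ?case
  proof (cases "V = {0}")
    case True
    have "bij_betw (\<lambda>w. \<Sum>i<length []. w i) (\<Pi>\<^sub>E i\<in>{..<length []}. [] ! i) V"
      unfolding True by (simp add: bij_betw_def PiE_empty_domain)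
    then have "irreducible_decomposition n act V []"
      unfolding irreducible_decomposition_def by simp
    then show ?thesis by blast
  next
    case False
    obtain U where U: "irreducible_module n act U" "U \<subseteq> V"
      using exists_irreducible_submodule[OF less.prems False] by blast
    note sU = submodule_ofD[OF irreducible_moduleD(1)[OF U(1)]]
    define C where "C = {v\<in>V. \<forall>u\<in>U. inner_on X v u = 0}"
    have C: "submodule_of n act C" unfolding C_def
      by (rule orthogonal_complement_submodule[OF less.prems(1) irreducible_moduleD(1)[OF U(1)]])
    note sC = submodule_ofD[OF C]
    have CV: "C \<subseteq> V" unfolding C_def by blast
    have UC: "x = 0" if "x \<in> U" "x \<in> C" for x
      using that U(2) less.prems(2) inner_on_self_eq_0[OF finite_X, of x] unfolding C_def by blast
    have "U \<noteq> {0}" using irreducible_moduleD(2)[OF U(1)] .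
    then obtain u where "u \<in> U" "u \<noteq> 0" using cfun.subspace_0[OF sU(1)] by blast
    then have "C \<subset> V" using UC CV U(2) by blast
    then have "cfun.dim C < cfun.dim V"
      using dim_strict_mono sC(1) sV(1) less.prems(2) by blast
    then obtain Ws where Ws: "irreducible_decomposition n act C Ws"
      using less.hyps C CV less.prems(2) by blast
    define l where "l = length Ws"
    define s :: "(nat \<Rightarrow> 'x \<Rightarrow> complex) \<Rightarrow> 'x \<Rightarrow> complex" where "s w = (\<Sum>i<l. w i)" for w
    define P where "P = (\<Pi>\<^sub>E i\<in>{..<l}. Ws ! i)"
    define s' :: "(nat \<Rightarrow> 'x \<Rightarrow> complex) \<Rightarrow> 'x \<Rightarrow> complex" where "s' w = (\<Sum>i<Suc l. w i)" for w
    define P' where "P' = (\<Pi>\<^sub>E i\<in>{..<Suc l}. (U # Ws) ! i)"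
    define tl_fun :: "(nat \<Rightarrow> 'x \<Rightarrow> complex) \<Rightarrow> nat \<Rightarrow> 'x \<Rightarrow> complex" where
      "tl_fun w = (\<lambda>i\<in>{..<l}. w (Suc i))" for w
    have bij: "bij_betw s P C"
      using Ws unfolding irreducible_decomposition_def l_def s_def P_def by blast
    have s': "s' w = w 0 + s (tl_fun w)" for w
      unfolding s'_def s_def tl_fun_def sum.lessThan_Suc_shift
      by (simp only: restrict_apply' cong: sum.cong)
    have tl_P: "tl_fun w \<in> P" "w 0 \<in> U" if "w \<in> P'" for w
    proof -
      have "w i \<in> (U # Ws) ! i" if "i < Suc l" for i
        using \<open>w \<in> P'\<close> that unfolding P'_def by blast
      then have "w 0 \<in> U" "\<And>i. i < l \<Longrightarrow> w (Suc i) \<in> Ws ! i" by force+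
      then show "tl_fun w \<in> P" "w 0 \<in> U"
        unfolding tl_fun_def P_def by (auto simp only: restrict_PiE_iff lessThan_iff)
    qed
    have sP: "s w \<in> C" if "w \<in> P" for w using bij that bij_betwE by blast
    have inj: "inj_on s' P'"
    proof (rule inj_onI)
      fix w w' assume w: "w \<in> P'" "w' \<in> P'" "s' w = s' w'"
      have eq: "w 0 - w' 0 = s (tl_fun w') - s (tl_fun w)"
        using w(3) unfolding s' by (simp only: algebra_simps)
      have "w 0 - w' 0 \<in> U" using tl_P w sU(1) cfun.subspace_diff by blast
      moreover have "w 0 - w' 0 \<in> C"
        unfolding eq using tl_P w sP sC(1) cfun.subspace_diff by blast
      ultimately have "w 0 - w' 0 = 0" by (rule UC)
      then have 0: "w 0 = w' 0" by simp
      then have "s (tl_fun w) = s (tl_fun w')" using w(3) unfolding s' by simp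
      then have tl: "tl_fun w = tl_fun w'"
        using bij tl_P w unfolding bij_betw_def inj_on_def by blast
      have "w i = w' i" if "i < Suc l" for i
      proof (cases i)
        case (Suc j)
        then show ?thesis using fun_cong[OF tl, of j] that unfolding tl_fun_def by simp
      qed (simp add: 0)
      then show "w = w'"
        using w(1,2) unfolding P'_def by (intro PiE_ext) auto
    qed
    have sub: "s' ` P' \<subseteq> V"
    proof
      fix v assume "v \<in> s' ` P'"
      then obtain w where w: "w \<in> P'" "v = s' w" by blast
      have "w 0 \<in> V" "s (tl_fun w) \<in> V" using tl_P[OF w(1)] sP CV U(2) by blast+
      then show "v \<in> V" unfolding w(2) s' by (rule cfun.subspace_add[OF sV(1)])
    qed
    have "V \<subseteq> s' ` P'"
    proof
      fix v assume v: "v \<in> V"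
      obtain p where p: "p \<in> U" "\<forall>w\<in>U. inner_on X (v - p) w = 0"
        using orthogonal_projection[OF finite_X sU(1)] U(2) less.prems(2) by blast
      then have "v - p \<in> C" unfolding C_def using v U(2) sV(1) cfun.subspace_diff by blast
      then have "v - p \<in> s ` P" unfolding bij_betw_imp_surj_on[OF bij] .
      then obtain w where w: "w \<in> P" "v - p = s w" by blast
      define w' where "w' = (\<lambda>i\<in>{..<Suc l}. case i of 0 \<Rightarrow> p | Suc j \<Rightarrow> w j)"
      have "w' \<in> P'"
        unfolding w'_def P'_def restrict_PiE_iff
        using p(1) PiE_mem[OF w(1)[unfolded P_def]] by (auto split: nat.split)
      have "tl_fun w' = w"
      proof (rule ext)
        fix i show "tl_fun w' i = w i"
        proof (cases "i < l")
          case False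
          then have "w i = undefined" using PiE_arb[OF w(1)[unfolded P_def], of i] by simp
          then show ?thesis using False unfolding tl_fun_def by simp
        qed (simp add: tl_fun_def w'_def)
      qed
      then have "s' w' = w' 0 + (v - p)"
        unfolding s' w(2) by simp
      moreover have "w' 0 = p" unfolding w'_def by simp
      ultimately have "s' w' = v" by simp
      with \<open>w' \<in> P'\<close> show "v \<in> s' ` P'" by blast
    qed
    then have "bij_betw s' P' V" using inj sub by (simp add: bij_betw_def subset_antisym)
    then have "irreducible_decomposition n act V (U # Ws)"
      using U(1) Ws unfolding irreducible_decomposition_def s'_def P'_def l_def by simp
    then show ?thesis by blast
  qed
qed

text \<open>
  The multiplicity is defined by an arbitrary choice of a decomposition. Its positivity does not
  depend on the choice: a submodule isomorphic to \<open>U\<close> projects nontrivially to a summand of any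
  decomposition, and by Schur's lemma that summand is isomorphic to \<open>U\<close> as well.
\<close>

lemma multiplicity_pos_iff:
  assumes V: "submodule_of n act V" "V \<subseteq> funs_on X"
    and U: "irreducible_module n (induced_action b) U"
  shows "0 < multiplicity_in n (induced_action b) U act V \<longleftrightarrow>
    (\<exists>W. irreducible_module n act W \<and> W \<subseteq> V \<and> isomorphic_modules n (induced_action b) U act W)"
proof -
  let ?iso = "\<lambda>W. isomorphic_modules n (induced_action b) U act W"
  have "\<exists>m Ws. irreducible_decomposition n act V Ws \<and> m = length (filter ?iso Ws)"
    using maschke[OF V] by blast
  from someI_ex[OF this] obtain Ws where Ws: "irreducible_decomposition n act V Ws"
    "multiplicity_in n (induced_action b) U act V = length (filter ?iso Ws)"
    unfolding multiplicity_in_def by blast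
  show ?thesis
  proof
    assume "0 < multiplicity_in n (induced_action b) U act V"
    then have "filter ?iso Ws \<noteq> []" unfolding Ws(2) by simp
    then obtain W where "W \<in> set Ws" "?iso W" by (auto simp: filter_empty_conv)
    then show "\<exists>W. irreducible_module n act W \<and> W \<subseteq> V \<and> ?iso W"
      using decomposition_summand_subset[OF Ws(1)] Ws(1) unfolding irreducible_decomposition_def by blast
  next
    assume "\<exists>W. irreducible_module n act W \<and> W \<subseteq> V \<and> ?iso W"
    then obtain W where W: "irreducible_module n act W" "W \<subseteq> V" "?iso W" by blast
    obtain \<phi> where \<phi>: "equivariant_map n (induced_action b) U act W \<phi>" "bij_betw \<phi> U W"
      using isomorphic_modules_equivariant_map[OF W(3)] by blast
    obtain x where x: "x \<in> W" "x \<noteq> 0"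
      using irreducible_moduleD(2)[OF W(1)] cfun.subspace_0[OF submodule_ofD(1)[OF irreducible_moduleD(1)[OF W(1)]]]
      by blast
    then obtain u where u: "u \<in> U" "\<phi> u = x" using \<phi>(2) unfolding bij_betw_def by blast
    obtain W' p where p: "W' \<in> set Ws" "equivariant_map n act V act W' p" "p x \<noteq> 0"
      using decomposition_projection[OF V(1) Ws(1), of x] x W(2) by blast
    have "equivariant_map n (induced_action b) U act W' (p \<circ> \<phi>)"
      using equivariant_map_comp[OF \<phi>(1) equivariant_map_subset[OF p(2) W(2)]] .
    moreover have "irreducible_module n act W'"
      using p(1) Ws(1) unfolding irreducible_decomposition_def by blast
    ultimately have "?iso W'"
      using schur_lemma[OF U, of a W' "p \<circ> \<phi>" u] u p(3) by simp
    then have "filter ?iso Ws \<noteq> []" using p(1) by (auto simp: filter_empty_conv)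
    then show "0 < multiplicity_in n (induced_action b) U act V" unfolding Ws(2) by simp
  qed
qed

end


section \<open>Fibre-preserving permutations\<close>

text \<open>
  Column groups, row groups and Young subgroups are all of this form, with \<open>c\<close> the column, the row or
  the block of an entry.
\<close>

definition fibre_perms :: "nat set \<Rightarrow> (nat \<Rightarrow> 'c) \<Rightarrow> (nat \<Rightarrow> nat) set" where
  "fibre_perms N c = {\<pi>. \<pi> permutes N \<and> (\<forall>x\<in>N. c (\<pi> x) = c x)}"

lemma fibre_permsD:
  assumes "\<pi> \<in> fibre_perms N c"
  shows "\<pi> permutes N" "x \<in> N \<Longrightarrow> c (\<pi> x) = c x"
  using assms by (auto simp: fibre_perms_def)

lemma finite_fibre_perms: "finite N \<Longrightarrow> finite (fibre_perms N c)"
  by (rule finite_subset[OF _ finite_permutations[of N]]) (auto simp: fibre_perms_def)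

lemma id_fibre_perms: "id \<in> fibre_perms N c"
  by (simp add: fibre_perms_def)

lemma comp_fibre_perms:
  assumes "\<pi> \<in> fibre_perms N c" "\<sigma> \<in> fibre_perms N c"
  shows "\<pi> \<circ> \<sigma> \<in> fibre_perms N c"
  using assms permutes_in_image[of \<sigma> N] by (auto simp: fibre_perms_def permutes_compose)

lemma inv_fibre_perms:
  assumes "\<pi> \<in> fibre_perms N c"
  shows "pinv \<pi> \<in> fibre_perms N c"
  unfolding fibre_perms_def
proof (intro CollectI conjI ballI)
  note p = fibre_permsD[OF assms]
  show "pinv \<pi> permutes N" using p(1) by (rule permutes_inv)
  fix x assume "x \<in> N"
  then have "pinv \<pi> x \<in> N" using permutes_in_image[OF permutes_inv[OF p(1)]] by blast
  then show "c (pinv \<pi> x) = c x" using p(2)[of "pinv \<pi> x"] permutes_inverses(1)[OF p(1)] by simp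
qed

lemma sum_fibre_perms_left:
  assumes s: "\<sigma> \<in> fibre_perms N c"
  shows "(\<Sum>\<pi>\<in>fibre_perms N c. f (\<sigma> \<circ> \<pi>)) = (\<Sum>\<pi>\<in>fibre_perms N c. f \<pi>)"
proof (rule sum.reindex_bij_witness[where i = "\<lambda>\<pi>. pinv \<sigma> \<circ> \<pi>" and j = "\<lambda>\<pi>. \<sigma> \<circ> \<pi>"])
  note p = fibre_permsD(1)[OF s]
  show "pinv \<sigma> \<circ> (\<sigma> \<circ> \<pi>) = \<pi>" "\<sigma> \<circ> (pinv \<sigma> \<circ> \<pi>) = \<pi>" for \<pi> :: "nat \<Rightarrow> nat"
    by (simp_all add: fun_eq_iff permutes_inverses[OF p])
qed (auto intro: comp_fibre_perms s inv_fibre_perms)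

lemma sum_fibre_perms_right:
  assumes s: "\<sigma> \<in> fibre_perms N c"
  shows "(\<Sum>\<pi>\<in>fibre_perms N c. f (\<pi> \<circ> \<sigma>)) = (\<Sum>\<pi>\<in>fibre_perms N c. f \<pi>)"
proof (rule sum.reindex_bij_witness[where i = "\<lambda>\<pi>. \<pi> \<circ> pinv \<sigma>" and j = "\<lambda>\<pi>. \<pi> \<circ> \<sigma>"])
  note p = fibre_permsD(1)[OF s]
  show "(\<pi> \<circ> \<sigma>) \<circ> pinv \<sigma> = \<pi>" "(\<pi> \<circ> pinv \<sigma>) \<circ> \<sigma> = \<pi>" for \<pi> :: "nat \<Rightarrow> nat"
    by (simp_all add: fun_eq_iff permutes_inverses[OF p])
qed (auto intro: comp_fibre_perms s inv_fibre_perms)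

lemma permutation_fibre_perms:
  assumes "finite N" "\<pi> \<in> fibre_perms N c"
  shows "permutation \<pi>"
  unfolding permutation_permutes using assms(1) fibre_permsD(1)[OF assms(2)] by blast

lemma sign_comp_fibre_perms:
  assumes "finite N" "\<pi> \<in> fibre_perms N c" "\<sigma> \<in> fibre_perms N d"
  shows "sign (\<pi> \<circ> \<sigma>) = sign \<pi> * sign \<sigma>"
  by (rule sign_compose[OF permutation_fibre_perms[OF assms(1,2)] permutation_fibre_perms[OF assms(1,3)]])

lemma fibre_perms_cong:
  assumes "\<And>x y. x \<in> N \<Longrightarrow> y \<in> N \<Longrightarrow> c x = c y \<longleftrightarrow> d x = d y"
  shows "fibre_perms N c = fibre_perms N d"
proof -
  have "c (\<pi> x) = c x \<longleftrightarrow> d (\<pi> x) = d x" if "\<pi> permutes N" "x \<in> N" for \<pi> x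
    using assms[of "\<pi> x" x] permutes_in_image[OF that(1), of x] that(2) by simp
  then show ?thesis unfolding fibre_perms_def by blast
qed


lemma permutes_Un_split:
  assumes p: "\<pi> permutes A \<union> B" and fin: "finite A" and disj: "A \<inter> B = {}"
    and pA: "\<And>x. x \<in> A \<Longrightarrow> \<pi> x \<in> A"
  obtains \<alpha> \<beta> where "\<alpha> permutes A" "\<beta> permutes B" "\<pi> = \<alpha> \<circ> \<beta>"
proof -
  define \<alpha> where "\<alpha> x = (if x \<in> A then \<pi> x else x)" for x
  have a: "\<alpha> permutes A"
  proof (rule bij_imp_permutes)
    have "\<alpha> ` A \<subseteq> A" using pA by (auto simp: \<alpha>_def)
    moreover have "inj_on \<alpha> A" using permutes_inj_on[OF p, of A] by (simp add: \<alpha>_def inj_on_def)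
    ultimately show "bij_betw \<alpha> A A" using endo_inj_surj[OF fin] by (simp add: bij_betw_def)
  qed (simp add: \<alpha>_def)
  define \<beta> where "\<beta> = pinv \<alpha> \<circ> \<pi>"
  have AU: "A \<subseteq> A \<union> B" by blast
  have "\<beta> permutes A \<union> B"
    unfolding \<beta>_def by (rule permutes_compose[OF p permutes_subset[OF permutes_inv[OF a] AU]])
  moreover have "\<beta> x = x" if "x \<in> A \<union> B - B" for x
  proof -
    have "x \<in> A" using that by blast
    then have "\<beta> x = pinv \<alpha> (\<alpha> x)" by (simp add: \<beta>_def \<alpha>_def)
    then show ?thesis using permutes_inverses(2)[OF a] by simp
  qed
  ultimately have "\<beta> permutes B" using permutes_superset[of \<beta> "A \<union> B" B] by blast
  moreover have "\<pi> = \<alpha> \<circ> \<beta>" unfolding \<beta>_def by (simp add: fun_eq_iff permutes_inverses(1)[OF a])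
  ultimately show ?thesis using that a by blast
qed

section \<open>Exchanging a set with part of another one\<close>

text \<open>
  For \<open>b\<close> injective on \<open>J\<close> with image disjoint from \<open>J\<close>, this is the product of the commuting
  transpositions \<open>(a (b a))\<close>, \<open>a \<in> J\<close>.
\<close>

definition swap_all :: "nat set \<Rightarrow> (nat \<Rightarrow> nat) \<Rightarrow> nat \<Rightarrow> nat" where
  "swap_all J b x = (if x \<in> J then b x else if x \<in> b ` J then inv_into J b x else x)"

lemma swap_all_empty: "swap_all {} b = id"
  by (rule ext) (simp add: swap_all_def)

lemma swap_all_insert:
  assumes "a \<notin> J" "inj_on b (insert a J)" "insert a J \<inter> b ` insert a J = {}"
  shows "swap_all (insert a J) b = swap_all J b \<circ> transpose a (b a)"
proof
  fix x
  have inv: "inv_into (insert a J) b (b y) = y" if "y \<in> insert a J" for y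
    using assms(2) that by (rule inv_into_f_f)
  have inv': "inv_into J b (b y) = y" if "y \<in> J" for y
    using assms(2) that by (auto intro!: inv_into_f_f intro: inj_on_subset)
  have ba: "b a \<notin> b ` J" "b a \<notin> J" "a \<notin> b ` J" "b a \<noteq> a" using assms by auto
  consider "x = a" | "x = b a" | "x \<in> J" | y where "y \<in> J" "x = b y" | "x \<notin> insert a J" "x \<notin> b ` insert a J"
    by blast
  then show "swap_all (insert a J) b x = (swap_all J b \<circ> transpose a (b a)) x"
  proof cases
    case 1
    then show ?thesis using ba by (auto simp: swap_all_def)
  next
    case 2
    show ?thesis unfolding 2 by (simp add: swap_all_def ba inv assms(1) del: image_insert)
  next
    case 3
    then show ?thesis using ba assms by (auto simp: swap_all_def transpose_def)
  next
    case (4 y)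
    then have "x \<in> b ` J" by blast
    then have "x \<noteq> a" "x \<noteq> b a" "x \<notin> insert a J" using ba(1,3) assms(3) by blast+
    moreover have "inv_into (insert a J) b x = y" "inv_into J b x = y"
      using inv[of y] inv'[of y] 4 by auto
    ultimately show ?thesis using 4 by (auto simp: swap_all_def transpose_def)
  next
    case 5
    then show ?thesis by (auto simp: swap_all_def transpose_def)
  qed
qed

lemma swap_all_permutes:
  assumes "finite J" "inj_on b J" "J \<inter> b ` J = {}"
  shows "swap_all J b permutes (J \<union> b ` J) \<and> sign (swap_all J b) = (- 1) ^ card J"
  using assms
proof (induction J rule: finite_induct)
  case empty
  show ?case unfolding swap_all_empty
    by (simp only: permutes_id sign_id card.empty power_0 simp_thms)
next
  case (insert a J)
  have IH: "swap_all J b permutes (J \<union> b ` J)" "sign (swap_all J b) = (- 1) ^ card J"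
    using insert by auto
  have eq: "swap_all (insert a J) b = swap_all J b \<circ> transpose a (b a)"
    using insert by (intro swap_all_insert) auto
  have "b a \<noteq> a" using insert.prems by auto
  have sw: "swap_all J b permutes (insert a J \<union> b ` insert a J)"
    using IH(1) by (rule permutes_subset) auto
  have tr: "transpose a (b a) permutes (insert a J \<union> b ` insert a J)"
    by (rule permutes_swap_id) auto
  have p: "permutation (swap_all J b)"
  proof -
    have "finite (J \<union> b ` J)" using insert.hyps(1) by simp
    then show ?thesis using IH(1) unfolding permutation_permutes by blast
  qed
  have "sign (swap_all (insert a J) b) = (- 1) ^ card (insert a J)"
    unfolding eq sign_compose[OF p permutation_swap_id] IH(2) sign_swap_id
    using insert.hyps \<open>b a \<noteq> a\<close> by simp
  then show ?case using permutes_compose[OF tr sw] unfolding eq by blast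
qed

lemma swap_all_involution:
  assumes "inj_on b J" "J \<inter> b ` J = {}"
  shows "swap_all J b (swap_all J b x) = x"
proof -
  have "inv_into J b (b y) = y" if "y \<in> J" for y
    using assms(1) that by (rule inv_into_f_f)
  then show ?thesis using assms(2) by (auto simp: swap_all_def)
qed

lemma swap_all_cong:
  assumes "\<And>x. x \<in> J \<Longrightarrow> b x = d x"
  shows "swap_all J b = swap_all J d"
proof -
  have "b ` J = d ` J" using assms by simp
  moreover have "inv_into J b = inv_into J d"
    unfolding inv_into_def using assms by (intro ext arg_cong[where f = Eps]) auto
  ultimately show ?thesis using assms by (auto simp: swap_all_def fun_eq_iff)
qed

section \<open>Every module contains a nonzero polytabloid image\<close>

context permutation_rep
begin

definition alt :: "nat set \<Rightarrow> (nat \<Rightarrow> 'c) \<Rightarrow> ('x \<Rightarrow> complex) \<Rightarrow> 'x \<Rightarrow> complex" where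
  "alt N c f = (\<Sum>\<pi>\<in>fibre_perms N c. cscale (of_int (sign \<pi>)) (act \<pi> f))"

definition sym :: "nat set \<Rightarrow> ('x \<Rightarrow> complex) \<Rightarrow> 'x \<Rightarrow> complex" where
  "sym J f = (\<Sum>\<sigma> | \<sigma> permutes J. act \<sigma> f)"

definition fixed_by :: "nat set \<Rightarrow> ('x \<Rightarrow> complex) \<Rightarrow> bool" where
  "fixed_by A h \<longleftrightarrow> (\<forall>\<pi>. \<pi> permutes A \<longrightarrow> act \<pi> h = h)"

text \<open>
  The symmetric group of \<open>insert e J\<close> is the union of the cosets \<open>(e j) S_J\<close>, and for \<open>j \<in> J\<close> the coset
  \<open>(e j) S_J\<close> equals \<open>S_K (e j)\<close> with \<open>K = insert e (J - {j})\<close>.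
\<close>

lemma sym_insert:
  assumes "finite J" "e \<notin> J" "insert e J \<subseteq> {..<n}"
  shows "sym (insert e J) h = sym J h + (\<Sum>j\<in>J. sym (insert e (J - {j})) (act (transpose e j) h))"
proof -
  have tr: "transpose e j permutes {..<n}" if "j \<in> J" for j
    using assms that by (intro permutes_swap_id) auto
  have inner: "(\<Sum>q | q permutes J. act (transpose e j \<circ> q) h) = sym (insert e (J - {j})) (act (transpose e j) h)"
    if j: "j \<in> J" for j
    unfolding sym_def
  proof (rule sum.reindex_bij_witness[where i = "\<lambda>p. transpose e j \<circ> p \<circ> transpose e j"
        and j = "\<lambda>p. transpose e j \<circ> p \<circ> transpose e j"])
    have set_eq: "transpose e j ` J = insert e (J - {j})" "transpose e j ` insert e (J - {j}) = J"
      using j assms(2) by (auto simp: transpose_def)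
    have conj: "transpose e j \<circ> p \<circ> transpose e j permutes (transpose e j ` S)" if "p permutes S" for p S
    proof (rule bij_imp_permutes)
      let ?t = "transpose e j"
      have "bij_betw ?t S (?t ` S)" by (simp add: bij_betw_def)
      moreover have "bij_betw ?t (?t ` S) S" by (simp add: bij_betw_def image_comp)
      ultimately show "bij_betw (?t \<circ> p \<circ> ?t) (?t ` S) (?t ` S)"
        using permutes_imp_bij[OF that] bij_betw_trans by metis
      show "(?t \<circ> p \<circ> ?t) x = x" if "x \<notin> ?t ` S" for x
      proof -
        have "?t x \<notin> S" using that by (metis imageI transpose_involutory)
        then show ?thesis using permutes_not_in[OF \<open>p permutes S\<close>] by simp
      qed
    qed
    show "transpose e j \<circ> q \<circ> transpose e j \<in> {p. p permutes insert e (J - {j})}"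
      if "q \<in> {p. p permutes J}" for q
      using conj[of q J] that set_eq by simp
    show "transpose e j \<circ> q \<circ> transpose e j \<in> {p. p permutes J}"
      if "q \<in> {p. p permutes insert e (J - {j})}" for q
      using conj[of q "insert e (J - {j})"] that set_eq by simp
    show "transpose e j \<circ> (transpose e j \<circ> q \<circ> transpose e j) \<circ> transpose e j = q" for q :: "nat \<Rightarrow> nat"
      by (simp add: fun_eq_iff)
    then show "transpose e j \<circ> (transpose e j \<circ> q \<circ> transpose e j) \<circ> transpose e j = q" for q :: "nat \<Rightarrow> nat" .
    show "act (transpose e j \<circ> q \<circ> transpose e j) (act (transpose e j) h) = act (transpose e j \<circ> q) h"
      if "q \<in> {p. p permutes J}" for q
    proof -
      have "q permutes {..<n}" using that assms(3) by (auto intro: permutes_subset)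
      then have "act (transpose e j \<circ> q \<circ> transpose e j) (act (transpose e j) h)
          = act ((transpose e j \<circ> q \<circ> transpose e j) \<circ> transpose e j) h"
        using tr[OF j] by (intro act_comp[symmetric] permutes_compose)
      also have "(transpose e j \<circ> q \<circ> transpose e j) \<circ> transpose e j = transpose e j \<circ> q"
        by (simp add: fun_eq_iff)
      finally show ?thesis .
    qed
  qed
  have "sym (insert e J) h = (\<Sum>j\<in>insert e J. \<Sum>q | q permutes J. act (transpose e j \<circ> q) h)"
    unfolding sym_def by (rule sum_over_permutations_insert[OF assms(1,2)])
  also have "\<dots> = sym J h + (\<Sum>j\<in>J. \<Sum>q | q permutes J. act (transpose e j \<circ> q) h)"
    unfolding sum.insert[OF assms(1,2)] sym_def by (simp only: transpose_same id_comp)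
  also have "(\<Sum>j\<in>J. \<Sum>q | q permutes J. act (transpose e j \<circ> q) h)
      = (\<Sum>j\<in>J. sym (insert e (J - {j})) (act (transpose e j) h))"
    by (rule sum.cong[OF refl inner])
  finally show ?thesis .
qed

text \<open>
  Up to the positive factor \<open>|J|!\<close>, symmetrisation is an orthogonal projection.
\<close>

lemma inner_sym_nonneg:
  assumes "J \<subseteq> {..<n}"
  shows "0 \<le> Re (inner_on X (sym J h) h)"
proof -
  have perm: "\<sigma> permutes {..<n}" if "\<sigma> permutes J" for \<sigma>
    using that assms by (rule permutes_subset)
  have fin: "finite J" using assms finite_subset by blast
  have fixed: "act \<sigma> (sym J h) = sym J h" if s: "\<sigma> permutes J" for \<sigma>
  proof -
    have "act \<sigma> (sym J h) = (\<Sum>\<pi> | \<pi> permutes J. act (\<sigma> \<circ> \<pi>) h)"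
      unfolding sym_def induced_action_sum
      by (rule sum.cong) (simp_all only: mem_Collect_eq act_comp perm s)
    also have "\<dots> = sym J h"
      unfolding sym_def by (rule setum_permutations_compose_left[OF s, symmetric])
    finally show ?thesis .
  qed
  have "inner_on X (sym J h) (sym J h) = (\<Sum>\<sigma> | \<sigma> permutes J. inner_on X (sym J h) (act \<sigma> h))"
    by (subst (2) sym_def) (rule inner_on_sum_right)
  also have "\<dots> = (\<Sum>\<sigma> | \<sigma> permutes J. inner_on X (sym J h) h)"
  proof (rule sum.cong[OF refl])
    fix \<sigma> assume "\<sigma> \<in> {\<sigma>. \<sigma> permutes J}"
    then have s: "\<sigma> permutes J" by simp
    show "inner_on X (sym J h) (act \<sigma> h) = inner_on X (sym J h) h"
      using inner_act[OF perm[OF s], of "sym J h" h] fixed[OF s] by simp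
  qed
  also have "\<dots> = of_nat (fact (card J)) * inner_on X (sym J h) h"
    using card_permutations[OF refl fin] by simp
  finally have "Re (inner_on X (sym J h) (sym J h)) = fact (card J) * Re (inner_on X (sym J h) h)"
    by simp
  then have nonneg: "0 \<le> (fact (card J) :: real) * Re (inner_on X (sym J h) h)"
    using inner_on_self_nonneg[of X "sym J h"] by (simp only:)
  show ?thesis
  proof (rule ccontr)
    assume "\<not> ?thesis"
    then have "(fact (card J) :: real) * Re (inner_on X (sym J h) h) < 0"
      by (intro mult_pos_neg) simp_all
    then show False using nonneg by linarith
  qed
qed

text \<open>
  The sum is fixed by all permutations of \<open>insert e A\<close>, because the transpositions \<open>(e x)\<close> represent
  the cosets of the stabilizer of \<open>e\<close>. So it vanishes if \<open>H\<close> has no nonzero vector with this symmetry.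
\<close>

lemma sum_transposed_eq_zero:
  assumes H: "cfun.subspace H" and A: "finite A" "insert e A \<subseteq> {..<n}" "e \<notin> A"
    and closed: "\<And>\<pi> h. \<pi> permutes insert e A \<Longrightarrow> h \<in> H \<Longrightarrow> act \<pi> h \<in> H"
    and maximal: "\<And>h. h \<in> H \<Longrightarrow> fixed_by (insert e A) h \<Longrightarrow> h = 0"
    and h: "h \<in> H" "fixed_by A h"
  shows "h + (\<Sum>x\<in>A. act (transpose e x) h) = 0"
proof -
  define z where "z = (\<Sum>x\<in>insert e A. act (transpose e x) h)"
  have tr: "transpose e x permutes insert e A" if "x \<in> insert e A" for x
    using that by (intro permutes_swap_id) auto
  note sub = permutes_subset[OF _ A(2)]
  have "z \<in> H" unfolding z_def using closed tr h(1) by (intro cfun.subspace_sum[OF H]) blast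
  moreover have "fixed_by (insert e A) z"
    unfolding fixed_by_def
  proof (intro allI impI)
    fix \<sigma> assume s: "\<sigma> permutes insert e A"
    have "act \<sigma> (act (transpose e x) h) = act (transpose e (\<sigma> x)) h" if x: "x \<in> insert e A" for x
    proof -
      have sx: "\<sigma> x \<in> insert e A" using s x permutes_in_image by metis
      define \<tau> where "\<tau> = transpose e (\<sigma> x) \<circ> \<sigma> \<circ> transpose e x"
      have "\<tau> permutes insert e A"
        unfolding \<tau>_def using s tr[OF x] tr[OF sx] by (intro permutes_compose)
      moreover have "\<tau> e = e" by (simp add: \<tau>_def)
      ultimately have "\<tau> permutes A" using permutes_superset[of \<tau> "insert e A" A] by blast
      then have "act \<tau> h = h" using h(2) by (simp add: fixed_by_def)
      have eq: "\<sigma> \<circ> transpose e x = transpose e (\<sigma> x) \<circ> \<tau>"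
        by (simp add: \<tau>_def fun_eq_iff)
      have "act \<sigma> (act (transpose e x) h) = act (\<sigma> \<circ> transpose e x) h"
        using s tr[OF x] by (intro act_comp[symmetric] sub)
      also have "\<dots> = act (transpose e (\<sigma> x)) (act \<tau> h)"
        unfolding eq using tr[OF sx] \<open>\<tau> permutes insert e A\<close> by (intro act_comp sub)
      finally show ?thesis using \<open>act \<tau> h = h\<close> by simp
    qed
    then have "act \<sigma> z = (\<Sum>x\<in>insert e A. act (transpose e (\<sigma> x)) h)"
      unfolding z_def induced_action_sum by (rule sum.cong[OF refl])
    also have "\<dots> = z"
      unfolding z_def using sum.reindex_bij_betw[OF permutes_imp_bij[OF s], of "\<lambda>x. act (transpose e x) h"] .
    finally show "act \<sigma> z = z" .
  qed
  ultimately have "z = 0" by (rule maximal)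
  moreover have "z = h + (\<Sum>x\<in>A. act (transpose e x) h)"
    unfolding z_def sum.insert[OF A(1,3)] by (simp only: transpose_same act_id)
  ultimately show ?thesis by simp
qed

text \<open>
  On vectors fixed by \<open>A\<close>, and after pairing with a vector fixed by \<open>A\<close>, exchanging \<open>J\<close> with \<open>|J|\<close>
  elements of \<open>A\<close> acts like \<open>(-1)\<^sup>|\<^sup>J\<^sup>|\<close> times the symmetrisation over \<open>J\<close>, divided by a falling factorial
  of \<open>|A|\<close>. The induction applies the relation \<open>rel\<close> to a new element \<open>e\<close>. The \<open>|A| - |J|\<close> terms with
  \<open>x\<close> outside \<open>b ` J\<close> all equal the wanted one, by invariance under \<open>A\<close>. A term with \<open>x = b j\<close> is an
  exchange of the set obtained from \<open>J\<close> by replacing \<open>j\<close> with \<open>e\<close>, applied after the transposition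
  \<open>(e j)\<close>; these terms assemble to the symmetrisation over \<open>insert e J\<close> by \<open>sym_insert\<close>.
\<close>

lemma inner_swap_all:
  assumes A: "finite A" "A \<subseteq> {..<n}" and u: "fixed_by A u"
    and Z: "Z \<subseteq> {..<n}" "Z \<inter> A = {}"
    and rel: "\<And>h e. P h \<Longrightarrow> e \<in> Z \<Longrightarrow> h + (\<Sum>x\<in>A. act (transpose e x) h) = 0"
    and P_closed: "\<And>h \<pi>. P h \<Longrightarrow> \<pi> permutes Z \<Longrightarrow> P (act \<pi> h)"
    and fixed: "\<And>h. P h \<Longrightarrow> fixed_by A h"
    and J: "finite J" "J \<subseteq> Z" "inj_on b J" "b ` J \<subseteq> A" and h: "P h"
  shows "of_nat (\<Prod>i<card J. card A - i) * inner_on X (act (swap_all J b) h) u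
    = (- 1) ^ card J * inner_on X (sym J h) u"
  using J h
proof (induction "card J" arbitrary: J b h)
  case 0
  have "J = {}" by (rule iffD1[OF card_0_eq[OF 0(2)] 0(1)[symmetric]])
  moreover have "sym {} h = h" unfolding sym_def permutes_empty by simp
  ultimately show ?case
    by (simp only: swap_all_empty act_id card.empty lessThan_0 prod.empty of_nat_1 power_0)
next
  case (Suc r)
  obtain e J0 where J0: "J = insert e J0" "e \<notin> J0" "card J0 = r"
    using Suc.hyps(2)[symmetric] unfolding card_Suc_eq by blast
  note prems = Suc.prems[unfolded J0(1)]
  have fin: "finite J0" and aZ: "e \<in> Z" and J0Z: "J0 \<subseteq> Z" and inj: "inj_on b J0" and bJ0: "b ` J0 \<subseteq> A"
    and baA: "b e \<in> A" "b e \<notin> b ` J0"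
    using prems J0(2) by auto
  have disj: "J0 \<inter> A = {}" "e \<notin> A" "insert e J0 \<inter> A = {}" using J0Z aZ Z(2) by auto
  have sw: "swap_all K d permutes {..<n}" if "finite K" "K \<subseteq> Z" "inj_on d K" "d ` K \<subseteq> A" for K d
  proof -
    have 1: "K \<inter> d ` K = {}" using that Z(2) by blast
    have 2: "K \<union> d ` K \<subseteq> {..<n}" using that Z(1) A(2) by blast
    show ?thesis
      by (rule permutes_subset[OF conjunct1[OF swap_all_permutes[OF that(1,3) 1]] 2])
  qed
  define g where "g = swap_all J0 b"
  have g: "g permutes {..<n}" unfolding g_def by (rule sw[OF fin J0Z inj bJ0])
  have tr: "transpose e x permutes {..<n}" if "x \<in> A \<union> Z" for x
    using that A(2) Z(1) aZ by (intro permutes_swap_id) auto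
  define E where "E = inner_on X (act (swap_all J b) h) u"
  define F where "F = (\<Prod>i<r. card A - i)"
  \<comment> \<open>Apply the exchange \<open>g\<close> of \<open>J0\<close> to the relation for \<open>e\<close> and pair with \<open>u\<close>.\<close>
  have zero: "inner_on X (act g h) u + (\<Sum>x\<in>A. inner_on X (act (g \<circ> transpose e x) h) u) = 0"
  proof -
    have "inner_on X (act g (h + (\<Sum>x\<in>A. act (transpose e x) h))) u = 0"
      unfolding rel[OF prems(5) aZ] by (simp only: induced_action_zero inner_on_zero)
    moreover have "act g (act (transpose e x) h) = act (g \<circ> transpose e x) h" if "x \<in> A" for x
      using that g tr by (simp only: act_comp Un_iff simp_thms)
    ultimately show ?thesis
      unfolding induced_action_add induced_action_sum inner_on_add inner_on_sum by simp
  qed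
  \<comment> \<open>Replacing the partner \<open>x\<close> of \<open>e\<close> by \<open>b e\<close> is conjugation by \<open>(x (b e))\<close>, which fixes \<open>h\<close> and \<open>u\<close>.\<close>
  have free: "inner_on X (act (g \<circ> transpose e x) h) u = E" if x: "x \<in> A - b ` J0" for x
  proof -
    define d where "d = b(e := x)"
    have dJ: "d y = b y" if "y \<in> J0" for y using that J0(2) by (auto simp: d_def)
    have d: "inj_on d J" "d ` J \<subseteq> A"
      unfolding J0(1) using inj x bJ0 J0(2) by (auto simp: d_def inj_on_def)
    have "swap_all J d = swap_all J0 d \<circ> transpose e (d e)"
      unfolding J0(1) using d disj J0(2) unfolding J0(1) by (intro swap_all_insert) auto
    also have "swap_all J0 d = g" unfolding g_def by (rule swap_all_cong) (rule dJ)
    finally have "swap_all J d = g \<circ> transpose e (d e)" .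
    moreover have "d e = x" by (simp add: d_def)
    ultimately have gd: "g \<circ> transpose e x = swap_all J d" by (simp only:)
    define s where "s = transpose x (b e)"
    have s: "s permutes A" unfolding s_def using x baA by (intro permutes_swap_id) auto
    then have sn: "s permutes {..<n}" using A(2) by (rule permutes_subset)
    have ss: "s (s y) = y" for y by (simp add: s_def)
    have "swap_all J b = s \<circ> swap_all J d \<circ> s"
    proof
      fix y
      have bs: "b z = s (d z)" if "z \<in> J" for z
      proof (cases "z = e")
        case False
        then have "z \<in> J0" using that J0 by simp
        then have "b z \<in> b ` J0" by (rule imageI)
        then have "b z \<noteq> x" "b z \<noteq> b e" using x baA(2) by (metis DiffD2)+
        then have "s (b z) = b z" unfolding s_def by (intro transpose_apply_other) simp_all
        moreover have "d z = b z" using False by (simp add: d_def)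
        ultimately show ?thesis by (simp only:)
      qed (simp add: d_def s_def)
      have sJ: "s z = z" if "z \<in> J" for z
      proof -
        have "z \<notin> A" using that disj(3) unfolding J0(1) by blast
        then have "z \<noteq> x" "z \<noteq> b e" using x baA by blast+
        then show ?thesis unfolding s_def by (intro transpose_apply_other) simp_all
      qed
      have inJ: "s y \<in> J \<longleftrightarrow> y \<in> J" using sJ[of y] sJ[of "s y"] ss[of y] by auto
      have img: "y \<in> b ` J \<longleftrightarrow> s y \<in> d ` J"
      proof
        assume "y \<in> b ` J"
        then obtain z where "z \<in> J" "y = b z" by blast
        then have "s y = d z" using bs ss by simp
        then show "s y \<in> d ` J" using \<open>z \<in> J\<close> by blast
      next
        assume "s y \<in> d ` J"
        then obtain z where "z \<in> J" "s y = d z" by blast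
        then have "y = b z" using bs[of z] ss[of y] by simp
        then show "y \<in> b ` J" using \<open>z \<in> J\<close> by blast
      qed
      have invs: "inv_into J b y = s (inv_into J d (s y))" if yb: "y \<in> b ` J"
      proof -
        obtain z where z: "z \<in> J" "y = b z" using yb by blast
        have 1: "inv_into J b y = z" unfolding z(2) by (rule inv_into_f_f[OF Suc.prems(3) z(1)])
        have sy: "s y = d z" unfolding z(2) bs[OF z(1)] by (rule ss)
        have 2: "inv_into J d (s y) = z" unfolding sy by (rule inv_into_f_f[OF d(1) z(1)])
        show ?thesis unfolding 1 2 using sJ[OF z(1)] by simp
      qed
      show "swap_all J b y = (s \<circ> swap_all J d \<circ> s) y"
      proof (cases "y \<in> J")
        case True
        then show ?thesis using bs[of y] sJ[of y] by (simp add: swap_all_def)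
      next
        case F: False
        then have "s y \<notin> J" using inJ by simp
        then show ?thesis using F img invs ss[of y] by (simp add: swap_all_def)
      qed
    qed
    then have "act (swap_all J b) h = act s (act (swap_all J d) (act s h))"
      using sn sw[OF Suc.prems(1,2) d] by (simp only: act_comp permutes_compose)
    also have "act s h = h" using fixed[OF Suc.prems(5)] s by (simp add: fixed_by_def)
    finally have "E = inner_on X (act s (act (swap_all J d) h)) u" by (simp add: E_def)
    also have "\<dots> = inner_on X (act s (act (swap_all J d) h)) (act s u)"
      using u s by (simp add: fixed_by_def)
    also have "\<dots> = inner_on X (act (swap_all J d) h) u" by (rule inner_act[OF sn])
    finally show ?thesis unfolding gd ..
  qed
  \<comment> \<open>Here \<open>(j (b j)) (e (b j)) = (e (b j)) (e j)\<close>, so the exchange now involves \<open>e\<close> instead of \<open>j\<close>.\<close>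
  have hit: "of_nat F * inner_on X (act (g \<circ> transpose e (b j)) h) u
      = (- 1) ^ r * inner_on X (sym (insert e (J0 - {j})) (act (transpose e j) h)) u" if j: "j \<in> J0" for j
  proof -
    define K where "K = J0 - {j}"
    define d where "d = b(e := b j)"
    have bj: "b j \<notin> b ` K" using inj j unfolding K_def inj_on_def by blast
    have dK: "d y = b y" if "y \<in> K" for y using that J0(2) by (auto simp: d_def K_def)
    have aK: "e \<notin> K" using J0(2) by (auto simp: K_def)
    have dinj: "inj_on d (insert e K)"
    proof -
      have "inj_on b K" using inj by (rule inj_on_subset) (auto simp: K_def)
      then have "inj_on d K" using dK by (simp cong: inj_on_cong)
      moreover have "d ` K = b ` K" using dK by simp
      ultimately show ?thesis using bj aK by (simp add: d_def)
    qed
    have dA: "d ` insert e K \<subseteq> A" using bJ0 j by (auto simp: d_def K_def)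
    have K: "finite (insert e K)" "insert e K \<subseteq> Z" "card (insert e K) = r"
    proof -
      show "finite (insert e K)" "insert e K \<subseteq> Z" using fin aZ J0Z by (auto simp: K_def)
      have "card (insert e K) = Suc (card K)" using fin aK by (simp add: K_def)
      also have "\<dots> = r" unfolding K_def using card_Suc_Diff1[OF fin j] J0(3) by simp
      finally show "card (insert e K) = r" .
    qed
    have jK: "insert j K = J0" using j by (auto simp: K_def)
    have "swap_all (insert e K) d = swap_all K d \<circ> transpose e (d e)"
      using aK dinj dA K(2) Z(2) by (intro swap_all_insert) auto
    also have "swap_all K d = swap_all K b" by (rule swap_all_cong) (rule dK)
    finally have "swap_all (insert e K) d = swap_all K b \<circ> transpose e (d e)" .
    moreover have "d e = b j" by (simp add: d_def)
    ultimately have e1: "swap_all (insert e K) d = swap_all K b \<circ> transpose e (b j)" by (simp only:)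
    have "swap_all (insert j K) b = swap_all K b \<circ> transpose j (b j)"
    proof (rule swap_all_insert)
      show "j \<notin> K" by (simp add: K_def)
      show "inj_on b (insert j K)" using inj unfolding jK .
      show "insert j K \<inter> b ` insert j K = {}" using bJ0 disj(1) unfolding jK by blast
    qed
    then have e2: "g = swap_all K b \<circ> transpose j (b j)"
      unfolding jK g_def .
    have ne: "e \<noteq> b j" "e \<noteq> j" "j \<noteq> b j" using j bJ0 disj J0(2) by auto
    have "transpose j (b j) \<circ> transpose e (b j) = transpose e (b j) \<circ> transpose e j"
      using ne by (auto simp: fun_eq_iff transpose_def)
    then have "g \<circ> transpose e (b j) = swap_all (insert e K) d \<circ> transpose e j"
      unfolding e1 e2 by (simp only: o_assoc[symmetric])
    then have "act (g \<circ> transpose e (b j)) h = act (swap_all (insert e K) d) (act (transpose e j) h)"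
      using act_comp[OF sw[OF K(1,2) dinj dA] tr[of j]] j J0Z by auto
    moreover have "P (act (transpose e j) h)"
      using P_closed[OF Suc.prems(5)] aZ J0Z j by (auto intro: permutes_swap_id)
    ultimately show ?thesis
      using Suc.hyps(1)[of "insert e K" d "act (transpose e j) h"] K dinj dA
      unfolding F_def K_def by simp
  qed
  have base: "of_nat F * inner_on X (act g h) u = (- 1) ^ r * inner_on X (sym J0 h) u"
    using Suc.hyps(1)[of J0 b h] J0(3) fin J0Z inj bJ0 Suc.prems(5) unfolding F_def g_def by simp
  have cardA: "card (A - b ` J0) = card A - r"
    using card_Diff_subset[of "b ` J0" A] bJ0 fin J0(3) card_image[OF inj] by simp
  have split: "(\<Sum>x\<in>A. inner_on X (act (g \<circ> transpose e x) h) u)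
      = of_nat (card A - r) * E + (\<Sum>j\<in>J0. inner_on X (act (g \<circ> transpose e (b j)) h) u)"
  proof -
    have "(\<Sum>x\<in>A. inner_on X (act (g \<circ> transpose e x) h) u)
        = (\<Sum>x\<in>A - b ` J0. inner_on X (act (g \<circ> transpose e x) h) u)
          + (\<Sum>x\<in>b ` J0. inner_on X (act (g \<circ> transpose e x) h) u)"
      using sum.subset_diff[OF bJ0 A(1)] .
    also have "(\<Sum>x\<in>A - b ` J0. inner_on X (act (g \<circ> transpose e x) h) u) = (\<Sum>x\<in>A - b ` J0. E)"
      by (rule sum.cong[OF refl free])
    also have "\<dots> = of_nat (card A - r) * E" by (simp add: cardA)
    also have "(\<Sum>x\<in>b ` J0. inner_on X (act (g \<circ> transpose e x) h) u)
        = (\<Sum>j\<in>J0. inner_on X (act (g \<circ> transpose e (b j)) h) u)"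
      using sum.reindex[OF inj] by (simp add: o_def)
    finally show ?thesis .
  qed
  have "of_nat F * (of_nat (card A - r) * E)
      = - (of_nat F * inner_on X (act g h) u)
        - (\<Sum>j\<in>J0. of_nat F * inner_on X (act (g \<circ> transpose e (b j)) h) u)"
  proof -
    have "of_nat (card A - r) * E = - inner_on X (act g h) u
        - (\<Sum>j\<in>J0. inner_on X (act (g \<circ> transpose e (b j)) h) u)"
      using zero unfolding split by (simp add: algebra_simps eq_neg_iff_add_eq_0)
    then show ?thesis by (simp only: right_diff_distrib mult_minus_right sum_distrib_left)
  qed
  also have "(\<Sum>j\<in>J0. of_nat F * inner_on X (act (g \<circ> transpose e (b j)) h) u)
      = (\<Sum>j\<in>J0. (- 1) ^ r * inner_on X (sym (insert e (J0 - {j})) (act (transpose e j) h)) u)"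
    by (rule sum.cong[OF refl hit])
  also have "- (of_nat F * inner_on X (act g h) u) - \<dots>
      = (- 1) ^ Suc r * (inner_on X (sym J0 h) u
          + (\<Sum>j\<in>J0. inner_on X (sym (insert e (J0 - {j})) (act (transpose e j) h)) u))"
    unfolding base sum_distrib_left[symmetric] by (simp add: algebra_simps)
  also have "inner_on X (sym J0 h) u
          + (\<Sum>j\<in>J0. inner_on X (sym (insert e (J0 - {j})) (act (transpose e j) h)) u)
      = inner_on X (sym J h) u"
  proof -
    have "insert e J0 \<subseteq> {..<n}" using aZ J0Z Z(1) by auto
    from sym_insert[OF fin J0(2) this, of h] show ?thesis
      unfolding J0(1) inner_on_add[symmetric] inner_on_sum[symmetric] by simp
  qed
  finally have main: "of_nat F * (of_nat (card A - r) * E) = (- 1) ^ Suc r * inner_on X (sym J h) u" .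
  have P: "(\<Prod>i<Suc r. card A - i) = F * (card A - r)"
    unfolding F_def by simp
  show ?case
    unfolding Suc.hyps(2)[symmetric] P of_nat_mult mult.assoc E_def[symmetric] by (rule main)
qed


lemma alt_submodule:
  assumes H: "cfun.subspace H" and closed: "\<And>\<pi> h. \<pi> permutes N \<Longrightarrow> h \<in> H \<Longrightarrow> act \<pi> h \<in> H"
    and h: "h \<in> H"
  shows "alt N c h \<in> H"
  unfolding alt_def
  by (intro cfun.subspace_sum[OF H] cfun.subspace_scale[OF H] closed h) (rule fibre_permsD(1))

lemma fixed_by_act_disjoint:
  assumes A: "A \<subseteq> {..<n}" and B: "B \<subseteq> {..<n}" "A \<inter> B = {}"
    and p: "\<pi> permutes B" and h: "fixed_by A h"
  shows "fixed_by A (act \<pi> h)"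
  unfolding fixed_by_def
proof (intro allI impI)
  fix \<sigma> assume s: "\<sigma> permutes A"
  have pn: "\<pi> permutes {..<n}" and sn: "\<sigma> permutes {..<n}"
    using permutes_subset[OF p B(1)] permutes_subset[OF s A] by blast+
  have "\<sigma> \<circ> \<pi> = \<pi> \<circ> \<sigma>"
  proof
    fix x
    have in_B: "\<pi> x \<notin> A" if "x \<in> B" using permutes_in_image[OF p, of x] that B(2) by blast
    have in_A: "\<sigma> x \<notin> B" if "x \<in> A" using permutes_in_image[OF s, of x] that B(2) by blast
    consider "x \<in> A" "x \<notin> B" | "x \<in> B" "x \<notin> A" | "x \<notin> A" "x \<notin> B" using B(2) by blast
    then show "(\<sigma> \<circ> \<pi>) x = (\<pi> \<circ> \<sigma>) x"
      by cases (simp_all add: permutes_not_in[OF p] permutes_not_in[OF s] in_A in_B)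
  qed
  then have "act \<sigma> (act \<pi> h) = act \<pi> (act \<sigma> h)"
    using act_comp[OF sn pn] act_comp[OF pn sn] by metis
  then show "act \<sigma> (act \<pi> h) = act \<pi> h" using h s by (simp add: fixed_by_def)
qed

lemma subspace_fixed_by:
  assumes H: "cfun.subspace H"
  shows "cfun.subspace {h. h \<in> H \<and> fixed_by A h}"
  by (rule cfun.subspaceI)
    (simp_all add: fixed_by_def induced_action_add induced_action_scale
      cfun.subspace_0[OF H] cfun.subspace_add[OF H] cfun.subspace_scale[OF H] del: plus_fun_apply)

text \<open>
  Every column-preserving permutation of \<open>Y\<close> factors uniquely as one of \<open>Y - A\<close> followed by an
  exchange of a set \<open>J\<close> with the elements of \<open>A\<close> in the same columns; \<open>J\<close> consists of the elements
  outside \<open>A\<close> that are images of elements of \<open>A\<close>, so it has at most one element in each column.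
\<close>

lemma alt_add_top_row:
  assumes Y: "Y \<subseteq> {..<n}" and A: "A \<subseteq> Y" and inj: "inj_on c A"
    and top: "\<And>y. y \<in> Y - A \<Longrightarrow> c y \<in> c ` A"
  defines "b \<equiv> \<lambda>y. inv_into A c (c y)"
  shows "alt Y c w =
    (\<Sum>J\<in>{J. J \<subseteq> Y - A \<and> inj_on c J}. cscale ((- 1) ^ card J) (act (swap_all J b) (alt (Y - A) c w)))"
proof -
  define \<J> where "\<J> = {J. J \<subseteq> Y - A \<and> inj_on c J}"
  have finY: "finite Y" using Y finite_subset by blast
  have b: "b y \<in> A" "c (b y) = c y" if "y \<in> Y - A" for y
    unfolding b_def using top[OF that] by (auto intro: inv_into_into f_inv_into_f)
  have b_unique: "b y = x" if "y \<in> Y - A" "x \<in> A" "c x = c y" for x y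
    using inj_onD[OF inj, of "b y" x] b[OF that(1)] that by simp
  have J: "finite J" "J \<inter> b ` J = {}" "inj_on b J" "J \<subseteq> Y - A" "J \<union> b ` J \<subseteq> Y" if "J \<in> \<J>" for J
  proof -
    show 1: "J \<subseteq> Y - A" using that by (simp add: \<J>_def)
    show "finite J" using 1 finY by (meson finite_Diff finite_subset)
    show "J \<inter> b ` J = {}" "J \<union> b ` J \<subseteq> Y" using 1 b(1) A by blast+
    show "inj_on b J"
    proof (rule inj_onI)
      fix x y assume "x \<in> J" "y \<in> J" "b x = b y"
      then have "c x = c y" using b(2) 1 by (metis subsetD)
      then show "x = y" using that \<open>x \<in> J\<close> \<open>y \<in> J\<close> unfolding \<J>_def inj_on_def by blast
    qed
  qed
  have sw: "swap_all J b \<in> fibre_perms Y c" "sign (swap_all J b) = (- 1) ^ card J" if "J \<in> \<J>" for J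
  proof -
    have p: "swap_all J b permutes (J \<union> b ` J)" and s: "sign (swap_all J b) = (- 1) ^ card J"
      using swap_all_permutes[OF J(1,3,2)[OF that]] by blast+
    show "sign (swap_all J b) = (- 1) ^ card J" by (rule s)
    have "c (swap_all J b x) = c x" for x
    proof -
      consider "x \<in> J" | y where "y \<in> J" "x = b y" | "x \<notin> J" "x \<notin> b ` J" by blast
      then show ?thesis
      proof cases
        case 1
        then show ?thesis using b(2) J(4)[OF that] by (auto simp: swap_all_def)
      next
        case (2 y)
        then have "x \<notin> J" using J(2)[OF that] by blast
        moreover have "inv_into J b x = y" unfolding 2(2) by (rule inv_into_f_f[OF J(3)[OF that] 2(1)])
        ultimately show ?thesis using 2 b(2)[of y] J(4)[OF that] by (auto simp: swap_all_def)
      qed (simp add: swap_all_def)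
    qed
    then show "swap_all J b \<in> fibre_perms Y c"
      unfolding fibre_perms_def using permutes_subset[OF p J(5)[OF that]] by simp
  qed
  have low: "\<pi> \<in> fibre_perms Y c" "\<And>x. x \<in> A \<Longrightarrow> \<pi> x = x" if "\<pi> \<in> fibre_perms (Y - A) c" for \<pi>
  proof -
    note p = fibre_permsD[OF that]
    show "\<pi> x = x" if "x \<in> A" for x using permutes_not_in[OF p(1), of x] that by blast
    moreover have "\<pi> permutes Y" using permutes_subset[OF p(1)] by blast
    ultimately show "\<pi> \<in> fibre_perms Y c" unfolding fibre_perms_def using p(2) by fastforce
  qed
  have recover: "J = {y \<in> Y - A. \<exists>x\<in>A. (swap_all J b \<circ> \<pi>) x = y}"
    if JJ: "J \<in> \<J>" and p: "\<pi> \<in> fibre_perms (Y - A) c" for J \<pi>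
  proof -
    have e: "(swap_all J b \<circ> \<pi>) x = swap_all J b x" if "x \<in> A" for x using low(2)[OF p that] by simp
    have AJ: "x \<notin> J" if "x \<in> A" for x using J(4)[OF JJ] that by blast
    show ?thesis
    proof (intro equalityI subsetI)
      fix y assume y: "y \<in> J"
      have "swap_all J b (b y) = y"
        using AJ[OF b(1), of y] y J(4)[OF JJ] inv_into_f_f[OF J(3)[OF JJ] y] by (auto simp: swap_all_def)
      moreover have "y \<in> Y - A" using y J(4)[OF JJ] by blast
      ultimately show "y \<in> {y \<in> Y - A. \<exists>x\<in>A. (swap_all J b \<circ> \<pi>) x = y}"
        using e[OF b(1)] b(1) by (metis (mono_tags, lifting) mem_Collect_eq)
    next
      fix y assume "y \<in> {y \<in> Y - A. \<exists>x\<in>A. (swap_all J b \<circ> \<pi>) x = y}"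
      then obtain x where x: "x \<in> A" "y \<notin> A" "swap_all J b x = y" using e by auto
      then have "x \<in> b ` J" using AJ[OF x(1)] by (auto simp: swap_all_def split: if_splits)
      then have "inv_into J b x \<in> J" by (rule inv_into_into)
      then show "y \<in> J" using x AJ[OF x(1)] \<open>x \<in> b ` J\<close> by (simp add: swap_all_def)
    qed
  qed
  have invol: "swap_all J b (swap_all J b x) = x" if "J \<in> \<J>" for J x
    using swap_all_involution[OF J(3,2)[OF that]] .
  have bij: "bij_betw (\<lambda>(J, \<pi>). swap_all J b \<circ> \<pi>) (\<J> \<times> fibre_perms (Y - A) c) (fibre_perms Y c)"
    unfolding bij_betw_def
  proof
    show "inj_on (\<lambda>(J, \<pi>). swap_all J b \<circ> \<pi>) (\<J> \<times> fibre_perms (Y - A) c)"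
    proof (rule inj_onI, clarify)
      fix J \<pi> K \<sigma> assume h: "J \<in> \<J>" "\<pi> \<in> fibre_perms (Y - A) c" "K \<in> \<J>" "\<sigma> \<in> fibre_perms (Y - A) c"
        "swap_all J b \<circ> \<pi> = swap_all K b \<circ> \<sigma>"
      have JK: "J = K"
        by (rule trans[OF recover[OF h(1,2), unfolded h(5)] recover[OF h(3,4), symmetric]])
      have "\<pi> x = \<sigma> x" for x
      proof -
        have "swap_all J b (\<pi> x) = swap_all J b (\<sigma> x)"
          using fun_cong[OF h(5), of x] unfolding JK o_apply .
        then have "swap_all J b (swap_all J b (\<pi> x)) = swap_all J b (swap_all J b (\<sigma> x))"
          by (rule arg_cong)
        then show ?thesis unfolding invol[OF h(1)] .
      qed
      then show "J = K \<and> \<pi> = \<sigma>" using JK by blast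
    qed
    show "(\<lambda>(J, \<pi>). swap_all J b \<circ> \<pi>) ` (\<J> \<times> fibre_perms (Y - A) c) = fibre_perms Y c"
    proof (intro equalityI subsetI)
      fix \<pi> assume "\<pi> \<in> (\<lambda>(J, \<pi>). swap_all J b \<circ> \<pi>) ` (\<J> \<times> fibre_perms (Y - A) c)"
      then obtain J \<sigma> where "J \<in> \<J>" "\<sigma> \<in> fibre_perms (Y - A) c" "\<pi> = swap_all J b \<circ> \<sigma>" by auto
      then show "\<pi> \<in> fibre_perms Y c" using comp_fibre_perms[OF sw(1) low(1)] by simp
    next
      fix \<pi> assume p: "\<pi> \<in> fibre_perms Y c"
      note pD = fibre_permsD[OF p]
      have pY: "\<pi> x \<in> Y" if "x \<in> Y" for x using permutes_in_image[OF pD(1)] that by blast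
      define J where "J = \<pi> ` A - A"
      have "inj_on c J"
      proof (rule inj_onI)
        fix y y' assume "y \<in> J" "y' \<in> J" and eq: "c y = c y'"
        then obtain x x' where x: "x \<in> A" "y = \<pi> x" "x' \<in> A" "y' = \<pi> x'" unfolding J_def by blast
        have "c (\<pi> x) = c x" "c (\<pi> x') = c x'" using pD(2) subsetD[OF A] x(1,3) by blast+
        then have "c x = c x'" using eq x(2,4) by simp
        then show "y = y'" using inj_onD[OF inj] x by blast
      qed
      then have JJ: "J \<in> \<J>" unfolding \<J>_def J_def using pY A by blast
      define \<tau> where "\<tau> = swap_all J b \<circ> \<pi>"
      have t: "\<tau> \<in> fibre_perms Y c" unfolding \<tau>_def by (rule comp_fibre_perms[OF sw(1)[OF JJ] p])
      have tA: "\<tau> x = x" if x: "x \<in> A" for x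
      proof (cases "\<pi> x \<in> A")
        case True
        have cx: "c (\<pi> x) = c x" using pD(2) x A by blast
        then have px: "\<pi> x = x" using inj_onD[OF inj] True x by blast
        have "x \<notin> J" using x by (simp add: J_def)
        moreover have "x \<notin> b ` J"
        proof
          assume "x \<in> b ` J"
          then obtain x' where x': "x' \<in> A" "\<pi> x' \<in> J" "x = b (\<pi> x')" unfolding J_def by blast
          have "\<pi> x' \<in> Y - A" using x'(2) J(4)[OF JJ] by blast
          then have "c x = c (\<pi> x')" using b(2) x'(3) by simp
          moreover have "c (\<pi> x') = c x'" using pD(2) x'(1) A by blast
          ultimately have "c x = c x'" by simp
          then have "x = x'" by (rule inj_onD[OF inj _ x x'(1)])
          then show False using x'(2) px \<open>x \<notin> J\<close> by metis
        qed
        ultimately show ?thesis unfolding \<tau>_def by (simp add: px swap_all_def)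
      next
        case False
        then have y: "\<pi> x \<in> J" using x by (simp add: J_def)
        have "\<pi> x \<in> Y - A" using y J(4)[OF JJ] by blast
        moreover have "c x = c (\<pi> x)" using pD(2) x A by (metis subsetD)
        ultimately have "b (\<pi> x) = x" using b_unique x by blast
        then show ?thesis unfolding \<tau>_def using y by (simp add: swap_all_def)
      qed
      have "\<tau> permutes Y - A"
        using permutes_superset[OF fibre_permsD(1)[OF t], of "Y - A"] tA by blast
      then have t': "\<tau> \<in> fibre_perms (Y - A) c"
        using fibre_permsD(2)[OF t] unfolding fibre_perms_def by blast
      have "\<pi> = swap_all J b \<circ> \<tau>" unfolding \<tau>_def by (simp add: fun_eq_iff invol[OF JJ])
      then show "\<pi> \<in> (\<lambda>(J, \<pi>). swap_all J b \<circ> \<pi>) ` (\<J> \<times> fibre_perms (Y - A) c)"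
        using JJ t' by force
    qed
  qed
  have perm_n: "\<pi> permutes {..<n}" if "\<pi> \<in> fibre_perms Y c" for \<pi>
    using permutes_subset[OF fibre_permsD(1)[OF that] Y] .
  have "alt Y c w = (\<Sum>(J, \<pi>)\<in>\<J> \<times> fibre_perms (Y - A) c.
      cscale (of_int (sign (swap_all J b \<circ> \<pi>))) (act (swap_all J b \<circ> \<pi>) w))"
    unfolding alt_def using sum.reindex_bij_betw[OF bij, symmetric, of "\<lambda>\<pi>. cscale (of_int (sign \<pi>)) (act \<pi> w)"]
    by (simp only: case_prod_beta')
  also have "\<dots> = (\<Sum>J\<in>\<J>. \<Sum>\<pi>\<in>fibre_perms (Y - A) c.
      cscale (of_int (sign (swap_all J b \<circ> \<pi>))) (act (swap_all J b \<circ> \<pi>) w))"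
    by (rule sum.cartesian_product[symmetric])
  also have "\<dots> = (\<Sum>J\<in>\<J>. cscale ((- 1) ^ card J) (act (swap_all J b) (alt (Y - A) c w)))"
  proof (rule sum.cong[OF refl])
    fix J assume JJ: "J \<in> \<J>"
    have "cscale (of_int (sign (swap_all J b \<circ> \<pi>))) (act (swap_all J b \<circ> \<pi>) w)
        = cscale ((- 1) ^ card J) (act (swap_all J b) (cscale (of_int (sign \<pi>)) (act \<pi> w)))"
      if "\<pi> \<in> fibre_perms (Y - A) c" for \<pi>
      unfolding sign_comp_fibre_perms[OF finY sw(1)[OF JJ] low(1)[OF that]] sw(2)[OF JJ] induced_action_scale
        act_comp[OF perm_n[OF sw(1)[OF JJ]] perm_n[OF low(1)[OF that]]] cscale_cscale by simp
    then show "(\<Sum>\<pi>\<in>fibre_perms (Y - A) c.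
        cscale (of_int (sign (swap_all J b \<circ> \<pi>))) (act (swap_all J b \<circ> \<pi>) w))
        = cscale ((- 1) ^ card J) (act (swap_all J b) (alt (Y - A) c w))"
      unfolding alt_def induced_action_sum cscale_sum by (rule sum.cong[OF refl])
  qed
  finally show ?thesis unfolding \<J>_def .
qed

text \<open>
  Pair the expansion of \<open>alt_add_top_row\<close> with \<open>u = alt (Y - A) c w\<close>. By \<open>inner_swap_all\<close> the two
  occurrences of \<open>(-1)\<^sup>|\<^sup>J\<^sup>|\<close> cancel and all summands are nonnegative; the one for \<open>J = {}\<close> is the squared
  norm of \<open>u\<close>, which is positive.
\<close>

lemma alt_add_top_row_nonzero:
  assumes Y: "Y \<subseteq> {..<n}" and A: "A \<subseteq> Y" and inj: "inj_on c A"
    and top: "\<And>y. y \<in> Y - A \<Longrightarrow> c y \<in> c ` A"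
    and H: "cfun.subspace H" "H \<subseteq> funs_on X"
    and closed: "\<And>\<pi> h. \<pi> permutes Y \<Longrightarrow> h \<in> H \<Longrightarrow> act \<pi> h \<in> H"
    and maximal: "\<And>B h. B \<subseteq> Y \<Longrightarrow> card A < card B \<Longrightarrow> h \<in> H \<Longrightarrow> fixed_by B h \<Longrightarrow> h = 0"
    and w: "w \<in> H" "fixed_by A w" "alt (Y - A) c w \<noteq> 0"
  shows "alt Y c w \<noteq> 0"
proof
  assume zero: "alt Y c w = 0"
  define P where "P h \<longleftrightarrow> h \<in> H \<and> fixed_by A h" for h
  define u where "u = alt (Y - A) c w"
  define b where "b = (\<lambda>y. inv_into A c (c y))"
  define \<J> where "\<J> = {J. J \<subseteq> Y - A \<and> inj_on c J}"
  have finY: "finite Y" and An: "A \<subseteq> {..<n}" using Y A finite_subset by blast+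
  have finA: "finite A" using finY A finite_subset by blast
  have P_closed: "P (act \<pi> h)" if "P h" "\<pi> permutes Y - A" for \<pi> h
    using that fixed_by_act_disjoint[OF An _ _ that(2)] Y closed[OF permutes_subset[OF that(2)]]
    unfolding P_def by blast
  have Psub: "cfun.subspace {h. P h}"
    unfolding P_def by (rule subspace_fixed_by[OF H(1)])
  have Pu: "P u"
    using alt_submodule[OF Psub, of "Y - A" w c] P_closed w(1,2) unfolding u_def P_def by blast
  have rel: "h + (\<Sum>x\<in>A. act (transpose e x) h) = 0" if Ph: "P h" and e: "e \<in> Y - A" for h e
  proof (rule sum_transposed_eq_zero[OF H(1) finA])
    have eA: "insert e A \<subseteq> Y" using e A by blast
    show "insert e A \<subseteq> {..<n}" "e \<notin> A" using eA Y e by blast+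
    show "act \<pi> g \<in> H" if "\<pi> permutes insert e A" "g \<in> H" for \<pi> g
      using closed[OF permutes_subset[OF that(1) eA] that(2)] .
    show "g = 0" if "g \<in> H" "fixed_by (insert e A) g" for g
      using maximal[OF eA _ that] e finA by simp
  qed (use Ph in \<open>auto simp: P_def\<close>)
  have J: "inj_on b J" "b ` J \<subseteq> A" "finite J" "J \<subseteq> Y - A" if JJ: "J \<in> \<J>" for J
  proof -
    show 1: "J \<subseteq> Y - A" using JJ by (simp add: \<J>_def)
    show "finite J" using 1 finY by (meson finite_Diff finite_subset)
    have b: "b y \<in> A" "c (b y) = c y" if "y \<in> J" for y
      unfolding b_def using top[of y] that 1 by (auto intro: inv_into_into f_inv_into_f)
    then show "b ` J \<subseteq> A" by blast
    show "inj_on b J"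
    proof (rule inj_onI)
      fix x y assume xy: "x \<in> J" "y \<in> J" "b x = b y"
      then have "c x = c y" using b(2)[of x] b(2)[of y] by simp
      then show "x = y" using JJ xy unfolding \<J>_def inj_on_def by blast
    qed
  qed
  define D where "D J = (\<Prod>i<card J. card A - i)" for J :: "nat set"
  have D: "0 < D J" if "J \<in> \<J>" for J
  proof -
    have "card J \<le> card A" using card_inj_on_le[OF J(1,2)[OF that] finA] .
    then show ?thesis unfolding D_def by (auto intro!: prod_pos)
  qed
  have summand: "inner_on X (cscale ((- 1) ^ card J) (act (swap_all J b) u)) u
      = inner_on X (sym J u) u / of_nat (D J)" if JJ: "J \<in> \<J>" for J
  proof -
    have "of_nat (D J) * inner_on X (act (swap_all J b) u) u = (- 1) ^ card J * inner_on X (sym J u) u"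
      unfolding D_def
      by (rule inner_swap_all[where P = P and Z = "Y - A", OF finA An])
        (use Pu Y rel P_closed J[OF JJ] in \<open>auto simp: P_def\<close>)
    then have "inner_on X (act (swap_all J b) u) u = (- 1) ^ card J * inner_on X (sym J u) u / of_nat (D J)"
      using D[OF JJ] by (simp add: field_simps)
    then show ?thesis unfolding inner_on_scale by (simp flip: power_add mult_2 power_mult_distrib)
  qed
  have expand: "alt Y c w = (\<Sum>J\<in>\<J>. cscale ((- 1) ^ card J) (act (swap_all J b) u))"
    unfolding \<J>_def b_def u_def by (rule alt_add_top_row[OF Y A inj top])
  have "0 = inner_on X (alt Y c w) u" unfolding zero by simp
  also have "\<dots> = (\<Sum>J\<in>\<J>. inner_on X (sym J u) u / of_nat (D J))"
    unfolding expand inner_on_sum by (rule sum.cong[OF refl summand])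
  finally have "(\<Sum>J\<in>\<J>. Re (inner_on X (sym J u) u) / real (D J)) = 0"
    by (simp add: complex_eq_iff Re_divide_of_nat)
  moreover have "finite \<J>" unfolding \<J>_def using finY by simp
  moreover have "{} \<in> \<J>" unfolding \<J>_def by simp
  moreover have nn: "0 \<le> Re (inner_on X (sym J u) u) / real (D J)" if "J \<in> \<J>" for J
    using inner_sym_nonneg[of J u] J(4)[OF that] Y by (intro divide_nonneg_nonneg) auto
  ultimately have "Re (inner_on X (sym {} u) u) / real (D {}) = 0"
    using sum_nonneg_eq_0_iff[of \<J> "\<lambda>J. Re (inner_on X (sym J u) u) / real (D J)"] by simp
  then have "Re (inner_on X u u) = 0" unfolding D_def sym_def permutes_empty by simp
  moreover have "u \<in> funs_on X" using Pu H(2) unfolding P_def by blast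
  ultimately show False using inner_on_self_pos[OF finite_X, of u] w(3) unfolding u_def by simp
qed

end


definition down_closed :: "(nat \<times> nat) set \<Rightarrow> bool" where
  "down_closed D \<longleftrightarrow> (\<forall>i j i' j'. (i, j) \<in> D \<longrightarrow> i' \<le> i \<longrightarrow> j' \<le> j \<longrightarrow> (i', j') \<in> D)"

lemma down_closedD: "down_closed D \<Longrightarrow> (i, j) \<in> D \<Longrightarrow> i' \<le> i \<Longrightarrow> j' \<le> j \<Longrightarrow> (i', j') \<in> D"
  unfolding down_closed_def by blast

context permutation_rep
begin

lemma alt_zero [simp]: "alt N c 0 = 0"
  unfolding alt_def by (simp only: induced_action_zero cscale_zero sum.neutral_const)

text \<open>
  The tableau is recorded by the positions \<open>t y\<close> of its entries. Its first row is a largest set \<open>A\<close>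
  such that \<open>H\<close> contains a nonzero vector fixed by all permutations of \<open>A\<close>; the other rows come from
  the induction hypothesis for \<open>Y - A\<close> acting on the vectors fixed by \<open>A\<close>. Maximality of \<open>A\<close> also
  guarantees that the next row is not longer than \<open>A\<close>, so the result has the shape of a partition.
\<close>

theorem exists_nonzero_polytabloid_image:
  assumes "Y \<subseteq> {..<n}" "cfun.subspace H" "H \<subseteq> funs_on X" "H \<noteq> {0}"
    and "\<And>\<pi> h. \<pi> permutes Y \<Longrightarrow> h \<in> H \<Longrightarrow> act \<pi> h \<in> H"
  shows "\<exists>t w. inj_on t Y \<and> down_closed (t ` Y) \<and> w \<in> H \<and>
    (\<forall>\<pi>\<in>fibre_perms Y (fst \<circ> t). act \<pi> w = w) \<and> alt Y (snd \<circ> t) w \<noteq> 0"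
  using assms
proof (induction "card Y" arbitrary: Y H rule: less_induct)
  case less
  note Y = less.prems(1) and H = less.prems(2,3) and closed = less.prems(5)
  obtain h0 where h0: "h0 \<in> H" "h0 \<noteq> 0" using less.prems(4) cfun.subspace_0[OF H(1)] by blast
  have finY: "finite Y" using Y finite_subset by blast
  show ?case
  proof (cases "Y = {}")
    case True
    have fib: "fibre_perms {} c = {id}" for c :: "nat \<Rightarrow> nat"
      unfolding fibre_perms_def by auto
    have alt: "alt {} c h0 = h0" for c :: "nat \<Rightarrow> nat"
      unfolding alt_def fib
      by (simp only: sum.insert finite.emptyI empty_iff not_False_eq_True sum.empty act_id sign_id of_int_1
          cscale_one add_0_right)
    define t :: "nat \<Rightarrow> nat \<times> nat" where "t = (\<lambda>_. (0, 0))"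
    have "\<forall>\<pi>\<in>fibre_perms {} (fst \<circ> t). act \<pi> h0 = h0"
      unfolding fib by (simp only: ball_simps act_id simp_thms)
    moreover have "alt {} (snd \<circ> t) h0 \<noteq> 0" unfolding alt by (rule h0(2))
    moreover have "inj_on t {}" "down_closed (t ` {})" by (simp_all add: down_closed_def)
    ultimately show ?thesis unfolding True using h0(1) by blast
  next
    case False
    define S where "S = {A. A \<subseteq> Y \<and> (\<exists>h\<in>H. h \<noteq> 0 \<and> fixed_by A h)}"
    obtain y0 where y0: "y0 \<in> Y" using False by blast
    have "fixed_by {y0} h0" by (simp add: fixed_by_def)
    then have y0S: "{y0} \<in> S" unfolding S_def using y0 h0 by blast
    have "finite S" unfolding S_def using finY by simp
    then have fin: "finite (card ` S)" and ne: "card ` S \<noteq> {}" using y0S by blast+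
    obtain A where A: "A \<in> S" "card A = Max (card ` S)" using Max_in[OF fin ne] by force
    have max: "card B \<le> card A" if "B \<in> S" for B
      using Max_ge[OF fin, of "card B"] that A(2) by simp
    have AY: "A \<subseteq> Y" using A(1) by (simp add: S_def)
    have finA: "finite A" using AY finY finite_subset by blast
    have "1 \<le> card A" using max[OF y0S] by simp
    then have "A \<noteq> {}" by auto
    then have smaller: "card (Y - A) < card Y" using AY finY by (intro psubset_card_mono) auto
    define H' where "H' = {h. h \<in> H \<and> fixed_by A h}"
    have H': "cfun.subspace H'" "H' \<subseteq> funs_on X" "H' \<noteq> {0}"
      unfolding H'_def using subspace_fixed_by[OF H(1)] H(2) A(1) by (auto simp: S_def)
    have An: "A \<subseteq> {..<n}" and YA: "Y - A \<subseteq> {..<n}" using AY Y by blast+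
    have "act \<pi> h \<in> H'" if p: "\<pi> permutes Y - A" and h: "h \<in> H'" for \<pi> h
    proof -
      have "\<pi> permutes Y" using p by (rule permutes_subset) blast
      then have "act \<pi> h \<in> H" using closed h unfolding H'_def by blast
      moreover have "fixed_by A (act \<pi> h)"
        using fixed_by_act_disjoint[OF An YA _ p] h unfolding H'_def by blast
      ultimately show ?thesis unfolding H'_def by blast
    qed
    from less.hyps[OF smaller YA H' this] obtain t' w where t': "inj_on t' (Y - A)" "down_closed (t' ` (Y - A))"
      and w: "w \<in> H'" "\<And>\<pi>. \<pi> \<in> fibre_perms (Y - A) (fst \<circ> t') \<Longrightarrow> act \<pi> w = w"
        "alt (Y - A) (snd \<circ> t') w \<noteq> 0"
      by blast
    have wH: "w \<in> H" "fixed_by A w" using w(1) by (simp_all add: H'_def)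
    have "w \<noteq> 0" using w(3) by auto
    \<comment> \<open>The first row \<open>R\<close> of \<open>t'\<close> competes with \<open>A\<close>, because its symmetric group fixes \<open>w\<close>.\<close>
    have short: "j < card A" if j: "(0, j) \<in> t' ` (Y - A)" for j
    proof -
      define R where "R = {y \<in> Y - A. fst (t' y) = 0}"
      have RY: "R \<subseteq> Y - A" by (auto simp: R_def)
      have "fixed_by R w"
        unfolding fixed_by_def
      proof (intro allI impI)
        fix \<pi> assume p: "\<pi> permutes R"
        have "fst (t' (\<pi> x)) = fst (t' x)" for x
        proof (cases "x \<in> R")
          case True
          then have "\<pi> x \<in> R" using permutes_in_image[OF p] by blast
          then show ?thesis using True by (simp add: R_def)
        qed (simp add: permutes_not_in[OF p])
        then have "\<pi> \<in> fibre_perms (Y - A) (fst \<circ> t')"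
          unfolding fibre_perms_def using permutes_subset[OF p RY] by simp
        then show "act \<pi> w = w" by (rule w(2))
      qed
      then have "R \<in> S" unfolding S_def using RY wH(1) \<open>w \<noteq> 0\<close> by blast
      then have "card R \<le> card A" by (rule max)
      have "{0} \<times> {..j} \<subseteq> t' ` R"
      proof
        fix p :: "nat \<times> nat" assume "p \<in> {0} \<times> {..j}"
        then have p: "fst p = 0" "snd p \<le> j" by auto
        then have "(0, snd p) \<in> t' ` (Y - A)" using down_closedD[OF t'(2) j] by blast
        then obtain y where "y \<in> Y - A" "t' y = (0, snd p)" by force
        then show "p \<in> t' ` R" using p(1) unfolding R_def by (intro image_eqI[of _ _ y]) (auto simp: prod_eq_iff)
      qed
      moreover have "finite R" using RY finY finite_subset by blast
      ultimately have "card ({0 :: nat} \<times> {..j}) \<le> card R"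
        using surj_card_le by blast
      then show ?thesis using \<open>card R \<le> card A\<close> by simp
    qed
    obtain e where e: "bij_betw e A {0..<card A}" using ex_bij_betw_finite_nat[OF finA] by blast
    define t where "t y = (if y \<in> A then (0, e y) else (Suc (fst (t' y)), snd (t' y)))" for y
    have tA: "t y = (0, e y)" if "y \<in> A" for y using that by (simp add: t_def)
    have tB: "t y = (Suc (fst (t' y)), snd (t' y))" if "y \<notin> A" for y using that by (simp add: t_def)
    have "inj_on t Y"
    proof (rule inj_onI)
      fix x y assume xy: "x \<in> Y" "y \<in> Y" "t x = t y"
      show "x = y"
      proof (cases "x \<in> A")
        case True
        then have "y \<in> A" using xy(3) tA tB by (cases "y \<in> A") auto
        then have "e x = e y" using xy(3) tA True by simp
        then show ?thesis using e True \<open>y \<in> A\<close> unfolding bij_betw_def inj_on_def by blast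
      next
        case F: False
        then have "y \<notin> A" using xy(3) tA tB by (cases "y \<in> A") auto
        then have "t' x = t' y" using xy(3) tB F by (simp add: prod_eq_iff)
        then show ?thesis using t'(1) xy F \<open>y \<notin> A\<close> unfolding inj_on_def by blast
      qed
    qed
    moreover have "down_closed (t ` Y)"
      unfolding down_closed_def
    proof (intro allI impI)
      fix i j i' j' assume ij: "(i, j) \<in> t ` Y" "i' \<le> i" "j' \<le> j"
      have top_row: "(0, k) \<in> t ` Y" if "k < card A" for k
      proof -
        have "k \<in> e ` A" using that bij_betw_imp_surj_on[OF e] by simp
        then obtain x where "x \<in> A" "e x = k" by blast
        then show ?thesis using tA AY by (intro image_eqI[of _ _ x]) auto
      qed
      obtain y where y: "y \<in> Y" "t y = (i, j)" using ij(1) by force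
      show "(i', j') \<in> t ` Y"
      proof (cases "y \<in> A")
        case True
        then have "i = 0" "j = e y" using y tA by auto
        moreover have "e y < card A" using bij_betwE[OF e] True by auto
        ultimately show ?thesis using top_row ij by simp
      next
        case F: False
        then have ij': "i = Suc (fst (t' y))" "j = snd (t' y)" using y tB by auto
        then have "(fst (t' y), j) \<in> t' ` (Y - A)" using y F by (intro image_eqI[of _ _ y]) auto
        note low = down_closedD[OF t'(2) this]
        show ?thesis
        proof (cases i')
          case 0
          then show ?thesis using top_row short[OF low[of 0 j']] ij(3) by simp
        next
          case (Suc k)
          then have "(k, j') \<in> t' ` (Y - A)" using low ij ij'(1) by simp
          then obtain z where "z \<in> Y - A" "t' z = (k, j')" by force
          then show ?thesis using Suc tB by (intro image_eqI[of _ _ z]) auto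
        qed
      qed
    qed
    moreover have "act \<pi> w = w" if p: "\<pi> \<in> fibre_perms Y (fst \<circ> t)" for \<pi>
    proof -
      note pD = fibre_permsD[OF p]
      have pY: "\<pi> x \<in> Y \<longleftrightarrow> x \<in> Y" for x using permutes_in_image[OF pD(1)] .
      have A0: "x \<in> A \<longleftrightarrow> fst (t x) = 0" for x by (cases "x \<in> A") (simp_all add: tA tB)
      have pA: "\<pi> x \<in> A \<longleftrightarrow> x \<in> A" if "x \<in> Y" for x using pD(2)[OF that] unfolding A0 by simp
      have YU: "A \<union> (Y - A) = Y" using AY by blast
      have "\<pi> permutes A \<union> (Y - A)" using pD(1) unfolding YU .
      then obtain \<alpha> \<beta> where ab: "\<alpha> permutes A" "\<beta> permutes Y - A" "\<pi> = \<alpha> \<circ> \<beta>"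
        using permutes_Un_split[of \<pi> A "Y - A"] finA pA AY by blast
      have bB: "\<beta> x = \<pi> x" if "x \<in> Y - A" for x
      proof -
        have "\<beta> x \<in> Y - A" using permutes_in_image[OF ab(2)] that by blast
        then have "\<alpha> (\<beta> x) = \<beta> x" using permutes_not_in[OF ab(1)] by blast
        then show ?thesis unfolding ab(3) by simp
      qed
      have fst_b: "fst (t' (\<beta> x)) = fst (t' x)" if x: "x \<in> Y - A" for x
      proof -
        have "\<pi> x \<notin> A" using x pA by blast
        then show ?thesis using pD(2)[of x] x bB[OF x] tB[of x] tB[of "\<pi> x"] by simp
      qed
      have "\<beta> \<in> fibre_perms (Y - A) (fst \<circ> t')" unfolding fibre_perms_def using ab(2) fst_b by simp
      then have "act \<beta> w = w" by (rule w(2))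
      moreover have "act \<alpha> w = w" using wH(2) ab(1) by (simp add: fixed_by_def)
      ultimately show ?thesis
        using act_comp[OF permutes_subset[OF ab(1) An] permutes_subset[OF ab(2) YA], of w] unfolding ab(3) by simp
    qed
    moreover have "alt Y (snd \<circ> t) w \<noteq> 0"
    proof (rule alt_add_top_row_nonzero[OF Y AY _ _ H closed _ wH])
      show "inj_on (snd \<circ> t) A"
        using bij_betw_imp_inj_on[OF e] by (simp add: inj_on_def tA)
      have img: "(snd \<circ> t) ` A = {0..<card A}"
        using bij_betw_imp_surj_on[OF e] by (simp add: tA cong: image_cong)
      show "(snd \<circ> t) y \<in> (snd \<circ> t) ` A" if y: "y \<in> Y - A" for y
      proof -
        have "(fst (t' y), snd (t' y)) \<in> t' ` (Y - A)" using y by simp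
        then have "(0, snd (t' y)) \<in> t' ` (Y - A)" using down_closedD[OF t'(2)] by blast
        then have "snd (t' y) < card A" by (rule short)
        then show ?thesis unfolding img using y tB by simp
      qed
      show "h = 0" if "B \<subseteq> Y" "card A < card B" "h \<in> H" "fixed_by B h" for B h
      proof (rule ccontr)
        assume "h \<noteq> 0"
        then have "B \<in> S" unfolding S_def using that by blast
        then show False using max that(2) by fastforce
      qed
      have "fibre_perms (Y - A) (snd \<circ> t) = fibre_perms (Y - A) (snd \<circ> t')"
        by (rule fibre_perms_cong) (simp add: tB)
      then show "alt (Y - A) (snd \<circ> t) w \<noteq> 0" using w(3) unfolding alt_def by simp
    qed
    ultimately show ?thesis using wH(1) by blast
  qed
qed

end


section \<open>Column antisymmetrisers\<close>

context permutation_rep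
begin

lemma alt_add: "alt N c (f + g) = alt N c f + alt N c g"
  unfolding alt_def by (simp only: induced_action_add cscale_add sum.distrib)

lemma alt_scale: "alt N c (cscale k f) = cscale k (alt N c f)"
  unfolding alt_def cscale_sum by (simp only: induced_action_scale cscale_cscale mult.commute)

lemma alt_sum: "alt N c (\<Sum>i\<in>A. f i) = (\<Sum>i\<in>A. alt N c (f i))"
  by (induction A rule: infinite_finite_induct)
    (simp_all only: sum.infinite sum.empty sum.insert alt_zero alt_add not_False_eq_True)

lemma alt_cong:
  assumes "\<And>x y. x \<in> N \<Longrightarrow> y \<in> N \<Longrightarrow> c x = c y \<longleftrightarrow> d x = d y"
  shows "alt N c f = alt N d f"
proof -
  have "fibre_perms N c = fibre_perms N d" by (rule fibre_perms_cong) (rule assms)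
  then show ?thesis unfolding alt_def by (simp only:)
qed

lemma alt_act:
  assumes N: "N \<subseteq> {..<n}" and s: "\<sigma> \<in> fibre_perms N c"
  shows "alt N c (act \<sigma> f) = cscale (of_int (sign \<sigma>)) (alt N c f)"
proof -
  have fin: "finite N" using N finite_subset by blast
  note pn = permutes_subset[OF fibre_permsD(1) N]
  have "alt N c f = (\<Sum>\<pi>\<in>fibre_perms N c. cscale (of_int (sign (\<pi> \<circ> \<sigma>))) (act (\<pi> \<circ> \<sigma>) f))"
    unfolding alt_def by (rule sum_fibre_perms_right[OF s, symmetric])
  also have "\<dots> = (\<Sum>\<pi>\<in>fibre_perms N c. cscale (of_int (sign \<sigma>)) (cscale (of_int (sign \<pi>)) (act \<pi> (act \<sigma> f))))"
    by (rule sum.cong[OF refl])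
      (simp only: sign_comp_fibre_perms[OF fin _ s] act_comp[OF pn pn[OF s]] cscale_cscale of_int_mult mult.commute)
  also have "\<dots> = cscale (of_int (sign \<sigma>)) (alt N c (act \<sigma> f))"
    unfolding alt_def cscale_sum ..
  finally have "cscale (of_int (sign \<sigma>)) (alt N c f)
      = cscale (of_int (sign \<sigma>)) (cscale (of_int (sign \<sigma>)) (alt N c (act \<sigma> f)))" by (rule arg_cong)
  also have "\<dots> = cscale (of_int (sign \<sigma> * sign \<sigma>)) (alt N c (act \<sigma> f))"
    by (simp only: cscale_cscale of_int_mult)
  also have "\<dots> = alt N c (act \<sigma> f)"
    by (simp only: sign_idempotent of_int_1 cscale_one)
  finally show ?thesis by (rule sym)
qed

lemma act_alt:
  assumes N: "N \<subseteq> {..<n}" and s: "\<sigma> permutes N"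
  shows "act \<sigma> (alt N c f) = alt N (c \<circ> pinv \<sigma>) (act \<sigma> f)"
proof -
  have fin: "finite N" using N finite_subset by blast
  note pn = permutes_subset[OF _ N]
  note i = permutes_inverses[OF s]
  have sp: "permutation \<sigma>" unfolding permutation_permutes using fin s by blast
  have mem: "\<sigma> \<circ> \<pi> \<circ> pinv \<sigma> \<in> fibre_perms N (c \<circ> pinv \<sigma>)" if "\<pi> \<in> fibre_perms N c" for \<pi>
    unfolding fibre_perms_def
  proof (intro CollectI conjI ballI)
    note p = fibre_permsD[OF that]
    show "\<sigma> \<circ> \<pi> \<circ> pinv \<sigma> permutes N" using permutes_compose[OF permutes_inv[OF s] permutes_compose[OF p(1) s]] by simp
    fix x assume "x \<in> N"
    then have "pinv \<sigma> x \<in> N" using permutes_in_image[OF permutes_inv[OF s]] by blast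
    then show "(c \<circ> pinv \<sigma>) ((\<sigma> \<circ> \<pi> \<circ> pinv \<sigma>) x) = (c \<circ> pinv \<sigma>) x" using p(2) i by simp
  qed
  have mem': "pinv \<sigma> \<circ> \<pi> \<circ> \<sigma> \<in> fibre_perms N c" if "\<pi> \<in> fibre_perms N (c \<circ> pinv \<sigma>)" for \<pi>
    unfolding fibre_perms_def
  proof (intro CollectI conjI ballI)
    note p = fibre_permsD[OF that]
    show "pinv \<sigma> \<circ> \<pi> \<circ> \<sigma> permutes N" using permutes_compose[OF s permutes_compose[OF p(1) permutes_inv[OF s]]] by simp
    fix x assume "x \<in> N"
    then have "\<sigma> x \<in> N" using permutes_in_image[OF s] by blast
    then show "c ((pinv \<sigma> \<circ> \<pi> \<circ> \<sigma>) x) = c x" using p(2)[of "\<sigma> x"] i by simp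
  qed
  show ?thesis
    unfolding alt_def induced_action_sum
  proof (rule sum.reindex_bij_witness[where j = "\<lambda>\<pi>. \<sigma> \<circ> \<pi> \<circ> pinv \<sigma>" and i = "\<lambda>\<pi>. pinv \<sigma> \<circ> \<pi> \<circ> \<sigma>"])
    show "pinv \<sigma> \<circ> (\<sigma> \<circ> \<pi> \<circ> pinv \<sigma>) \<circ> \<sigma> = \<pi>" "\<sigma> \<circ> (pinv \<sigma> \<circ> \<pi> \<circ> \<sigma>) \<circ> pinv \<sigma> = \<pi>" for \<pi> :: "nat \<Rightarrow> nat"
      by (simp_all add: fun_eq_iff i)
    show "\<sigma> \<circ> \<pi> \<circ> pinv \<sigma> \<in> fibre_perms N (c \<circ> pinv \<sigma>)" if "\<pi> \<in> fibre_perms N c" for \<pi> by (rule mem[OF that])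
    show "pinv \<sigma> \<circ> \<pi> \<circ> \<sigma> \<in> fibre_perms N c" if "\<pi> \<in> fibre_perms N (c \<circ> pinv \<sigma>)" for \<pi> by (rule mem'[OF that])
    fix \<pi> assume p: "\<pi> \<in> fibre_perms N c"
    have pp: "permutation \<pi>" by (rule permutation_fibre_perms[OF fin p])
    have "sign (\<sigma> \<circ> \<pi> \<circ> pinv \<sigma>) = sign \<sigma> * sign \<pi> * sign \<sigma>"
      using sign_compose[OF permutation_compose[OF sp pp] permutation_inverse[OF sp]] sign_compose[OF sp pp]
        sign_inverse[OF sp] by simp
    also have "\<dots> = sign \<pi>" by (simp add: mult_ac)
    finally have sg: "sign (\<sigma> \<circ> \<pi> \<circ> pinv \<sigma>) = sign \<pi>" .
    have "act (\<sigma> \<circ> \<pi> \<circ> pinv \<sigma>) (act \<sigma> f) = act ((\<sigma> \<circ> \<pi> \<circ> pinv \<sigma>) \<circ> \<sigma>) f"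
      by (rule act_comp[symmetric]) (rule pn fibre_permsD(1)[OF mem[OF p]] s)+
    also have "(\<sigma> \<circ> \<pi> \<circ> pinv \<sigma>) \<circ> \<sigma> = \<sigma> \<circ> \<pi>" by (simp add: fun_eq_iff i)
    also have "act (\<sigma> \<circ> \<pi>) f = act \<sigma> (act \<pi> f)"
      by (rule act_comp) (rule pn fibre_permsD(1)[OF p] s)+
    finally show "cscale (of_int (sign (\<sigma> \<circ> \<pi> \<circ> pinv \<sigma>))) (act (\<sigma> \<circ> \<pi> \<circ> pinv \<sigma>) (act \<sigma> f))
        = act \<sigma> (cscale (of_int (sign \<pi>)) (act \<pi> f))"
      unfolding sg induced_action_scale by (rule arg_cong)
  qed
qed

lemma inner_alt:
  assumes N: "N \<subseteq> {..<n}"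
  shows "inner_on X (alt N c f) g = inner_on X f (alt N c g)"
proof -
  have fin: "finite N" using N finite_subset by blast
  have "inner_on X (alt N c f) g = (\<Sum>\<pi>\<in>fibre_perms N c. of_int (sign \<pi>) * inner_on X f (act (pinv \<pi>) g))"
    unfolding alt_def inner_on_sum inner_on_scale
    by (intro sum.cong refl arg_cong2[where f = "(*)"] inner_act_left permutes_subset[OF fibre_permsD(1) N])
  also have "\<dots> = (\<Sum>\<pi>\<in>fibre_perms N c. of_int (sign \<pi>) * inner_on X f (act \<pi> g))"
  proof (rule sum.reindex_bij_witness[where i = pinv and j = pinv])
    fix \<pi> assume p: "\<pi> \<in> fibre_perms N c"
    show "pinv (pinv \<pi>) = \<pi>" by (rule permutes_inv_inv[OF fibre_permsD(1)[OF p]])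
    then show "pinv (pinv \<pi>) = \<pi>" .
    show "pinv \<pi> \<in> fibre_perms N c" by (rule inv_fibre_perms[OF p])
    then show "pinv \<pi> \<in> fibre_perms N c" .
    show "of_int (sign (pinv \<pi>)) * inner_on X f (act (pinv \<pi>) g)
        = of_int (sign \<pi>) * inner_on X f (act (pinv \<pi>) g)"
      using sign_inverse[OF permutation_fibre_perms[OF fin p]] by simp
  qed
  also have "\<dots> = inner_on X f (alt N c g)"
    unfolding alt_def inner_on_sum_right inner_on_scale_right by simp
  finally show ?thesis .
qed

end


section \<open>Cells, tableaux and tabloids\<close>

lemma mem_cells: "(i, j) \<in> cells lam \<longleftrightarrow> i < length lam \<and> j < lam ! i"
  by (simp add: cells_def)

lemma cells_Sigma: "cells lam = Sigma {..<length lam} (\<lambda>i. {..<lam ! i})"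
  by (auto simp: cells_def)

lemma finite_cells [simp]: "finite (cells lam)"
  unfolding cells_Sigma by simp

lemma card_cells: "card (cells lam) = sum_list lam"
  unfolding cells_Sigma by (simp add: sum_list_sum_nth atLeast0LessThan)

lemma down_closed_cells:
  assumes "is_partition lam"
  shows "down_closed (cells lam)"
  unfolding down_closed_def
proof (intro allI impI)
  fix i j i' j' assume *: "(i, j) \<in> cells lam" "i' \<le> i" "j' \<le> j"
  then have i: "i < length lam" "j < lam ! i" "i' < length lam" by (auto simp: mem_cells)
  have "lam ! i \<le> lam ! i'"
    using assms *(2) i sorted_wrt_nth_less[of "(\<ge>)" lam i' i]
    unfolding is_partition_def by (cases "i' = i") auto
  then show "(i', j') \<in> cells lam" using i *(3) by (simp add: mem_cells)
qed

definition pos :: "nat list \<Rightarrow> (nat \<times> nat \<Rightarrow> nat) \<Rightarrow> nat \<Rightarrow> nat \<times> nat" where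
  "pos lam t = inv_into (cells lam) t"

lemma tableau_bij: "t \<in> tableaux lam \<Longrightarrow> bij_betw t (cells lam) {..<sum_list lam}"
  by (simp add: tableaux_def)

lemma pos_bij: "t \<in> tableaux lam \<Longrightarrow> bij_betw (pos lam t) {..<sum_list lam} (cells lam)"
  unfolding pos_def by (intro bij_betw_inv_into tableau_bij)

lemma pos_tableau [simp]: "t \<in> tableaux lam \<Longrightarrow> p \<in> cells lam \<Longrightarrow> pos lam t (t p) = p"
  unfolding pos_def using bij_betw_inv_into_left[OF tableau_bij] by blast

lemma tableau_pos [simp]: "t \<in> tableaux lam \<Longrightarrow> a < sum_list lam \<Longrightarrow> t (pos lam t a) = a"
  unfolding pos_def using bij_betw_inv_into_right[OF tableau_bij] by blast

lemma pos_in_cells: "t \<in> tableaux lam \<Longrightarrow> a < sum_list lam \<Longrightarrow> pos lam t a \<in> cells lam"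
  using bij_betwE[OF pos_bij] by blast

lemma tableau_less: "t \<in> tableaux lam \<Longrightarrow> p \<in> cells lam \<Longrightarrow> t p < sum_list lam"
  using bij_betwE[OF tableau_bij] by blast

lemma tableau_of_positions:
  assumes "bij_betw q {..<sum_list lam} (cells lam)"
  obtains t where "t \<in> tableaux lam" "\<And>a. a < sum_list lam \<Longrightarrow> pos lam t a = q a"
proof -
  define t where "t = restrict (inv_into {..<sum_list lam} q) (cells lam)"
  have "bij_betw t (cells lam) {..<sum_list lam}"
    unfolding t_def using bij_betw_inv_into[OF assms] by (simp cong: bij_betw_cong)
  then have t: "t \<in> tableaux lam" unfolding tableaux_def t_def by simp
  have "pos lam t a = q a" if "a < sum_list lam" for a
  proof -
    have "q a \<in> cells lam" using bij_betwE[OF assms] that by blast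
    moreover have "t (q a) = a"
      unfolding t_def using calculation bij_betw_inv_into_left[OF assms, of a] that by simp
    ultimately show ?thesis using pos_tableau[OF t, of "q a"] by simp
  qed
  with t that show ?thesis by blast
qed

lemma tableaux_nonempty: "tableaux lam \<noteq> {}"
proof -
  obtain q where "bij_betw q {..<sum_list lam} (cells lam)"
    using ex_bij_betw_nat_finite[OF finite_cells, of lam] unfolding card_cells atLeast0LessThan by blast
  then show ?thesis using tableau_of_positions by blast
qed

lemma finite_tableaux: "finite (tableaux lam)"
proof (rule finite_subset)
  show "tableaux lam \<subseteq> (\<Pi>\<^sub>E _\<in>cells lam. {..<sum_list lam})"
  proof
    fix t assume t: "t \<in> tableaux lam"
    then show "t \<in> (\<Pi>\<^sub>E _\<in>cells lam. {..<sum_list lam})"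
      using tableau_less[OF t] unfolding tableaux_def PiE_iff by blast
  qed
qed (simp add: finite_PiE)

lemma permuted_tableau:
  assumes t: "t \<in> tableaux lam" and s: "\<sigma> permutes {..<sum_list lam}"
  shows "restrict (\<sigma> \<circ> t) (cells lam) \<in> tableaux lam"
    and "a < sum_list lam \<Longrightarrow> pos lam (restrict (\<sigma> \<circ> t) (cells lam)) a = pos lam t (pinv \<sigma> a)"
proof -
  have "bij_betw (\<sigma> \<circ> t) (cells lam) {..<sum_list lam}"
    using bij_betw_trans[OF tableau_bij[OF t] permutes_imp_bij[OF s]] .
  then show 1: "restrict (\<sigma> \<circ> t) (cells lam) \<in> tableaux lam"
    by (simp add: tableaux_def cong: bij_betw_cong)
  assume a: "a < sum_list lam"
  then have b: "pinv \<sigma> a < sum_list lam" using permutes_in_image[OF permutes_inv[OF s], of a] by simp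
  have "restrict (\<sigma> \<circ> t) (cells lam) (pos lam t (pinv \<sigma> a)) = a"
    using pos_in_cells[OF t b] tableau_pos[OF t b] permutes_inverses(1)[OF s] by simp
  then show "pos lam (restrict (\<sigma> \<circ> t) (cells lam)) a = pos lam t (pinv \<sigma> a)"
    using pos_tableau[OF 1 pos_in_cells[OF t b]] by simp
qed

lemma tableaux_transitive:
  assumes t: "t \<in> tableaux lam" and s: "s \<in> tableaux lam"
  obtains \<sigma> where "\<sigma> permutes {..<sum_list lam}" "s = restrict (\<sigma> \<circ> t) (cells lam)"
proof -
  define \<sigma> where "\<sigma> a = (if a < sum_list lam then s (pos lam t a) else a)" for a
  have "bij_betw (s \<circ> pos lam t) {..<sum_list lam} {..<sum_list lam}"
    using bij_betw_trans[OF pos_bij[OF t] tableau_bij[OF s]] .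
  then have "bij_betw \<sigma> {..<sum_list lam} {..<sum_list lam}"
    by (rule bij_betw_cong[THEN iffD1, rotated]) (simp add: \<sigma>_def)
  then have "\<sigma> permutes {..<sum_list lam}" by (rule bij_imp_permutes) (simp add: \<sigma>_def)
  moreover have "s = restrict (\<sigma> \<circ> t) (cells lam)"
  proof (rule extensionalityI[of s "cells lam"])
    show "s \<in> extensional (cells lam)" using s by (simp add: tableaux_def)
    show "s x = restrict (\<sigma> \<circ> t) (cells lam) x" if "x \<in> cells lam" for x
      using that tableau_less[OF t that] by (simp add: \<sigma>_def t)
  qed simp
  ultimately show ?thesis using that by blast
qed

lemma tabloid_restrict: "tabloid lam (restrict f (cells lam)) = tabloid lam f"
  unfolding tabloid_def by (intro map_cong refl image_cong) (auto simp: mem_cells)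

lemma tabloid_action_tabloid: "tabloid_action \<pi> (tabloid lam t) = tabloid lam (\<pi> \<circ> t)"
  unfolding tabloid_action_def tabloid_def by (simp add: image_image)

lemma tabloid_eq_iff:
  assumes t: "t \<in> tableaux lam" and s: "s \<in> tableaux lam"
  shows "tabloid lam t = tabloid lam s \<longleftrightarrow> (\<forall>a<sum_list lam. fst (pos lam t a) = fst (pos lam s a))"
proof -
  have row: "(\<lambda>j. t (i, j)) ` {..<lam ! i} = {a. a < sum_list lam \<and> fst (pos lam t a) = i}"
    if t: "t \<in> tableaux lam" and i: "i < length lam" for t i
  proof (intro equalityI subsetI)
    fix a assume "a \<in> (\<lambda>j. t (i, j)) ` {..<lam ! i}"
    then obtain j where "a = t (i, j)" "(i, j) \<in> cells lam" using i by (auto simp: mem_cells)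
    then show "a \<in> {a. a < sum_list lam \<and> fst (pos lam t a) = i}" using tableau_less[OF t] t by simp
  next
    fix a assume "a \<in> {a. a < sum_list lam \<and> fst (pos lam t a) = i}"
    then have a: "a < sum_list lam" "fst (pos lam t a) = i" by auto
    have "(i, snd (pos lam t a)) \<in> cells lam" using pos_in_cells[OF t a(1)] a(2) by (metis prod.collapse)
    moreover have "a = t (i, snd (pos lam t a))" using tableau_pos[OF t a(1)] a(2) by (metis prod.collapse)
    ultimately show "a \<in> (\<lambda>j. t (i, j)) ` {..<lam ! i}" unfolding mem_cells by blast
  qed
  have len: "fst (pos lam t a) < length lam" if "t \<in> tableaux lam" "a < sum_list lam" for t a
    using pos_in_cells[OF that] by (cases "pos lam t a") (simp add: mem_cells)
  have eq1: "tabloid lam t = tabloid lam s \<longleftrightarrow> (\<forall>i<length lam. {a. a < sum_list lam \<and> fst (pos lam t a) = i}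
      = {a. a < sum_list lam \<and> fst (pos lam s a) = i})"
    unfolding tabloid_def list_eq_iff_nth_eq using row[OF t] row[OF s] by simp
  show ?thesis
    unfolding eq1
  proof
    assume L: "\<forall>i<length lam. {a. a < sum_list lam \<and> fst (pos lam t a) = i}
        = {a. a < sum_list lam \<and> fst (pos lam s a) = i}"
    show "\<forall>a<sum_list lam. fst (pos lam t a) = fst (pos lam s a)"
    proof (intro allI impI)
      fix a assume a: "a < sum_list lam"
      then have "a \<in> {b. b < sum_list lam \<and> fst (pos lam t b) = fst (pos lam t a)}" by blast
      then have "a \<in> {b. b < sum_list lam \<and> fst (pos lam s b) = fst (pos lam t a)}"
        using L len[OF t a] by blast
      then show "fst (pos lam t a) = fst (pos lam s a)" by simp
    qed
  next
    assume R: "\<forall>a<sum_list lam. fst (pos lam t a) = fst (pos lam s a)"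
    show "\<forall>i<length lam. {a. a < sum_list lam \<and> fst (pos lam t a) = i}
        = {a. a < sum_list lam \<and> fst (pos lam s a) = i}"
      by (intro allI impI Collect_cong conj_cong refl) (simp add: R)
  qed
qed

lemma permuted_tabloid_eq_iff:
  assumes t: "t \<in> tableaux lam" and s: "s \<in> tableaux lam" and p: "\<pi> permutes {..<sum_list lam}"
  shows "tabloid lam (\<pi> \<circ> t) = tabloid lam s \<longleftrightarrow>
    (\<forall>a<sum_list lam. fst (pos lam t (pinv \<pi> a)) = fst (pos lam s a))"
  unfolding tabloid_eq_iff[OF permuted_tableau(1)[OF t p] s, unfolded tabloid_restrict]
  by (auto simp only: permuted_tableau(2)[OF t p])

lemma column_stabilizer_eq:
  assumes t: "t \<in> tableaux lam"
  shows "column_stabilizer lam t = fibre_perms {..<sum_list lam} (snd \<circ> pos lam t)"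
proof -
  have col: "column lam t j = {a. a < sum_list lam \<and> snd (pos lam t a) = j}" for j
  proof (intro equalityI subsetI)
    fix a assume "a \<in> column lam t j"
    then obtain i where "a = t (i, j)" "(i, j) \<in> cells lam" unfolding column_def by blast
    then show "a \<in> {a. a < sum_list lam \<and> snd (pos lam t a) = j}" using tableau_less[OF t] t by simp
  next
    fix a assume "a \<in> {a. a < sum_list lam \<and> snd (pos lam t a) = j}"
    then have a: "a < sum_list lam" "snd (pos lam t a) = j" by auto
    have "(fst (pos lam t a), j) \<in> cells lam" using pos_in_cells[OF t a(1)] a(2) by (metis prod.collapse)
    moreover have "a = t (fst (pos lam t a), j)" using tableau_pos[OF t a(1)] a(2) by (metis prod.collapse)
    ultimately show "a \<in> column lam t j" unfolding column_def by blast
  qed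
  have "(\<forall>j. \<pi> ` column lam t j = column lam t j) \<longleftrightarrow>
      (\<forall>x\<in>{..<sum_list lam}. (snd \<circ> pos lam t) (\<pi> x) = (snd \<circ> pos lam t) x)"
    if p: "\<pi> permutes {..<sum_list lam}" for \<pi>
  proof
    assume L: "\<forall>j. \<pi> ` column lam t j = column lam t j"
    show "\<forall>x\<in>{..<sum_list lam}. (snd \<circ> pos lam t) (\<pi> x) = (snd \<circ> pos lam t) x"
    proof
      fix x assume "x \<in> {..<sum_list lam}"
      then have "x \<in> column lam t (snd (pos lam t x))" unfolding col by simp
      then have "\<pi> x \<in> column lam t (snd (pos lam t x))" using L by blast
      then show "(snd \<circ> pos lam t) (\<pi> x) = (snd \<circ> pos lam t) x" unfolding col by simp
    qed
  next
    assume R: "\<forall>x\<in>{..<sum_list lam}. (snd \<circ> pos lam t) (\<pi> x) = (snd \<circ> pos lam t) x"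
    show "\<forall>j. \<pi> ` column lam t j = column lam t j"
    proof
      fix j
      have "\<pi> ` column lam t j \<subseteq> column lam t j"
        unfolding col using R permutes_in_image[OF p] by force
      moreover have "finite (column lam t j)" unfolding col by simp
      ultimately show "\<pi> ` column lam t j = column lam t j"
        using endo_inj_surj permutes_inj_on[OF p] by blast
    qed
  qed
  then show ?thesis unfolding column_stabilizer_def fibre_perms_def by blast
qed

definition tabloids :: "nat list \<Rightarrow> nat set list set" where
  "tabloids lam = tabloid lam ` tableaux lam"

global_interpretation M: permutation_rep "sum_list lam" "tabloids lam" tabloid_action for lam
proof
  show "finite (tabloids lam)" unfolding tabloids_def using finite_tableaux by simp
  show "tabloid_action id x = x" for x by (simp add: tabloid_action_def)
  show "tabloid_action (\<pi> \<circ> \<sigma>) x = tabloid_action \<pi> (tabloid_action \<sigma> x)" for \<pi> \<sigma> x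
    by (simp add: tabloid_action_def image_comp)
  show "tabloid_action \<pi> x \<in> tabloids lam" if p: "\<pi> permutes {..<sum_list lam}" and x: "x \<in> tabloids lam" for \<pi> x
  proof -
    obtain t where t: "t \<in> tableaux lam" "x = tabloid lam t" using x unfolding tabloids_def by blast
    have "tabloid_action \<pi> x = tabloid lam (restrict (\<pi> \<circ> t) (cells lam))"
      unfolding t(2) tabloid_action_tabloid tabloid_restrict ..
    then show ?thesis unfolding tabloids_def using permuted_tableau(1)[OF t(1) p] by blast
  qed
qed

lemma polytabloid_eq_alt:
  assumes t: "t \<in> tableaux lam"
  shows "polytabloid lam t = M.alt {..<sum_list lam} (snd \<circ> pos lam t) (point_mass (tabloid lam t))"
  unfolding M.alt_def polytabloid_def column_stabilizer_eq[OF t]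
proof (rule ext)
  fix x
  have "(if tabloid lam (\<pi> \<circ> t) = x then complex_of_int (sign \<pi>) else 0)
      = cscale (of_int (sign \<pi>)) (M.act \<pi> (point_mass (tabloid lam t))) x"
    if "\<pi> \<in> fibre_perms {..<sum_list lam} (snd \<circ> pos lam t)" for \<pi>
    unfolding M.act_point_mass[OF fibre_permsD(1)[OF that]] tabloid_action_tabloid by (simp add: point_mass_def)
  then show "(\<Sum>\<pi>\<in>fibre_perms {..<sum_list lam} (snd \<circ> pos lam t).
        if tabloid lam (\<pi> \<circ> t) = x then complex_of_int (sign \<pi>) else 0)
      = (\<Sum>\<pi>\<in>fibre_perms {..<sum_list lam} (snd \<circ> pos lam t).
        cscale (of_int (sign \<pi>)) (M.act \<pi> (point_mass (tabloid lam t)))) x"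
    unfolding sum_fun_apply by (rule sum.cong[OF refl])
qed

lemma act_polytabloid:
  assumes t: "t \<in> tableaux lam" and s: "\<sigma> permutes {..<sum_list lam}"
  shows "M.act \<sigma> (polytabloid lam t) = polytabloid lam (restrict (\<sigma> \<circ> t) (cells lam))"
proof -
  have "M.alt {..<sum_list lam} ((snd \<circ> pos lam t) \<circ> pinv \<sigma>) f
      = M.alt {..<sum_list lam} (snd \<circ> pos lam (restrict (\<sigma> \<circ> t) (cells lam))) f" for f
    by (rule M.alt_cong) (simp add: permuted_tableau(2)[OF t s])
  then show ?thesis
    unfolding polytabloid_eq_alt[OF t] polytabloid_eq_alt[OF permuted_tableau(1)[OF t s]]
      M.act_alt[OF order_refl s] M.act_point_mass[OF s] tabloid_action_tabloid tabloid_restrict by simp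
qed

lemma subspace_specht: "cfun.subspace (specht lam)"
  unfolding specht_def by (rule cfun.subspace_span)

lemma polytabloid_in_specht: "t \<in> tableaux lam \<Longrightarrow> polytabloid lam t \<in> specht lam"
  unfolding specht_def by (intro cfun.span_base imageI)

lemma submodule_specht: "submodule_of (sum_list lam) specht_action (specht lam)"
  unfolding submodule_of_def specht_action_def
proof (intro conjI allI impI ballI subspace_specht)
  fix \<pi> v assume p: "\<pi> permutes {..<sum_list lam}" and v: "v \<in> specht lam"
  show "M.act \<pi> v \<in> specht lam"
    using v unfolding specht_def
  proof (induction rule: cfun.span_induct_alt)
    case base
    then show ?case unfolding induced_action_zero by (rule cfun.span_zero)
  next
    case (step c x y)
    then obtain t where t: "t \<in> tableaux lam" "x = polytabloid lam t" by blast
    have "M.act \<pi> x \<in> cfun.span (polytabloid lam ` tableaux lam)"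
      unfolding t(2) act_polytabloid[OF t(1) p]
      by (intro cfun.span_base imageI permuted_tableau(1)[OF t(1) p])
    then show ?case
      unfolding induced_action_add induced_action_scale using step(2)
      by (intro cfun.span_add cfun.span_scale)
  qed
qed

lemma polytabloid_funs_on: "t \<in> tableaux lam \<Longrightarrow> polytabloid lam t \<in> funs_on (tabloids lam)"
  unfolding polytabloid_eq_alt
  by (rule M.alt_submodule[OF subspace_funs_on M.act_funs_on point_mass_funs_on])
    (auto simp: tabloids_def)

lemma specht_funs_on: "specht lam \<subseteq> funs_on (tabloids lam)"
  unfolding specht_def using polytabloid_funs_on by (intro cfun.span_minimal subspace_funs_on) blast

lemma row_column_fixing_is_id:
  assumes t: "t \<in> tableaux lam" and p: "\<pi> \<in> fibre_perms {..<sum_list lam} (snd \<circ> pos lam t)"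
    and row: "tabloid lam (\<pi> \<circ> t) = tabloid lam t"
  shows "\<pi> = id"
proof -
  note pi = fibre_permsD(1)[OF p]
  have "pinv \<pi> a = a" for a
  proof (cases "a < sum_list lam")
    case True
    have b: "pinv \<pi> a < sum_list lam" using permutes_in_image[OF permutes_inv[OF pi], of a] True by simp
    have "fst (pos lam t (pinv \<pi> a)) = fst (pos lam t a)"
      using row True unfolding permuted_tabloid_eq_iff[OF t t pi] by blast
    moreover have "snd (pos lam t (pinv \<pi> a)) = snd (pos lam t a)"
      using fibre_permsD(2)[OF inv_fibre_perms[OF p], of a] True by simp
    ultimately have "pos lam t (pinv \<pi> a) = pos lam t a" by (rule prod_eqI)
    then show ?thesis using tableau_pos[OF t b] tableau_pos[OF t True] by simp
  next
    case False
    then show ?thesis using permutes_not_in[OF permutes_inv[OF pi], of a] by simp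
  qed
  then have "\<pi> a = a" for a using permutes_inverses(1)[OF pi, of a] by simp
  then show ?thesis by (simp add: fun_eq_iff)
qed

lemma polytabloid_at_own_tabloid:
  assumes t: "t \<in> tableaux lam"
  shows "polytabloid lam t (tabloid lam t) = 1"
proof -
  let ?C = "fibre_perms {..<sum_list lam} (snd \<circ> pos lam t)"
  have "polytabloid lam t (tabloid lam t) = (\<Sum>\<pi>\<in>?C. if \<pi> = id then 1 else 0)"
    unfolding polytabloid_def column_stabilizer_eq[OF t]
  proof (rule sum.cong[OF refl])
    fix \<pi> assume p: "\<pi> \<in> ?C"
    show "(if tabloid lam (\<pi> \<circ> t) = tabloid lam t then complex_of_int (sign \<pi>) else 0)
        = (if \<pi> = id then 1 else 0)"
    proof (cases "\<pi> = id")
      case True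
      show ?thesis unfolding True by (simp only: id_comp sign_id of_int_1 if_True simp_thms)
    next
      case False
      then have "tabloid lam (\<pi> \<circ> t) \<noteq> tabloid lam t" using row_column_fixing_is_id[OF t p] by blast
      then show ?thesis using False by (simp only: if_False)
    qed
  qed
  also have "\<dots> = 1"
    unfolding sum.delta[OF finite_fibre_perms[OF finite_lessThan]] by (simp only: id_fibre_perms if_True)
  finally show ?thesis .
qed


section \<open>Irreducibility of Specht modules\<close>

lemma sum_lessThan_card_le:
  fixes S :: "nat set"
  assumes "finite S"
  shows "\<Sum>{..<card S} \<le> \<Sum>S" and "\<Sum>S = \<Sum>{..<card S} \<Longrightarrow> S = {..<card S}"
proof -
  have "\<Sum>{..<card S} \<le> \<Sum>S \<and> (\<Sum>S = \<Sum>{..<card S} \<longrightarrow> S = {..<card S})"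
    using assms
  proof (induction "card S" arbitrary: S)
    case 0
    then show ?case by simp
  next
    case (Suc k)
    have ne: "S \<noteq> {}" using Suc.hyps(2) by auto
    define m where "m = Max S"
    have m: "m \<in> S" "S \<subseteq> {..m}" using Suc.prems ne unfolding m_def by auto
    define S' where "S' = S - {m}"
    have S': "finite S'" "card S' = k" "S = insert m S'" "m \<notin> S'"
      using Suc m(1) by (auto simp: S'_def)
    have IH: "\<Sum>{..<k} \<le> \<Sum>S'" "\<Sum>S' = \<Sum>{..<k} \<Longrightarrow> S' = {..<k}"
      using Suc.hyps(1)[of S'] S' by auto
    have "S' \<subseteq> {..<m}" using m(2) by (auto simp: S'_def le_less)
    then have km: "k \<le> m" using card_mono[of "{..<m}" S'] S'(2) by simp
    have sum_S: "\<Sum>S = m + \<Sum>S'" unfolding S'(3) using S'(1,4) by simp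
    have cs: "card S = Suc k" using Suc.hyps(2) by simp
    have sum_k: "\<Sum>{..<Suc k} = k + \<Sum>{..<k}" by simp
    have "S = {..<Suc k}" if "\<Sum>S = \<Sum>{..<Suc k}"
    proof -
      have "m = k" "\<Sum>S' = \<Sum>{..<k}" using that km IH(1) unfolding sum_S sum_k by linarith+
      then show ?thesis using IH(2) S'(3) by (simp add: lessThan_Suc)
    qed
    then show ?case unfolding cs using km IH(1) sum_S sum_k by linarith
  qed
  then show "\<Sum>{..<card S} \<le> \<Sum>S" "\<Sum>S = \<Sum>{..<card S} \<Longrightarrow> S = {..<card S}" by blast+
qed

lemma downward_closed_eq_lessThan:
  fixes S :: "nat set"
  assumes "finite S" "\<And>i i'. i \<in> S \<Longrightarrow> i' \<le> i \<Longrightarrow> i' \<in> S"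
  shows "S = {..<card S}"
proof -
  obtain m where m: "m \<notin> S" "\<And>i. i < m \<Longrightarrow> i \<in> S"
    using assms(1) ex_least_nat_le[of "\<lambda>m. m \<notin> S"] ex_new_if_finite[OF infinite_UNIV_nat assms(1)] by blast
  have "S = {..<m}" using m assms(2) by (meson lessThan_iff not_less subset_antisym subsetI)
  then show ?thesis by simp
qed

text \<open>
  Among the sets with prescribed column sizes, the one with columns pushed to the top has the
  smallest sum of row indices, and it is the only one with that sum.
\<close>

lemma eq_if_initial_columns:
  fixes D C :: "(nat \<times> nat) set"
  assumes fin: "finite D" "finite C"
    and cards: "\<And>j. card {i. (i, j) \<in> D} = card {i. (i, j) \<in> C}"
    and init: "\<And>j. {i. (i, j) \<in> C} = {..<card {i. (i, j) \<in> C}}"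
    and sums: "(\<Sum>p\<in>D. fst p) = (\<Sum>p\<in>C. fst p)"
  shows "D = C"
proof -
  define J where "J = snd ` (D \<union> C)"
  have J: "finite J" "snd ` D \<subseteq> J" "snd ` C \<subseteq> J" unfolding J_def using fin by auto
  have by_columns: "(\<Sum>p\<in>E. fst p) = (\<Sum>j\<in>J. \<Sum>{i. (i, j) \<in> E})" if E: "finite E" "snd ` E \<subseteq> J" for E
  proof -
    have "(\<Sum>p | p \<in> E \<and> snd p = j. fst p) = \<Sum>{i. (i, j) \<in> E}" for j
    proof -
      have "inj_on fst {p. p \<in> E \<and> snd p = j}" by (auto simp: inj_on_def prod_eq_iff)
      moreover have "fst ` {p. p \<in> E \<and> snd p = j} = {i. (i, j) \<in> E}" by force
      ultimately show ?thesis using sum.reindex[of fst "{p. p \<in> E \<and> snd p = j}" "\<lambda>x. x"] by simp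
    qed
    then show ?thesis using sum.group[OF E(1) J(1) E(2), of fst] by simp
  qed
  have fin_col: "finite {i. (i, j) \<in> D}" for j
    by (rule finite_subset[OF _ finite_imageI[OF fin(1), of fst]]) force
  have le: "\<Sum>{i. (i, j) \<in> C} \<le> \<Sum>{i. (i, j) \<in> D}" for j
    by (subst init) (use sum_lessThan_card_le(1)[OF fin_col, of j] in \<open>simp add: cards\<close>)
  have total: "(\<Sum>j\<in>J. \<Sum>{i. (i, j) \<in> C}) = (\<Sum>j\<in>J. \<Sum>{i. (i, j) \<in> D})"
    using by_columns[OF fin(1) J(2)] by_columns[OF fin(2) J(3)] sums by simp
  have col: "{i. (i, j) \<in> D} = {i. (i, j) \<in> C}" for j
  proof (cases "j \<in> J")
    case True
    have "\<Sum>{i. (i, j) \<in> C} = \<Sum>{i. (i, j) \<in> D}"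
      by (rule sum_mono_inv[OF total le True J(1)])
    then have "\<Sum>{i. (i, j) \<in> D} = \<Sum>{..<card {i. (i, j) \<in> D}}"
      using init[of j] cards[of j] by simp
    from sum_lessThan_card_le(2)[OF fin_col this] show ?thesis using init[of j] cards[of j] by simp
  next
    case False
    then show ?thesis using J(2,3) by force
  qed
  show ?thesis using col by (auto simp: set_eq_iff)
qed

lemma cells_column_initial:
  assumes "is_partition lam"
  shows "{i. (i, j) \<in> cells lam} = {..<card {i. (i, j) \<in> cells lam}}"
proof (rule downward_closed_eq_lessThan)
  show "finite {i. (i, j) \<in> cells lam}"
    by (rule finite_subset[OF _ finite_imageI[OF finite_cells, of fst lam]]) force
qed (use down_closedD[OF down_closed_cells[OF assms]] in blast)

text \<open>
  Either two entries are in the same column of \<open>t\<close> and the same row of \<open>s\<close>, and their transposition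
  changes the sign of the antisymmetrisation without changing the tabloid; or the entries have
  distinct pairs (row in \<open>s\<close>, column in \<open>t\<close>). In the second case these pairs have the same row and
  column sizes as the diagram, so they fill it, and the tabloid of \<open>s\<close> comes from the one of \<open>t\<close> by a
  permutation of its columns.
\<close>

lemma alt_tabloid:
  assumes lam: "is_partition lam" and t: "t \<in> tableaux lam" and s: "s \<in> tableaux lam"
  obtains k where "M.alt {..<sum_list lam} (snd \<circ> pos lam t) (point_mass (tabloid lam s))
    = cscale k (polytabloid lam t)"
proof -
  define n where "n = sum_list lam"
  define row where "row a = fst (pos lam s a)" for a
  define col where "col a = snd (pos lam t a)" for a
  let ?alt = "M.alt {..<n} (snd \<circ> pos lam t)"
  show ?thesis
  proof (cases "inj_on (\<lambda>a. (row a, col a)) {..<n}")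
    case False
    then obtain a b where ab: "a < n" "b < n" "a \<noteq> b" "row a = row b" "col a = col b"
      unfolding inj_on_def by auto
    define \<tau> where "\<tau> = transpose a b"
    have tp: "\<tau> permutes {..<n}" unfolding \<tau>_def using ab by (intro permutes_swap_id) auto
    have tC: "\<tau> \<in> fibre_perms {..<n} (snd \<circ> pos lam t)"
      unfolding fibre_perms_def using tp ab unfolding \<tau>_def col_def by (auto simp: transpose_def)
    have "pinv \<tau> = \<tau>" unfolding \<tau>_def by simp
    then have "tabloid lam (\<tau> \<circ> s) = tabloid lam s"
      using permuted_tabloid_eq_iff[OF s s tp[unfolded n_def]] ab
      unfolding \<tau>_def row_def by (auto simp: transpose_def)
    then have "M.act \<tau> (point_mass (tabloid lam s)) = point_mass (tabloid lam s)"
      using M.act_point_mass[OF tp[unfolded n_def]] tabloid_action_tabloid by metis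
    then have "?alt (point_mass (tabloid lam s)) = cscale (of_int (sign \<tau>)) (?alt (point_mass (tabloid lam s)))"
      using M.alt_act[OF _ tC, of lam "point_mass (tabloid lam s)"] unfolding n_def by simp
    also have "sign \<tau> = - 1" unfolding \<tau>_def using ab(3) by (simp add: sign_swap_id)
    finally have "?alt (point_mass (tabloid lam s)) x = - ?alt (point_mass (tabloid lam s)) x" for x
      by (metis cscale_apply mult_minus1 of_int_1 of_int_minus)
    then have "?alt (point_mass (tabloid lam s)) x = 0" for x
      by (metis add.inverse_inverse eq_neg_iff_add_eq_0 mult_2 mult_eq_0_iff zero_neq_numeral)
    then have "?alt (point_mass (tabloid lam s)) = 0" by (simp add: fun_eq_iff)
    then have "?alt (point_mass (tabloid lam s)) = cscale 0 (polytabloid lam t)"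
      by (simp only: cscale_zero)
    then show ?thesis using that unfolding n_def by blast
  next
    case True
    define q where "q a = (row a, col a)" for a
    define D where "D = q ` {..<n}"
    have q: "inj_on q {..<n}" using True unfolding q_def .
    have "D = cells lam"
    proof (rule eq_if_initial_columns)
      show "finite D" "finite (cells lam)" by (simp_all add: D_def)
      show "{i. (i, j) \<in> cells lam} = {..<card {i. (i, j) \<in> cells lam}}" for j
        by (rule cells_column_initial[OF lam])
      show "card {i. (i, j) \<in> D} = card {i. (i, j) \<in> cells lam}" for j
      proof -
        let ?A = "{a. a < n \<and> col a = j}"
        have "{i. (i, j) \<in> D} = row ` ?A" unfolding D_def q_def by auto
        moreover have "inj_on row ?A" using q unfolding inj_on_def q_def by auto
        moreover have "{i. (i, j) \<in> cells lam} = (\<lambda>a. fst (pos lam t a)) ` ?A"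
        proof (intro equalityI subsetI)
          fix i assume "i \<in> {i. (i, j) \<in> cells lam}"
          then have "(i, j) \<in> cells lam" by simp
          then show "i \<in> (\<lambda>a. fst (pos lam t a)) ` ?A"
            using tableau_less[OF t] t by (intro image_eqI[of _ _ "t (i, j)"]) (auto simp: n_def col_def)
        next
          fix i assume "i \<in> (\<lambda>a. fst (pos lam t a)) ` ?A"
          then obtain a where "a < n" "col a = j" "i = fst (pos lam t a)" by blast
          then show "i \<in> {i. (i, j) \<in> cells lam}"
            using pos_in_cells[OF t, of a] unfolding n_def col_def by (metis mem_Collect_eq prod.collapse)
        qed
        moreover have "inj_on (\<lambda>a. fst (pos lam t a)) ?A"
        proof (rule inj_onI)
          fix a b assume "a \<in> ?A" "b \<in> ?A" "fst (pos lam t a) = fst (pos lam t b)"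
          then have "pos lam t a = pos lam t b" "a < n" "b < n" unfolding col_def by (auto simp: prod_eq_iff)
          then show "a = b" using tableau_pos[OF t] unfolding n_def by metis
        qed
        ultimately show ?thesis by (simp add: card_image)
      qed
      have "(\<Sum>p\<in>D. fst p) = (\<Sum>a<n. row a)" unfolding D_def using sum.reindex[OF q, of fst] by (simp add: q_def)
      also have "\<dots> = (\<Sum>p\<in>cells lam. fst p)"
        unfolding row_def n_def by (rule sum.reindex_bij_betw[OF pos_bij[OF s]])
      finally show "(\<Sum>p\<in>D. fst p) = (\<Sum>p\<in>cells lam. fst p)" .
    qed
    then have qb: "bij_betw q {..<n} (cells lam)" using q unfolding D_def bij_betw_def by blast
    \<comment> \<open>\<open>\<rho>\<close> sends an entry to the one at its row in \<open>s\<close> and its column in \<open>t\<close>, so it preserves columns of \<open>t\<close>.\<close>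
    define \<rho> where "\<rho> a = (if a < n then t (q a) else a)" for a
    have "bij_betw (t \<circ> q) {..<n} {..<n}"
      using bij_betw_trans[OF qb tableau_bij[OF t]] unfolding n_def .
    then have "bij_betw \<rho> {..<n} {..<n}"
      by (rule bij_betw_cong[THEN iffD1, rotated]) (simp add: \<rho>_def)
    then have rp: "\<rho> permutes {..<n}" by (rule bij_imp_permutes) (simp add: \<rho>_def)
    have pos_r: "pos lam t (\<rho> a) = q a" if "a < n" for a
      using that pos_tableau[OF t] bij_betwE[OF qb] by (simp add: \<rho>_def)
    have rC: "\<rho> \<in> fibre_perms {..<n} (snd \<circ> pos lam t)"
      unfolding fibre_perms_def using rp pos_r by (simp add: q_def col_def)
    define \<sigma> where "\<sigma> = pinv \<rho>"
    have sC: "\<sigma> \<in> fibre_perms {..<n} (snd \<circ> pos lam t)" unfolding \<sigma>_def by (rule inv_fibre_perms[OF rC])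
    note sp = fibre_permsD(1)[OF sC]
    have "pinv \<sigma> = \<rho>" unfolding \<sigma>_def by (rule permutes_inv_inv[OF rp])
    then have "tabloid lam (\<sigma> \<circ> t) = tabloid lam s"
      using permuted_tabloid_eq_iff[OF t s sp[unfolded n_def]] pos_r unfolding n_def[symmetric]
      by (simp add: q_def row_def)
    then have "M.act \<sigma> (point_mass (tabloid lam t)) = point_mass (tabloid lam s)"
      using M.act_point_mass[OF sp[unfolded n_def]] tabloid_action_tabloid by metis
    then have "?alt (point_mass (tabloid lam s)) = cscale (of_int (sign \<sigma>)) (polytabloid lam t)"
      using M.alt_act[OF _ sC, of lam "point_mass (tabloid lam t)"] polytabloid_eq_alt[OF t] unfolding n_def by simp
    then show ?thesis using that unfolding n_def by blast
  qed
qed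

lemma alt_in_line:
  assumes lam: "is_partition lam" and t: "t \<in> tableaux lam" and f: "f \<in> funs_on (tabloids lam)"
  obtains k where "M.alt {..<sum_list lam} (snd \<circ> pos lam t) f = cscale k (polytabloid lam t)"
proof -
  let ?alt = "M.alt {..<sum_list lam} (snd \<circ> pos lam t)"
  have "\<exists>k. ?alt (point_mass x) = cscale k (polytabloid lam t)" if "x \<in> tabloids lam" for x
    using that alt_tabloid[OF lam t] unfolding tabloids_def by blast
  then obtain k where k: "\<And>x. x \<in> tabloids lam \<Longrightarrow> ?alt (point_mass x) = cscale (k x) (polytabloid lam t)"
    by metis
  have "?alt f = (\<Sum>x\<in>tabloids lam. cscale (f x) (?alt (point_mass x)))"
    by (subst funs_on_expand[OF M.finite_X f]) (simp only: M.alt_sum M.alt_scale)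
  also have "\<dots> = (\<Sum>x\<in>tabloids lam. cscale (f x * k x) (polytabloid lam t))"
    by (rule sum.cong[OF refl]) (simp only: k cscale_cscale)
  also have "\<dots> = cscale (\<Sum>x\<in>tabloids lam. f x * k x) (polytabloid lam t)"
    by (simp add: fun_eq_iff sum_fun_apply sum_distrib_right)
  finally show ?thesis using that by blast
qed

text \<open>
  James's submodule theorem. A submodule on which some antisymmetriser does not vanish contains a
  multiple of a polytabloid, by \<open>alt_in_line\<close>, hence all of them. Otherwise it is orthogonal to every
  polytabloid, because antisymmetrisers are self-adjoint.
\<close>

theorem irreducible_specht:
  assumes lam: "is_partition lam"
  shows "irreducible_module (sum_list lam) specht_action (specht lam)"
proof -
  let ?n = "sum_list lam"
  have nz: "polytabloid lam t \<noteq> 0" if "t \<in> tableaux lam" for t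
    using polytabloid_at_own_tabloid[OF that] by auto
  obtain t0 where t0: "t0 \<in> tableaux lam" using tableaux_nonempty by blast
  have "specht lam \<noteq> {0}" using polytabloid_in_specht[OF t0] nz[OF t0] by blast
  moreover have "U = {0} \<or> U = specht lam" if U: "submodule_of ?n specht_action U" "U \<subseteq> specht lam" for U
  proof (cases "\<exists>u\<in>U. \<exists>t\<in>tableaux lam. M.alt {..<?n} (snd \<circ> pos lam t) u \<noteq> 0")
    case True
    then obtain u t where u: "u \<in> U" "t \<in> tableaux lam" "M.alt {..<?n} (snd \<circ> pos lam t) u \<noteq> 0" by blast
    note sU = submodule_ofD[OF U(1), unfolded specht_action_def]
    have "u \<in> funs_on (tabloids lam)" using u(1) U(2) specht_funs_on by blast
    then obtain k where k: "M.alt {..<?n} (snd \<circ> pos lam t) u = cscale k (polytabloid lam t)"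
      using alt_in_line[OF lam u(2)] by blast
    have "k \<noteq> 0" using k u(3) by (auto simp only: cscale_zero)
    have "M.alt {..<?n} (snd \<circ> pos lam t) u \<in> U"
      by (rule M.alt_submodule[OF sU(1) _ u(1)]) (rule sU(2))
    then have "cscale (inverse k) (cscale k (polytabloid lam t)) \<in> U"
      unfolding k by (rule cfun.subspace_scale[OF sU(1)])
    then have tU: "polytabloid lam t \<in> U"
      unfolding cscale_cscale left_inverse[OF \<open>k \<noteq> 0\<close>] cscale_one .
    have "polytabloid lam s \<in> U" if s: "s \<in> tableaux lam" for s
    proof -
      obtain \<sigma> where \<sigma>: "\<sigma> permutes {..<?n}" "s = restrict (\<sigma> \<circ> t) (cells lam)"
        using tableaux_transitive[OF u(2) s] by blast
      show ?thesis unfolding \<sigma>(2) act_polytabloid[OF u(2) \<sigma>(1), symmetric] by (rule sU(2)[OF \<sigma>(1) tU])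
    qed
    then have "specht lam \<subseteq> U" unfolding specht_def by (intro cfun.span_minimal sU(1)) blast
    then show ?thesis using U(2) by blast
  next
    case False
    have "u = 0" if u: "u \<in> U" for u
    proof -
      have uX: "u \<in> funs_on (tabloids lam)" using u U(2) specht_funs_on by blast
      have "specht lam \<subseteq> {v. inner_on (tabloids lam) u v = 0}"
        unfolding specht_def
      proof (rule cfun.span_minimal)
        show "cfun.subspace {v. inner_on (tabloids lam) u v = 0}"
          by (rule cfun.subspaceI)
            (simp_all only: mem_Collect_eq inner_on_zero inner_on_add_right inner_on_scale_right add_0_left mult_zero_right)
        show "polytabloid lam ` tableaux lam \<subseteq> {v. inner_on (tabloids lam) u v = 0}"
        proof clarify
          fix t assume t: "t \<in> tableaux lam"
          have "M.alt {..<?n} (snd \<circ> pos lam t) u = 0" using False u t by blast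
          then show "inner_on (tabloids lam) u (polytabloid lam t) = 0"
            unfolding polytabloid_eq_alt[OF t] M.inner_alt[OF order_refl, symmetric] by (simp only: inner_on_zero)
        qed
      qed
      then show ?thesis using inner_on_self_eq_0[OF M.finite_X uX] u U(2) by blast
    qed
    then show ?thesis using cfun.subspace_0[OF submodule_ofD(1)[OF U(1)]] by blast
  qed
  ultimately show ?thesis unfolding irreducible_module_def using submodule_specht by blast
qed


section \<open>Every irreducible module is a Specht module\<close>

lemma partition_of_down_closed:
  assumes fin: "finite D" and dc: "down_closed D"
  obtains \<nu> where "is_partition \<nu>" "cells \<nu> = D"
proof -
  define l where "l = card {i. (i, 0) \<in> D}"
  define r where "r i = card {j. (i, j) \<in> D}" for i
  have fin0: "finite {i. (i, 0) \<in> D}"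
    by (rule finite_subset[OF _ finite_imageI[OF fin, of fst]]) force
  have finr: "finite {j. (i, j) \<in> D}" for i
    by (rule finite_subset[OF _ finite_imageI[OF fin, of snd]]) force
  have l: "(i, 0) \<in> D \<longleftrightarrow> i < l" for i
    using downward_closed_eq_lessThan[OF fin0] down_closedD[OF dc] unfolding l_def
    by (metis (no_types, lifting) lessThan_iff mem_Collect_eq order_refl)
  have r: "(i, j) \<in> D \<longleftrightarrow> j < r i" for i j
    using downward_closed_eq_lessThan[OF finr, of i] down_closedD[OF dc] unfolding r_def
    by (metis (no_types, lifting) lessThan_iff mem_Collect_eq order_refl)
  have "cells (map r [0..<l]) = D"
  proof -
    have "(i, j) \<in> cells (map r [0..<l]) \<longleftrightarrow> (i, j) \<in> D" for i j
      using l[of i] r[of i j] down_closedD[OF dc, of i j i 0] by (auto simp: mem_cells)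
    then show ?thesis by auto
  qed
  moreover have "is_partition (map r [0..<l])"
  proof -
    have "r i' \<le> r i" if "i \<le> i'" for i i'
      unfolding r_def by (rule card_mono[OF finr]) (use down_closedD[OF dc] that in blast)
    moreover have "0 < r i" if "i < l" for i using l[of i] r[of i 0] that by simp
    ultimately show ?thesis unfolding is_partition_def by (auto simp: sorted_wrt_iff_nth_less)
  qed
  ultimately show ?thesis using that by blast
qed

context permutation_rep
begin

text \<open>
  Take \<open>w\<close> and the positions \<open>q\<close> from \<open>exists_nonzero_polytabloid_image\<close>. Since \<open>w\<close> is fixed by the row
  group, \<open>tabloid (\<sigma> t) \<mapsto> \<sigma> w\<close> extends linearly to tabloid space. Summing over all \<open>\<sigma>\<close> instead of
  over tabloids only multiplies this map \<open>\<phi>\<close> by the order of the row group. It sends the polytabloid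
  of \<open>t\<close> to a positive multiple of the antisymmetrisation of \<open>w\<close>, which is nonzero, and Schur's lemma
  applies.
\<close>

theorem irreducible_isomorphic_to_specht:
  assumes W: "irreducible_module n act W" "W \<subseteq> funs_on X"
  obtains \<nu> where "\<nu> \<in> partitions_of n" "isomorphic_modules n specht_action (specht \<nu>) act W"
proof -
  let ?N = "{..<n}"
  note sW = submodule_ofD[OF irreducible_moduleD(1)[OF W(1)]]
  obtain q w where q: "inj_on q ?N" "down_closed (q ` ?N)" and w: "w \<in> W"
    "\<And>\<pi>. \<pi> \<in> fibre_perms ?N (fst \<circ> q) \<Longrightarrow> act \<pi> w = w" "alt ?N (snd \<circ> q) w \<noteq> 0"
    using exists_nonzero_polytabloid_image[OF order_refl sW(1) W(2) irreducible_moduleD(2)[OF W(1)] sW(2)] by blast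
  obtain \<nu> where \<nu>: "is_partition \<nu>" "cells \<nu> = q ` ?N"
    using partition_of_down_closed[OF _ q(2)] by blast
  have n: "sum_list \<nu> = n" using card_cells[of \<nu>] card_image[OF q(1)] \<nu>(2) by simp
  have "bij_betw q {..<sum_list \<nu>} (cells \<nu>)" using q(1) \<nu>(2) unfolding n bij_betw_def by simp
  then obtain t where t: "t \<in> tableaux \<nu>" "\<And>a. a < n \<Longrightarrow> pos \<nu> t a = q a"
    using tableau_of_positions n by metis
  define P where "P = {\<pi>. \<pi> permutes ?N}"
  have fP: "finite P" unfolding P_def by (rule finite_permutations) simp
  define \<phi> where "\<phi> f = (\<Sum>\<sigma>\<in>P. cscale (f (tabloid \<nu> (\<sigma> \<circ> t))) (act \<sigma> w))" for f :: "nat set list \<Rightarrow> complex"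
  have hom: "equivariant_map n (induced_action tabloid_action) (specht \<nu>) act W \<phi>"
    unfolding equivariant_map_def
  proof (intro conjI ballI allI impI)
    show "\<phi> f \<in> W" for f
      unfolding \<phi>_def P_def by (intro cfun.subspace_sum[OF sW(1)] cfun.subspace_scale[OF sW(1)] sW(2) w(1)) simp
    show "\<phi> (f + g) = \<phi> f + \<phi> g" for f g
      unfolding \<phi>_def sum.distrib[symmetric] by (rule sum.cong[OF refl]) (simp add: fun_eq_iff algebra_simps)
    show "\<phi> (cscale k f) = cscale k (\<phi> f)" for k f
      unfolding \<phi>_def cscale_sum by (simp only: cscale_cscale cscale_apply)
    fix \<tau> f assume \<tau>: "\<tau> permutes ?N"
    have "\<phi> (induced_action tabloid_action \<tau> f)
        = (\<Sum>\<sigma>\<in>P. cscale (f (tabloid \<nu> (pinv \<tau> \<circ> \<sigma> \<circ> t))) (act \<sigma> w))"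
      unfolding \<phi>_def induced_action_def[of tabloid_action] tabloid_action_tabloid by (simp only: o_assoc)
    also have "\<dots> = (\<Sum>\<sigma>\<in>P. cscale (f (tabloid \<nu> (pinv \<tau> \<circ> (\<tau> \<circ> \<sigma>) \<circ> t))) (act (\<tau> \<circ> \<sigma>) w))"
      unfolding P_def by (rule setum_permutations_compose_left[OF \<tau>])
    also have "\<dots> = (\<Sum>\<sigma>\<in>P. act \<tau> (cscale (f (tabloid \<nu> (\<sigma> \<circ> t))) (act \<sigma> w)))"
    proof (rule sum.cong[OF refl])
      fix \<sigma> assume "\<sigma> \<in> P"
      then have s: "\<sigma> permutes ?N" by (simp add: P_def)
      have "pinv \<tau> \<circ> (\<tau> \<circ> \<sigma>) = \<sigma>" using permutes_inverses(2)[OF \<tau>] by (simp add: fun_eq_iff)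
      then show "cscale (f (tabloid \<nu> (pinv \<tau> \<circ> (\<tau> \<circ> \<sigma>) \<circ> t))) (act (\<tau> \<circ> \<sigma>) w)
          = act \<tau> (cscale (f (tabloid \<nu> (\<sigma> \<circ> t))) (act \<sigma> w))"
        unfolding induced_action_scale act_comp[OF \<tau> s] by (simp only:)
    qed
    also have "\<dots> = act \<tau> (\<phi> f)" unfolding \<phi>_def induced_action_sum ..
    finally show "\<phi> (induced_action tabloid_action \<tau> f) = act \<tau> (\<phi> f)" .
  qed
  let ?C = "fibre_perms ?N (snd \<circ> pos \<nu> t)"
  have "\<phi> (polytabloid \<nu> t) \<noteq> 0"
  proof -
    define K where "K = {\<rho>\<in>P. tabloid \<nu> (\<rho> \<circ> t) = tabloid \<nu> t}"
    have fK: "finite K" unfolding K_def using fP by simp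
    have "id \<in> K" unfolding K_def P_def by (simp only: mem_Collect_eq permutes_id id_comp simp_thms)
    then have K0: "card K \<noteq> 0" using fK by auto
    have stab: "act \<rho> w = w" if "\<rho> \<in> K" for \<rho>
    proof -
      have r: "\<rho> permutes ?N" "tabloid \<nu> (\<rho> \<circ> t) = tabloid \<nu> t" using that by (simp_all add: K_def P_def)
      have "fst (q (pinv \<rho> a)) = fst (q a)" if "a < n" for a
      proof -
        have "pinv \<rho> a < n" using permutes_in_image[OF permutes_inv[OF r(1)], of a] that by simp
        then show ?thesis
          using permuted_tabloid_eq_iff[OF t(1) t(1), of \<rho>] r t(2) that unfolding n by auto
      qed
      then have "pinv \<rho> \<in> fibre_perms ?N (fst \<circ> q)"
        unfolding fibre_perms_def using permutes_inv[OF r(1)] by simp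
      then have "pinv (pinv \<rho>) \<in> fibre_perms ?N (fst \<circ> q)" by (rule inv_fibre_perms)
      then show ?thesis using w(2) permutes_inv_inv[OF r(1)] by simp
    qed
    \<comment> \<open>The permutations \<open>\<sigma>\<close> with the same tabloid as \<open>\<pi>\<close> form the coset of \<open>\<pi>\<close> modulo the row group \<open>K\<close>.\<close>
    have inner: "(\<Sum>\<sigma>\<in>P. if tabloid \<nu> (\<pi> \<circ> t) = tabloid \<nu> (\<sigma> \<circ> t) then act \<sigma> w else 0)
        = cscale (of_nat (card K)) (act \<pi> w)" if p: "\<pi> permutes ?N" for \<pi>
    proof -
      have cancel: "tabloid \<nu> (\<pi> \<circ> t) = tabloid \<nu> (\<pi> \<circ> \<rho> \<circ> t) \<longleftrightarrow> tabloid \<nu> (\<rho> \<circ> t) = tabloid \<nu> t" for \<rho>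
      proof
        assume "tabloid \<nu> (\<pi> \<circ> t) = tabloid \<nu> (\<pi> \<circ> \<rho> \<circ> t)"
        then have "tabloid_action \<pi> (tabloid \<nu> t) = tabloid_action \<pi> (tabloid \<nu> (\<rho> \<circ> t))"
          unfolding tabloid_action_tabloid by (simp only: o_assoc)
        then have "tabloid_action (pinv \<pi>) (tabloid_action \<pi> (tabloid \<nu> t))
            = tabloid_action (pinv \<pi>) (tabloid_action \<pi> (tabloid \<nu> (\<rho> \<circ> t)))"
          by (rule arg_cong)
        then show "tabloid \<nu> (\<rho> \<circ> t) = tabloid \<nu> t"
          using M.a_inverse(1)[of \<pi> \<nu>] p unfolding n by simp
      next
        assume "tabloid \<nu> (\<rho> \<circ> t) = tabloid \<nu> t"
        then have "tabloid_action \<pi> (tabloid \<nu> t) = tabloid_action \<pi> (tabloid \<nu> (\<rho> \<circ> t))" by simp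
        then show "tabloid \<nu> (\<pi> \<circ> t) = tabloid \<nu> (\<pi> \<circ> \<rho> \<circ> t)"
          unfolding tabloid_action_tabloid by (simp only: o_assoc)
      qed
      have "(\<Sum>\<sigma>\<in>P. if tabloid \<nu> (\<pi> \<circ> t) = tabloid \<nu> (\<sigma> \<circ> t) then act \<sigma> w else 0)
          = (\<Sum>\<rho>\<in>P. if tabloid \<nu> (\<pi> \<circ> t) = tabloid \<nu> (\<pi> \<circ> \<rho> \<circ> t) then act (\<pi> \<circ> \<rho>) w else 0)"
        unfolding P_def by (rule setum_permutations_compose_left[OF p])
      also have "\<dots> = (\<Sum>\<rho>\<in>P. if \<rho> \<in> K then act \<pi> w else 0)"
      proof (rule sum.cong[OF refl])
        fix \<rho> assume r: "\<rho> \<in> P"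
        show "(if tabloid \<nu> (\<pi> \<circ> t) = tabloid \<nu> (\<pi> \<circ> \<rho> \<circ> t) then act (\<pi> \<circ> \<rho>) w else 0)
            = (if \<rho> \<in> K then act \<pi> w else 0)"
          unfolding cancel using r stab[of \<rho>] act_comp[OF p, of \<rho> w] by (auto simp: K_def P_def)
      qed
      also have "\<dots> = (\<Sum>\<rho>\<in>K. act \<pi> w)"
        using sum.inter_filter[OF fP, of "\<lambda>_. act \<pi> w" "\<lambda>\<rho>. \<rho> \<in> K"] by (simp add: K_def)
      also have "\<dots> = cscale (of_nat (card K)) (act \<pi> w)"
        by (simp add: fun_eq_iff sum_fun_apply)
      finally show ?thesis .
    qed
    have "\<phi> (polytabloid \<nu> t) = (\<Sum>\<sigma>\<in>P. \<Sum>\<pi>\<in>?C. cscale (of_int (sign \<pi>))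
        (if tabloid \<nu> (\<pi> \<circ> t) = tabloid \<nu> (\<sigma> \<circ> t) then act \<sigma> w else 0))"
      unfolding \<phi>_def polytabloid_def column_stabilizer_eq[OF t(1)] n
      by (rule sum.cong[OF refl]) (auto simp: fun_eq_iff sum_fun_apply sum_distrib_right intro!: sum.cong)
    also have "\<dots> = (\<Sum>\<pi>\<in>?C. cscale (of_int (sign \<pi>)) (\<Sum>\<sigma>\<in>P.
        if tabloid \<nu> (\<pi> \<circ> t) = tabloid \<nu> (\<sigma> \<circ> t) then act \<sigma> w else 0))"
      unfolding cscale_sum by (rule sum.swap)
    also have "\<dots> = (\<Sum>\<pi>\<in>?C. cscale (of_nat (card K)) (cscale (of_int (sign \<pi>)) (act \<pi> w)))"
      by (rule sum.cong[OF refl]) (simp only: inner[OF fibre_permsD(1)] cscale_cscale mult.commute)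
    also have "\<dots> = cscale (of_nat (card K)) (alt ?N (snd \<circ> pos \<nu> t) w)"
      unfolding alt_def cscale_sum ..
    also have "alt ?N (snd \<circ> pos \<nu> t) w = alt ?N (snd \<circ> q) w"
      by (rule alt_cong) (simp add: t(2))
    finally show ?thesis using w(3) K0 by (simp only: cscale_eq_0_iff of_nat_eq_0_iff simp_thms)
  qed
  then have "isomorphic_modules n specht_action (specht \<nu>) act W"
    using schur_lemma[OF irreducible_specht[OF \<nu>(1), unfolded specht_action_def n] W(1) hom polytabloid_in_specht[OF t(1)]]
    unfolding specht_action_def by blast
  moreover have "\<nu> \<in> partitions_of n" using \<nu>(1) n by (simp add: partitions_of_def)
  ultimately show ?thesis using that by blast
qed

end


section \<open>Averaging over block permutations\<close>

lemma linear_nonzero_on_generators: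
  assumes add: "\<And>f g. T (f + g) = T f + T g" and scale: "\<And>c f. T (cscale c f) = cscale c (T f)"
    and v: "v \<in> cfun.span G" "T v \<noteq> 0"
  shows "\<exists>g\<in>G. T g \<noteq> 0"
proof (rule ccontr)
  assume zero: "\<not> ?thesis"
  have "T 0 = 0" using scale[of 0 0] by (simp only: cscale_zero)
  have "T v = 0"
    using v(1)
  proof (induction rule: cfun.span_induct_alt)
    case base
    show ?case by fact
  next
    case (step c x y)
    then have "T x = 0" using zero by blast
    then show ?case using step(2) by (simp only: add scale cscale_zero add_0_left)
  qed
  then show False using v(2) by blast
qed

context permutation_rep
begin

definition avg :: "(nat \<Rightarrow> nat) \<Rightarrow> ('x \<Rightarrow> complex) \<Rightarrow> 'x \<Rightarrow> complex" where
  "avg blk f = (\<Sum>\<sigma>\<in>fibre_perms {..<n} blk. act \<sigma> f)"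

definition block_invariant :: "(nat \<Rightarrow> nat) \<Rightarrow> ('x \<Rightarrow> complex) \<Rightarrow> bool" where
  "block_invariant blk f \<longleftrightarrow> (\<forall>\<sigma>\<in>fibre_perms {..<n} blk. act \<sigma> f = f)"

lemma avg_add: "avg blk (f + g) = avg blk f + avg blk g"
  unfolding avg_def induced_action_add sum.distrib ..

lemma avg_scale: "avg blk (cscale c f) = cscale c (avg blk f)"
  unfolding avg_def induced_action_scale cscale_sum ..

lemma avg_act:
  assumes s: "\<sigma> \<in> fibre_perms {..<n} blk"
  shows "avg blk (act \<sigma> f) = avg blk f"
proof -
  have "avg blk f = (\<Sum>\<pi>\<in>fibre_perms {..<n} blk. act (\<pi> \<circ> \<sigma>) f)"
    unfolding avg_def by (rule sum_fibre_perms_right[OF s, symmetric])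
  also have "\<dots> = avg blk (act \<sigma> f)"
    unfolding avg_def by (rule sum.cong[OF refl]) (simp only: act_comp[OF fibre_permsD(1) fibre_permsD(1)[OF s]])
  finally show ?thesis ..
qed

lemma avg_invariant: "block_invariant blk (avg blk f)"
  unfolding block_invariant_def
proof
  fix \<sigma> assume s: "\<sigma> \<in> fibre_perms {..<n} blk"
  have "act \<sigma> (avg blk f) = (\<Sum>\<pi>\<in>fibre_perms {..<n} blk. act (\<sigma> \<circ> \<pi>) f)"
    unfolding avg_def induced_action_sum
    by (rule sum.cong[OF refl]) (simp only: act_comp[OF fibre_permsD(1)[OF s] fibre_permsD(1)])
  also have "\<dots> = avg blk f" unfolding avg_def by (rule sum_fibre_perms_left[OF s])
  finally show "act \<sigma> (avg blk f) = avg blk f" .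
qed

lemma avg_of_invariant:
  assumes "block_invariant blk f"
  shows "avg blk f = cscale (of_nat (card (fibre_perms {..<n} blk))) f"
proof -
  have "avg blk f = (\<Sum>\<sigma>\<in>fibre_perms {..<n} blk. f)"
    unfolding avg_def using assms by (intro sum.cong refl) (simp add: block_invariant_def)
  then show ?thesis by (simp add: fun_eq_iff sum_fun_apply)
qed

text \<open>
  Averaging is linear, maps the module onto its invariant vectors and multiplies invariant vectors
  by the order of the group.
\<close>

lemma exists_invariant_iff:
  assumes V: "submodule_of n act V" and span: "V = cfun.span G"
  shows "(\<exists>v\<in>V. v \<noteq> 0 \<and> block_invariant blk v) \<longleftrightarrow> (\<exists>g\<in>G. avg blk g \<noteq> 0)"
proof
  assume "\<exists>v\<in>V. v \<noteq> 0 \<and> block_invariant blk v"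
  then obtain v where v: "v \<in> V" "v \<noteq> 0" "block_invariant blk v" by blast
  have "fibre_perms {..<n} blk \<noteq> {}" using id_fibre_perms by blast
  then have "card (fibre_perms {..<n} blk) \<noteq> 0"
    using finite_fibre_perms[OF finite_lessThan, of n blk] by (simp add: card_eq_0_iff)
  then have "avg blk v \<noteq> 0"
    unfolding avg_of_invariant[OF v(3)] cscale_eq_0_iff using v(2) by simp
  with v(1) show "\<exists>g\<in>G. avg blk g \<noteq> 0"
    unfolding span by (intro linear_nonzero_on_generators[of "avg blk"] avg_add avg_scale)
next
  assume "\<exists>g\<in>G. avg blk g \<noteq> 0"
  then obtain g where g: "g \<in> G" "avg blk g \<noteq> 0" by blast
  note sV = submodule_ofD[OF V]
  have "g \<in> V" unfolding span by (rule cfun.span_base[OF g(1)])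
  then have "avg blk g \<in> V"
    unfolding avg_def by (intro cfun.subspace_sum[OF sV(1)] sV(2)) (rule fibre_permsD(1))
  then show "\<exists>v\<in>V. v \<noteq> 0 \<and> block_invariant blk v" using g(2) avg_invariant by blast
qed

lemma act_alt_same:
  assumes s: "\<sigma> \<in> fibre_perms {..<n} c"
  shows "act \<sigma> (alt {..<n} c f) = cscale (of_int (sign \<sigma>)) (alt {..<n} c f)"
proof -
  note p = fibre_permsD(1)[OF s]
  have "act \<sigma> (alt {..<n} c f) = alt {..<n} (c \<circ> pinv \<sigma>) (act \<sigma> f)"
    by (rule act_alt[OF order_refl p])
  also have "\<dots> = alt {..<n} c (act \<sigma> f)"
    by (rule alt_cong) (simp add: fibre_permsD(2)[OF inv_fibre_perms[OF s]])
  also have "\<dots> = cscale (of_int (sign \<sigma>)) (alt {..<n} c f)" by (rule alt_act[OF order_refl s])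
  finally show ?thesis .
qed

end


section \<open>Semistandard tableaux and invariants of Specht modules\<close>

text \<open>
  The first \<open>j + 1\<close> entries of the sorted second list each dominate an entry of the first list, so
  more than \<open>j\<close> entries of the first list are smaller than entry \<open>j\<close> of the sorted second one.
\<close>

lemma sort_nth_less:
  fixes f g :: "nat \<Rightarrow> nat"
  assumes ba: "b \<le> a" and less: "\<And>k. k < b \<Longrightarrow> f k < g k" and j: "j < b"
  shows "sort (map f [0..<a]) ! j < sort (map g [0..<b]) ! j"
proof (rule ccontr)
  define xs where "xs = sort (map f [0..<a])"
  define ys where "ys = sort (map g [0..<b])"
  assume "\<not> ?thesis"
  then have le: "ys ! j \<le> xs ! j" unfolding xs_def ys_def by simp
  have len: "length xs = a" "length ys = b" by (simp_all add: xs_def ys_def)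
  have count_sort: "length (filter P (sort (map h [0..<m]))) = card {k. k < m \<and> P (h k)}" for P and h :: "nat \<Rightarrow> nat" and m
  proof -
    have "length (filter P (sort (map h [0..<m]))) = size (filter_mset P (mset (map h [0..<m])))"
      by (metis mset_filter mset_sort size_mset)
    also have "\<dots> = length (filter P (map h [0..<m]))" by (metis mset_filter size_mset)
    also have "\<dots> = card {k. k < m \<and> P (h k)}" unfolding length_filter_conv_card by (rule arg_cong[where f = card]) auto
    finally show ?thesis .
  qed
  have "Suc j \<le> card {k. k < b \<and> g k \<le> ys ! j}"
  proof -
    have "{..j} \<subseteq> {i. i < length ys \<and> ys ! i \<le> ys ! j}"
      using j len sorted_nth_mono[of ys] by (auto simp: ys_def)
    then have "card {..j} \<le> length (filter (\<lambda>v. v \<le> ys ! j) ys)"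
      unfolding length_filter_conv_card by (intro card_mono) auto
    then show ?thesis unfolding ys_def count_sort by simp
  qed
  also have "\<dots> \<le> card {k. k < a \<and> f k < ys ! j}"
    using ba less by (intro card_mono) (auto intro: less_le_trans)
  also have "\<dots> = length (filter (\<lambda>v. v < ys ! j) xs)" unfolding xs_def count_sort ..
  also have "\<dots> \<le> j"
  proof -
    have "{i. i < length xs \<and> xs ! i < ys ! j} \<subseteq> {..<j}"
    proof
      fix i assume "i \<in> {i. i < length xs \<and> xs ! i < ys ! j}"
      then have i: "i < length xs" "xs ! i < xs ! j" using le by auto
      have "i < j"
      proof (rule ccontr)
        assume "\<not> i < j"
        then have "xs ! j \<le> xs ! i" using i(1) sorted_nth_mono[of xs j i] by (simp add: xs_def)
        then show False using i(2) by simp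
      qed
      then show "i \<in> {..<j}" by simp
    qed
    then have "card {i. i < length xs \<and> xs ! i < ys ! j} \<le> card {..<j}" by (intro card_mono) auto
    then show ?thesis unfolding length_filter_conv_card by simp
  qed
  finally show False by simp
qed

lemma card_by_rows:
  "card {p \<in> cells \<nu>. F p = m} = (\<Sum>i<length \<nu>. card {j. j < \<nu> ! i \<and> F (i, j) = m})"
proof -
  have "{p \<in> cells \<nu>. F p = m} = Sigma {..<length \<nu>} (\<lambda>i. {j. j < \<nu> ! i \<and> F (i, j) = m})"
    by (auto simp: cells_def)
  then show ?thesis by simp
qed

text \<open>
  Sort every column, which makes the columns strictly increasing, and then sort every row. The
  second step keeps the columns strict by \<open>sort_nth_less\<close>. Neither step changes the content.
\<close>

lemma exists_ssyt_of_column_injective: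
  fixes F :: "nat \<times> nat \<Rightarrow> nat"
  assumes \<nu>: "is_partition \<nu>"
    and inj: "\<And>i i' j. (i, j) \<in> cells \<nu> \<Longrightarrow> (i', j) \<in> cells \<nu> \<Longrightarrow> F (i, j) = F (i', j) \<Longrightarrow> i = i'"
  obtains T where "T \<in> ssyt \<nu>" "\<And>m. card {p \<in> cells \<nu>. T p = m} = card {p \<in> cells \<nu>. F p = m}"
proof -
  define I where "I j = {i. (i, j) \<in> cells \<nu>}" for j
  define S where "S j = (\<lambda>i. F (i, j)) ` I j" for j
  have I: "I j = {..<card (I j)}" for j unfolding I_def by (rule cells_column_initial[OF \<nu>])
  have finI: "finite (I j)" for j by (subst I) simp
  have finS: "finite (S j)" and cardS: "card (S j) = card (I j)" for j
  proof -
    show "finite (S j)" unfolding S_def using finI by simp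
    have "inj_on (\<lambda>i. F (i, j)) (I j)" unfolding I_def using inj by (auto simp: inj_on_def)
    then show "card (S j) = card (I j)" unfolding S_def by (rule card_image)
  qed
  have in_cells: "(i, j) \<in> cells \<nu> \<longleftrightarrow> i < card (S j)" for i j
    using I[of j] unfolding cardS by (auto simp: I_def)
  define G where "G i j = sorted_list_of_set (S j) ! i" for i j
  have lenS: "length (sorted_list_of_set (S j)) = card (S j)" for j by simp
  have G_less: "G i j < G i' j" if "(i', j) \<in> cells \<nu>" "i < i'" for i i' j
    unfolding G_def using that in_cells strict_sorted_list_of_set[of "S j"]
    by (auto simp: sorted_wrt_iff_nth_less)
  define T where "T = (\<lambda>(i, j)\<in>cells \<nu>. sort (map (G i) [0..<\<nu> ! i]) ! j)"
  have T: "T (i, j) = sort (map (G i) [0..<\<nu> ! i]) ! j" if "(i, j) \<in> cells \<nu>" for i j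
    using that by (simp add: T_def)
  have "T \<in> ssyt \<nu>"
    unfolding ssyt_def
  proof (intro CollectI conjI allI impI)
    show "T \<in> extensional (cells \<nu>)" by (simp add: T_def)
    fix i j j' assume *: "(i, j) \<in> cells \<nu> \<and> (i, j') \<in> cells \<nu> \<and> j < j'"
    then show "T (i, j) \<le> T (i, j')"
      using sorted_nth_mono[OF sorted_sort, of j j' "map (G i) [0..<\<nu> ! i]"] by (simp add: T mem_cells)
  next
    fix i i' j assume *: "(i, j) \<in> cells \<nu> \<and> (i', j) \<in> cells \<nu> \<and> i < i'"
    then have i: "i < length \<nu>" "i' < length \<nu>" "j < \<nu> ! i'" by (simp_all add: mem_cells)
    have "\<nu> ! i' \<le> \<nu> ! i" using \<nu> i * sorted_wrt_nth_less[of "(\<ge>)" \<nu> i i'] unfolding is_partition_def by auto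
    moreover have "G i k < G i' k" if "k < \<nu> ! i'" for k using G_less that i * by (simp add: mem_cells)
    ultimately show "T (i, j) < T (i', j)" using sort_nth_less[of "\<nu> ! i'" "\<nu> ! i" "G i" "G i'" j] * i by (simp add: T)
  qed
  moreover have "card {p \<in> cells \<nu>. T p = m} = card {p \<in> cells \<nu>. F p = m}" for m
  proof -
    have row: "card {j. j < \<nu> ! i \<and> T (i, j) = m} = card {j. j < \<nu> ! i \<and> G i j = m}" if i: "i < length \<nu>" for i
    proof -
      let ?xs = "map (G i) [0..<\<nu> ! i]"
      have "{j. j < \<nu> ! i \<and> T (i, j) = m} = {j. j < length (sort ?xs) \<and> sort ?xs ! j = m}"
        using i T by (auto simp: mem_cells)
      then have "card {j. j < \<nu> ! i \<and> T (i, j) = m} = length (filter (\<lambda>v. v = m) (sort ?xs))"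
        unfolding length_filter_conv_card by simp
      also have "\<dots> = length (filter (\<lambda>v. v = m) ?xs)" by (metis mset_filter mset_sort size_mset)
      also have "\<dots> = card {j. j < \<nu> ! i \<and> G i j = m}"
        unfolding length_filter_conv_card by (rule arg_cong[where f = card]) auto
      finally show ?thesis .
    qed
    have "card {p \<in> cells \<nu>. T p = m} = card {p \<in> cells \<nu>. (case p of (i, j) \<Rightarrow> G i j) = m}"
      unfolding card_by_rows by (rule sum.cong[OF refl]) (simp add: row)
    also have "\<dots> = card {p \<in> cells \<nu>. F p = m}"
    proof -
      have by_cols: "card {p \<in> cells \<nu>. E p = m} = (\<Sum>j\<in>snd ` cells \<nu>. card {i \<in> I j. E (i, j) = m})" for E :: "nat \<times> nat \<Rightarrow> nat"
      proof -
        have "{p \<in> cells \<nu>. E p = m} = prod.swap ` Sigma (snd ` cells \<nu>) (\<lambda>j. {i \<in> I j. E (i, j) = m})"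
          by (force simp: I_def)
        then have "card {p \<in> cells \<nu>. E p = m} = card (Sigma (snd ` cells \<nu>) (\<lambda>j. {i \<in> I j. E (i, j) = m}))"
          by (simp add: card_image)
        also have "\<dots> = (\<Sum>j\<in>snd ` cells \<nu>. card {i \<in> I j. E (i, j) = m})"
          by (rule card_SigmaI) (use finI in auto)
        finally show ?thesis .
      qed
      have "card {i \<in> I j. G i j = m} = card {i \<in> I j. F (i, j) = m}" for j
      proof -
        have bF: "bij_betw (\<lambda>i. F (i, j)) (I j) (S j)"
          unfolding bij_betw_def S_def I_def using inj by (auto simp: inj_on_def)
        have "inj_on (\<lambda>i. G i j) (I j)"
          using G_less[of _ j] unfolding I_def by (auto simp: inj_on_def) (metis linorder_neqE_nat nat_neq_iff)
        moreover have "(\<lambda>i. G i j) ` I j = S j"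
        proof -
          have "(\<lambda>i. G i j) ` {..<card (S j)} = set (sorted_list_of_set (S j))"
            unfolding G_def set_conv_nth lenS by auto
          then show ?thesis using I[of j] finS cardS by simp
        qed
        ultimately have bG: "bij_betw (\<lambda>i. G i j) (I j) (S j)" by (simp add: bij_betw_def)
        have "card {i \<in> I j. h i = m} = card {v \<in> S j. v = m}" if "bij_betw h (I j) (S j)" for h
        proof -
          have e1: "{v \<in> S j. v = m} = h ` {i \<in> I j. h i = m}"
            unfolding bij_betw_imp_surj_on[OF that, symmetric] by blast
          have e2: "inj_on h {i \<in> I j. h i = m}" using that unfolding bij_betw_def inj_on_def by blast
          show ?thesis unfolding e1 by (rule card_image[OF e2, symmetric])
        qed
        from this[OF bF] this[OF bG] show ?thesis by simp
      qed
      then show ?thesis unfolding by_cols by simp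
    qed
    finally show ?thesis .
  qed
  ultimately show ?thesis using that by blast
qed

lemma schur_nonzero_iff:
  "schur \<nu> \<alpha> \<noteq> 0 \<longleftrightarrow>
    (\<exists>T\<in>ssyt \<nu>. \<forall>m. Poly_Mapping.lookup \<alpha> m = card {c \<in> cells \<nu>. T c = m})"
proof -
  let ?S = "{T \<in> ssyt \<nu>. \<forall>m. Poly_Mapping.lookup \<alpha> m = card {c \<in> cells \<nu>. T c = m}}"
  have "?S \<subseteq> (\<Pi>\<^sub>E _\<in>cells \<nu>. Poly_Mapping.keys \<alpha>)"
  proof
    fix T assume T: "T \<in> ?S"
    have "T p \<in> Poly_Mapping.keys \<alpha>" if "p \<in> cells \<nu>" for p
    proof -
      have "{c \<in> cells \<nu>. T c = T p} \<noteq> {}" using that by blast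
      then have "card {c \<in> cells \<nu>. T c = T p} \<noteq> 0" by simp
      then have "Poly_Mapping.lookup \<alpha> (T p) \<noteq> 0" using T by simp
      then show ?thesis by (simp add: in_keys_iff)
    qed
    moreover have "T \<in> extensional (cells \<nu>)" using T by (simp add: ssyt_def)
    ultimately show "T \<in> (\<Pi>\<^sub>E _\<in>cells \<nu>. Poly_Mapping.keys \<alpha>)" unfolding PiE_iff by blast
  qed
  then have "finite ?S" by (rule finite_subset) (simp add: finite_PiE)
  then have "schur \<nu> \<alpha> \<noteq> 0 \<longleftrightarrow> ?S \<noteq> {}" unfolding schur_def by simp
  then show ?thesis by blast
qed

text \<open>
  The average of the polytabloid of \<open>t\<close> over the block permutations is nonzero because its coefficient at the
  tabloid of \<open>t\<close> is positive: if a column permutation \<open>\<pi>\<close> of \<open>t\<close> does not change the contents of the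
  rows, then it is the identity. Indeed, if the rows above row \<open>i\<close> are fixed pointwise, then \<open>\<pi>\<close> can
  only bring entries into row \<open>i\<close> from further down, which are larger by column strictness, while
  the sum of row \<open>i\<close> must stay the same.
\<close>

lemma specht_invariant_of_ssyt:
  assumes t: "t \<in> tableaux \<nu>" and T: "T \<in> ssyt \<nu>"
  defines "blk \<equiv> \<lambda>a. T (pos \<nu> t a)"
  shows "\<exists>v\<in>specht \<nu>. v \<noteq> 0 \<and> permutation_rep.block_invariant (sum_list \<nu>) tabloid_action blk v"
proof -
  define n where "n = sum_list \<nu>"
  define row where "row a = fst (pos \<nu> t a)" for a
  let ?C = "fibre_perms {..<n} (snd \<circ> pos \<nu> t)" and ?B = "fibre_perms {..<n} blk"
  have blk_less: "blk a < blk b" if "a < n" "b < n" "snd (pos \<nu> t a) = snd (pos \<nu> t b)" "row a < row b" for a b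
  proof -
    obtain i j i' j' where ij: "pos \<nu> t a = (i, j)" "pos \<nu> t b = (i', j')" by (metis surj_pair)
    have "(i, j) \<in> cells \<nu>" "(i', j') \<in> cells \<nu>" using pos_in_cells[OF t] that(1,2) ij unfolding n_def by metis+
    then show ?thesis using T that(3,4) ij unfolding ssyt_def blk_def row_def by auto
  qed
  have only_id: "\<pi> = id" if p: "\<pi> \<in> ?C" and s: "\<sigma> \<in> ?B"
    and eq: "tabloid \<nu> (\<pi> \<circ> t) = tabloid \<nu> (pinv \<sigma> \<circ> t)" for \<pi> \<sigma>
  proof -
    note pp = fibre_permsD(1)[OF p] and sp = fibre_permsD(1)[OF s]
    have pn: "\<pi> a < n \<longleftrightarrow> a < n" and sn: "\<sigma> a < n \<longleftrightarrow> a < n" and pin: "pinv \<pi> a < n \<longleftrightarrow> a < n" for a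
      using permutes_in_image[OF pp, of a] permutes_in_image[OF sp, of a]
        permutes_in_image[OF permutes_inv[OF pp], of a] by simp_all
    have rows: "row (pinv \<pi> a) = row (\<sigma> a)" if a: "a < n" for a
    proof -
      have q: "pinv \<sigma> permutes {..<sum_list \<nu>}" using permutes_inv[OF sp] by (simp add: n_def)
      show ?thesis
        using eq a permuted_tabloid_eq_iff[OF t permuted_tableau(1)[OF t q], of \<pi>] pp
          permuted_tableau(2)[OF t q, of a] permutes_inv_inv[OF sp]
        unfolding tabloid_restrict row_def n_def by auto
    qed
    have row_sums: "(\<Sum>c | c < n \<and> row c = i. blk (\<pi> c)) = (\<Sum>c | c < n \<and> row c = i. blk c)" for i
    proof -
      have "(\<Sum>c | c < n \<and> row c = i. blk (\<pi> c)) = (\<Sum>a | a < n \<and> row (pinv \<pi> a) = i. blk a)"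
        by (rule sum.reindex_bij_witness[where i = "pinv \<pi>" and j = \<pi>])
          (auto simp: permutes_inverses[OF pp] pn pin)
      also have "\<dots> = (\<Sum>a | a < n \<and> row (\<sigma> a) = i. blk (\<sigma> a))"
        by (rule sum.cong) (use rows fibre_permsD(2)[OF s] in auto)
      also have "\<dots> = (\<Sum>c | c < n \<and> row c = i. blk c)"
        by (rule sum.reindex_bij_witness[where i = "pinv \<sigma>" and j = \<sigma>])
          (use permutes_inverses[OF sp] sn permutes_in_image[OF permutes_inv[OF sp]] in auto)
      finally show ?thesis .
    qed
    \<comment> \<open>Row \<open>i\<close> is fixed once all rows above it are.\<close>
    have "\<forall>c<n. row c = i \<longrightarrow> \<pi> c = c" for i
    proof (induction i rule: less_induct)
      case (less i)
      have col: "snd (pos \<nu> t (\<pi> c)) = snd (pos \<nu> t c)" if "c < n" for c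
        using fibre_permsD(2)[OF p, of c] that by simp
      have down: "i \<le> row (\<pi> c)" if c: "c < n" "row c = i" for c
      proof (rule ccontr)
        assume "\<not> i \<le> row (\<pi> c)"
        then have "\<pi> (\<pi> c) = \<pi> c" using less[of "row (\<pi> c)"] pn c(1) by simp
        then have "\<pi> c = c" using permutes_inj[OF pp] by (simp add: inj_eq)
        then show False using \<open>\<not> i \<le> row (\<pi> c)\<close> c(2) by simp
      qed
      have same: "\<pi> c = c" if c: "c < n" "row c = i" and r: "row (\<pi> c) = i" for c
      proof -
        have "pos \<nu> t (\<pi> c) = pos \<nu> t c" using col[OF c(1)] r c(2) unfolding row_def by (simp add: prod_eq_iff)
        then show ?thesis using tableau_pos[OF t] pn c(1) unfolding n_def by metis
      qed
      have le: "blk c \<le> blk (\<pi> c)" if "c \<in> {c. c < n \<and> row c = i}" for c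
        using that down[of c] same[of c] blk_less[of c "\<pi> c"] col[of c] pn[of c]
        by (cases "row (\<pi> c) = i") auto
      show ?case
      proof (intro allI impI)
        fix c assume c: "c < n" "row c = i"
        have "blk c = blk (\<pi> c)"
          by (rule sum_mono_inv[OF row_sums[symmetric] le]) (use c in auto)
        then have "row (\<pi> c) = i"
          using down[OF c] blk_less[of c "\<pi> c"] col[OF c(1)] pn c by (cases "row (\<pi> c) = i") auto
        then show "\<pi> c = c" by (rule same[OF c])
      qed
    qed
    then have "\<pi> c = c" for c using permutes_not_in[OF pp, of c] by (cases "c < n") auto
    then show ?thesis by (simp add: fun_eq_iff)
  qed
  have val: "polytabloid \<nu> t (tabloid \<nu> (pinv \<sigma> \<circ> t)) = (if tabloid \<nu> t = tabloid \<nu> (pinv \<sigma> \<circ> t) then 1 else 0)"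
    if s: "\<sigma> \<in> ?B" for \<sigma>
  proof -
    have "polytabloid \<nu> t (tabloid \<nu> (pinv \<sigma> \<circ> t))
        = (\<Sum>\<pi>\<in>?C. if \<pi> = id then (if tabloid \<nu> t = tabloid \<nu> (pinv \<sigma> \<circ> t) then 1 else 0) else 0)"
      unfolding polytabloid_def column_stabilizer_eq[OF t] n_def[symmetric]
    proof (rule sum.cong[OF refl])
      fix \<pi> assume p: "\<pi> \<in> ?C"
      show "(if tabloid \<nu> (\<pi> \<circ> t) = tabloid \<nu> (pinv \<sigma> \<circ> t) then complex_of_int (sign \<pi>) else 0)
        = (if \<pi> = id then (if tabloid \<nu> t = tabloid \<nu> (pinv \<sigma> \<circ> t) then 1 else 0) else 0)"
      proof (cases "\<pi> = id")
        case True
        show ?thesis unfolding True by (simp only: id_comp sign_id of_int_1 if_True simp_thms)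
      next
        case False
        then have "tabloid \<nu> (\<pi> \<circ> t) \<noteq> tabloid \<nu> (pinv \<sigma> \<circ> t)" using only_id[OF p s] by blast
        then show ?thesis using False by (simp only: if_False)
      qed
    qed
    also have "\<dots> = (if tabloid \<nu> t = tabloid \<nu> (pinv \<sigma> \<circ> t) then 1 else 0)"
      unfolding sum.delta[OF finite_fibre_perms[OF finite_lessThan]] by (simp only: id_fibre_perms if_True)
    finally show ?thesis .
  qed
  have "M.avg \<nu> blk (polytabloid \<nu> t) (tabloid \<nu> t)
      = (\<Sum>\<sigma>\<in>?B. if tabloid \<nu> t = tabloid \<nu> (pinv \<sigma> \<circ> t) then 1 else 0)"
    unfolding M.avg_def sum_fun_apply induced_action_def tabloid_action_tabloid
    unfolding n_def[symmetric] by (rule sum.cong[OF refl val])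
  also have "\<dots> = of_nat (card {\<sigma>\<in>?B. tabloid \<nu> t = tabloid \<nu> (pinv \<sigma> \<circ> t)})"
    using sum.inter_filter[OF finite_fibre_perms[OF finite_lessThan[of n], of blk], of "\<lambda>_. 1 :: complex"] by simp
  also have "\<dots> \<noteq> 0"
  proof -
    have "pinv id = (id :: nat \<Rightarrow> nat)" by simp
    then have "id \<in> {\<sigma>\<in>?B. tabloid \<nu> t = tabloid \<nu> (pinv \<sigma> \<circ> t)}" using id_fibre_perms by (simp only: mem_Collect_eq id_comp simp_thms)
    then have "{\<sigma>\<in>?B. tabloid \<nu> t = tabloid \<nu> (pinv \<sigma> \<circ> t)} \<noteq> {}" by blast
    then show ?thesis using finite_fibre_perms[OF finite_lessThan[of n], of blk] by (simp add: card_eq_0_iff)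
  qed
  finally have "M.avg \<nu> blk (polytabloid \<nu> t) (tabloid \<nu> t) \<noteq> 0" .
  then have "M.avg \<nu> blk (polytabloid \<nu> t) \<noteq> 0" by (rule contrapos_nn) (simp only: zero_fun_apply)
  then show ?thesis
    using M.exists_invariant_iff[OF submodule_specht[unfolded specht_action_def] specht_def] t by blast
qed

text \<open>
  Some polytabloid has a nonzero average. If two entries in one column were in the same block, their
  transposition would change the sign of this average and also fix it. So the blocks are distinct
  in each column, and \<open>exists_ssyt_of_column_injective\<close> applies.
\<close>

lemma ssyt_of_specht_invariant:
  assumes \<nu>: "is_partition \<nu>" and v: "v \<in> specht \<nu>" "v \<noteq> 0"
    "permutation_rep.block_invariant (sum_list \<nu>) tabloid_action blk v"
  obtains T where "T \<in> ssyt \<nu>" "\<And>m. card {p \<in> cells \<nu>. T p = m} = card {a. a < sum_list \<nu> \<and> blk a = m}"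
proof -
  define n where "n = sum_list \<nu>"
  obtain t where t: "t \<in> tableaux \<nu>" "M.avg \<nu> blk (polytabloid \<nu> t) \<noteq> 0"
    using M.exists_invariant_iff[OF submodule_specht[unfolded specht_action_def] specht_def] v by blast
  have distinct: "a = b" if ab: "a < n" "b < n" "snd (pos \<nu> t a) = snd (pos \<nu> t b)" "blk a = blk b" for a b
  proof (rule ccontr)
    assume "a \<noteq> b"
    define \<tau> where "\<tau> = transpose a b"
    have tp: "\<tau> permutes {..<n}" unfolding \<tau>_def using ab by (intro permutes_swap_id) auto
    have tC: "\<tau> \<in> fibre_perms {..<n} (snd \<circ> pos \<nu> t)" and tB: "\<tau> \<in> fibre_perms {..<n} blk"
      unfolding fibre_perms_def using tp ab unfolding \<tau>_def by (auto simp: transpose_def)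
    have "M.avg \<nu> blk (polytabloid \<nu> t) = M.avg \<nu> blk (M.act \<tau> (polytabloid \<nu> t))"
      using M.avg_act[OF tB[unfolded n_def]] by simp
    also have "M.act \<tau> (polytabloid \<nu> t) = cscale (of_int (sign \<tau>)) (polytabloid \<nu> t)"
      unfolding polytabloid_eq_alt[OF t(1)] by (rule M.act_alt_same[OF tC[unfolded n_def]])
    also have "sign \<tau> = - 1" unfolding \<tau>_def using \<open>a \<noteq> b\<close> by (simp add: sign_swap_id)
    finally have "M.avg \<nu> blk (polytabloid \<nu> t) x = - M.avg \<nu> blk (polytabloid \<nu> t) x" for x
      unfolding M.avg_scale by (metis cscale_apply mult_minus1 of_int_1 of_int_minus)
    then have "M.avg \<nu> blk (polytabloid \<nu> t) x = 0" for x
      by (metis add.inverse_inverse eq_neg_iff_add_eq_0 mult_2 mult_eq_0_iff zero_neq_numeral)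
    then show False using t(2) by (simp add: fun_eq_iff)
  qed
  define F where "F p = blk (t p)" for p
  have inj: "i = i'" if c: "(i, j) \<in> cells \<nu>" "(i', j) \<in> cells \<nu>" and eq: "F (i, j) = F (i', j)" for i i' j
  proof -
    have "t (i, j) = t (i', j)"
      by (rule distinct) (use c eq t(1) tableau_less[OF t(1)] in \<open>auto simp: F_def n_def\<close>)
    then show ?thesis using pos_tableau[OF t(1)] c by (metis prod.inject)
  qed
  obtain T where T: "T \<in> ssyt \<nu>" "\<And>m. card {p \<in> cells \<nu>. T p = m} = card {p \<in> cells \<nu>. F p = m}"
    by (rule exists_ssyt_of_column_injective[of \<nu> F]) (rule \<nu>, erule (2) inj, blast)
  have "card {p \<in> cells \<nu>. F p = m} = card {a. a < n \<and> blk a = m}" for m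
  proof -
    have bij: "bij_betw t (cells \<nu>) {..<n}" unfolding n_def by (rule tableau_bij[OF t(1)])
    have e1: "t ` {p \<in> cells \<nu>. F p = m} = {a. a < n \<and> blk a = m}"
      using bij unfolding F_def bij_betw_def by auto
    have e2: "inj_on t {p \<in> cells \<nu>. F p = m}"
      using bij_betw_imp_inj_on[OF bij] by (rule inj_on_subset) blast
    show ?thesis unfolding e1[symmetric] by (rule card_image[OF e2, symmetric])
  qed
  then show ?thesis using that[OF T(1)] T(2) unfolding n_def by simp
qed


section \<open>Words and their contents\<close>

definition content :: "nat set \<Rightarrow> (nat \<Rightarrow> nat) \<Rightarrow> nat \<Rightarrow>\<^sub>0 nat" where
  "content N W = (\<Sum>a\<in>N. Poly_Mapping.single (W a) 1)"

lemma lookup_content: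
  assumes "finite N"
  shows "Poly_Mapping.lookup (content N W) m = card {a \<in> N. W a = m}"
proof -
  have "Poly_Mapping.lookup (content N W) m = (\<Sum>a\<in>N. if W a = m then 1 else 0)"
    unfolding content_def lookup_sum lookup_single when_def ..
  also have "\<dots> = card {a \<in> N. W a = m}"
    using sum.inter_filter[OF assms, of "\<lambda>_. 1 :: nat" "\<lambda>a. W a = m"] by simp
  finally show ?thesis .
qed

lemma content_cong: "(\<And>a. a \<in> N \<Longrightarrow> W a = W' a) \<Longrightarrow> content N W = content N W'"
  unfolding content_def by (rule sum.cong) simp_all

lemma content_permute:
  assumes "\<sigma> permutes N"
  shows "content N (W \<circ> \<sigma>) = content N W"
  unfolding content_def o_def
  using sum.reindex_bij_betw[OF permutes_imp_bij[OF assms], of "\<lambda>a. Poly_Mapping.single (W a) 1"] .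

definition matchings :: "nat set \<Rightarrow> (nat \<Rightarrow> nat) \<Rightarrow> (nat \<Rightarrow> nat) \<Rightarrow> (nat \<Rightarrow> nat) set" where
  "matchings N W W' = {\<sigma>. \<sigma> permutes N \<and> (\<forall>a\<in>N. W' (\<sigma> a) = W a)}"

lemma finite_matchings: "finite N \<Longrightarrow> finite (matchings N W W')"
  by (rule finite_subset[OF _ finite_permutations[of N]]) (auto simp: matchings_def)

text \<open>
  If the contents agree, then the matchings form a coset of the stabilizer of \<open>W'\<close>.
\<close>

lemma card_matchings:
  assumes N: "finite N"
  shows "card (matchings N W W') = (if content N W = content N W' then card (matchings N W' W') else 0)"
proof (cases "content N W = content N W'")
  case False
  have "matchings N W W' = {}"
  proof (rule ccontr)
    assume "matchings N W W' \<noteq> {}"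
    then obtain \<sigma> where s: "\<sigma> permutes N" "\<And>a. a \<in> N \<Longrightarrow> W' (\<sigma> a) = W a" by (auto simp: matchings_def)
    have "content N W = content N (W' \<circ> \<sigma>)" by (rule content_cong) (simp add: s(2))
    then show False using False content_permute[OF s(1)] by simp
  qed
  then show ?thesis using False by simp
next
  case True
  have "image_mset W (mset_set N) = image_mset W' (mset_set N)"
  proof (rule multiset_eqI)
    fix m
    have "count (image_mset V (mset_set N)) m = Poly_Mapping.lookup (content N V) m" for V
      unfolding lookup_content[OF N] using N by (simp add: count_image_mset' Collect_conj_eq Int_commute eq_commute[of m])
    then show "count (image_mset W (mset_set N)) m = count (image_mset W' (mset_set N)) m" using True by simp
  qed
  then obtain p where p: "p permutes N" "\<forall>x\<in>N. W x = W' (p x)"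
    using image_mset_eq_implies_permutes[OF N] by blast
  note ip = permutes_inverses[OF p(1)]
  have pN: "p a \<in> N \<longleftrightarrow> a \<in> N" "pinv p a \<in> N \<longleftrightarrow> a \<in> N" for a
    using permutes_in_image[OF p(1)] permutes_in_image[OF permutes_inv[OF p(1)]] by blast+
  have "bij_betw (\<lambda>\<rho>. \<rho> \<circ> p) (matchings N W' W') (matchings N W W')"
  proof (rule bij_betwI[where g = "\<lambda>\<sigma>. \<sigma> \<circ> pinv p"])
    show "(\<lambda>\<rho>. \<rho> \<circ> p) \<in> matchings N W' W' \<rightarrow> matchings N W W'"
      using p pN permutes_compose[OF p(1)] by (auto simp: matchings_def)
    show "(\<lambda>\<sigma>. \<sigma> \<circ> pinv p) \<in> matchings N W W' \<rightarrow> matchings N W' W'"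
    proof
      fix \<sigma> assume "\<sigma> \<in> matchings N W W'"
      then have s: "\<sigma> permutes N" "\<And>a. a \<in> N \<Longrightarrow> W' (\<sigma> a) = W a" by (auto simp: matchings_def)
      have "W' (\<sigma> (pinv p a)) = W' a" if "a \<in> N" for a
        using s(2)[of "pinv p a"] p(2) pN(2)[of a] that ip(1)[of a] by simp
      then show "\<sigma> \<circ> pinv p \<in> matchings N W' W'"
        using permutes_compose[OF permutes_inv[OF p(1)] s(1)] by (simp add: matchings_def)
    qed
  qed (simp_all add: fun_eq_iff ip)
  then show ?thesis using True bij_betw_same_card by fastforce
qed


section \<open>The polynomial of a pair of tableaux\<close>

text \<open>
  The triple of the two rows and the block of an entry, encoded as a number because monomials are
  exponent functions on the linearly ordered type of natural numbers, which makes polynomials an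
  integral domain.
\<close>

definition letter :: "(nat \<Rightarrow> nat) \<Rightarrow> (nat \<Rightarrow> nat) \<Rightarrow> (nat \<Rightarrow> nat) \<Rightarrow> nat \<Rightarrow> nat" where
  "letter r r' blk a = prod_encode (r a, prod_encode (r' a, blk a))"

lemma letter_eq_iff:
  "letter r r' blk a = letter q q' bl b \<longleftrightarrow> r a = q b \<and> r' a = q' b \<and> blk a = bl b"
  by (simp add: letter_def)

text \<open>
  The polynomial \<open>F\<close> of a pair of tableaux with row maps \<open>r\<close>, \<open>r'\<close> and column maps \<open>c\<close>, \<open>c'\<close>. Entries may come
  from any set \<open>N\<close>, so that \<open>F\<close> can be restricted to part of the entries.
\<close>

definition pair_poly ::
  "nat set \<Rightarrow> (nat \<Rightarrow> nat) \<Rightarrow> (nat \<Rightarrow> 'c) \<Rightarrow> (nat \<Rightarrow> nat) \<Rightarrow> (nat \<Rightarrow> 'd) \<Rightarrow> (nat \<Rightarrow> nat) \<Rightarrow>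
    (nat \<Rightarrow>\<^sub>0 nat) \<Rightarrow>\<^sub>0 int" where
  "pair_poly N r c r' c' blk = (\<Sum>\<pi>\<in>fibre_perms N c. \<Sum>\<tau>\<in>fibre_perms N c'.
     Poly_Mapping.single (content N (letter (r \<circ> pinv \<pi>) (r' \<circ> pinv \<tau>) blk)) (sign \<pi> * sign \<tau>))"

lemma lookup_pair_poly:
  "Poly_Mapping.lookup (pair_poly N r c r' c' blk) m = (\<Sum>\<pi>\<in>fibre_perms N c. \<Sum>\<tau>\<in>fibre_perms N c'.
     if content N (letter (r \<circ> pinv \<pi>) (r' \<circ> pinv \<tau>) blk) = m then sign \<pi> * sign \<tau> else 0)"
  unfolding pair_poly_def lookup_sum lookup_single when_def ..


section \<open>The tensor product of two Specht modules\<close>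

definition pure_tensor :: "('x \<Rightarrow> complex) \<Rightarrow> ('y \<Rightarrow> complex) \<Rightarrow> 'x \<times> 'y \<Rightarrow> complex" where
  "pure_tensor v w = (\<lambda>(x, y). v x * w y)"

lemma pure_tensor_linear:
  "pure_tensor (v + v') w = pure_tensor v w + pure_tensor v' w"
  "pure_tensor (cscale c v) w = cscale c (pure_tensor v w)"
  "pure_tensor v (w + w') = pure_tensor v w + pure_tensor v w'"
  "pure_tensor v (cscale c w) = cscale c (pure_tensor v w)"
  "pure_tensor 0 w = 0" "pure_tensor v 0 = 0"
  by (auto simp: pure_tensor_def fun_eq_iff algebra_simps)

lemma tensor_space_span:
  "tensor_space (cfun.span A) (cfun.span B) = cfun.span {pure_tensor a b | a b. a \<in> A \<and> b \<in> B}"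
proof
  let ?G = "{pure_tensor a b | a b. a \<in> A \<and> b \<in> B}"
  have left: "pure_tensor v b \<in> cfun.span ?G" if v: "v \<in> cfun.span A" and b: "b \<in> B" for v b
    using v
  proof (induction rule: cfun.span_induct_alt)
    case base
    show ?case unfolding pure_tensor_linear(5) by (rule cfun.span_zero)
  next
    case (step c x y)
    have "pure_tensor x b \<in> cfun.span ?G" using step(1) b by (intro cfun.span_base) blast
    then show ?case
      unfolding pure_tensor_linear(1,2) using step(2) by (intro cfun.span_add cfun.span_scale)
  qed
  have both: "pure_tensor v w \<in> cfun.span ?G" if v: "v \<in> cfun.span A" and w: "w \<in> cfun.span B" for v w
    using w
  proof (induction rule: cfun.span_induct_alt)
    case base
    show ?case unfolding pure_tensor_linear(6) by (rule cfun.span_zero)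
  next
    case (step c x y)
    show ?case
      unfolding pure_tensor_linear(3,4) using step(2) left[OF v step(1)] by (intro cfun.span_add cfun.span_scale)
  qed
  show "tensor_space (cfun.span A) (cfun.span B) \<subseteq> cfun.span ?G"
    unfolding tensor_space_def pure_tensor_def[symmetric]
    by (rule cfun.span_minimal) (use both in blast, rule cfun.subspace_span)
  show "cfun.span ?G \<subseteq> tensor_space (cfun.span A) (cfun.span B)"
    unfolding tensor_space_def pure_tensor_def[symmetric]
    using cfun.span_superset[of A] cfun.span_superset[of B] by (intro cfun.span_mono) blast
qed

lemma finite_partitions_of: "finite (partitions_of m)"
proof (rule finite_subset)
  show "partitions_of m \<subseteq> {xs. set xs \<subseteq> {..m} \<and> length xs \<le> m}"
  proof
    fix xs assume "xs \<in> partitions_of m"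
    then have xs: "\<forall>a\<in>set xs. 0 < a" "sum_list xs = m" by (auto simp: partitions_of_def is_partition_def)
    have "length xs \<le> sum_list xs" using xs(1) by (induction xs) auto
    then show "xs \<in> {xs. set xs \<subseteq> {..m} \<and> length xs \<le> m}" using xs member_le_sum_list by auto
  qed
qed (rule finite_lists_length_le, simp)

locale tabloid_pair =
  fixes lam \<mu> :: "nat list" and n :: nat
  assumes lam: "is_partition lam" "sum_list lam = n"
    and mu: "is_partition \<mu>" "sum_list \<mu> = n"
begin

sublocale permutation_rep n "tabloids lam \<times> tabloids \<mu>"
  "\<lambda>\<pi>. map_prod (tabloid_action \<pi>) (tabloid_action \<pi>)"
proof
  show "finite (tabloids lam \<times> tabloids \<mu>)" using M.finite_X by simp
  show "map_prod (tabloid_action id) (tabloid_action id) x = x" for x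
    using M.a_id by (cases x) simp
  show "map_prod (tabloid_action (\<pi> \<circ> \<sigma>)) (tabloid_action (\<pi> \<circ> \<sigma>)) x
      = map_prod (tabloid_action \<pi>) (tabloid_action \<pi>) (map_prod (tabloid_action \<sigma>) (tabloid_action \<sigma>) x)" for \<pi> \<sigma> x
    using M.a_comp[of \<pi> \<sigma>] by (cases x) simp
  show "map_prod (tabloid_action \<pi>) (tabloid_action \<pi>) x \<in> tabloids lam \<times> tabloids \<mu>"
    if "\<pi> permutes {..<n}" "x \<in> tabloids lam \<times> tabloids \<mu>" for \<pi> x
    using that M.a_closed[of \<pi> lam] M.a_closed[of \<pi> \<mu>] lam(2) mu(2) by (cases x) simp
qed

lemma specht_tensor_action_eq: "specht_tensor_action = act"
  unfolding specht_tensor_action_def ..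

lemma act_pure_tensor: "act \<pi> (pure_tensor v w) = pure_tensor (M.act \<pi> v) (M.act \<pi> w)"
  unfolding induced_action_def pure_tensor_def by (rule ext) (simp add: case_prod_beta)

abbreviation "V \<equiv> tensor_space (specht lam) (specht \<mu>)"

definition "generators =
  {pure_tensor a b | a b. a \<in> polytabloid lam ` tableaux lam \<and> b \<in> polytabloid \<mu> ` tableaux \<mu>}"

lemma V_span: "V = cfun.span generators"
  unfolding specht_def generators_def by (rule tensor_space_span)

lemma V_submodule: "submodule_of n act V"
  unfolding submodule_of_def V_span
proof (intro conjI allI impI ballI)
  show "cfun.subspace (cfun.span generators)" by (rule cfun.subspace_span)
  fix \<pi> v assume p: "\<pi> permutes {..<n}" and "v \<in> cfun.span generators"
  from this(2) show "act \<pi> v \<in> cfun.span generators"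
  proof (induction rule: cfun.span_induct_alt)
    case base
    show ?case unfolding induced_action_zero by (rule cfun.span_zero)
  next
    case (step c x y)
    then obtain t s where ts: "t \<in> tableaux lam" "s \<in> tableaux \<mu>"
      "x = pure_tensor (polytabloid lam t) (polytabloid \<mu> s)" unfolding generators_def by blast
    have "act \<pi> x = pure_tensor (polytabloid lam (restrict (\<pi> \<circ> t) (cells lam)))
        (polytabloid \<mu> (restrict (\<pi> \<circ> s) (cells \<mu>)))"
      unfolding ts(3) act_pure_tensor
      using act_polytabloid[OF ts(1), of \<pi>] act_polytabloid[OF ts(2), of \<pi>] p lam(2) mu(2) by simp
    moreover have "restrict (\<pi> \<circ> t) (cells lam) \<in> tableaux lam" "restrict (\<pi> \<circ> s) (cells \<mu>) \<in> tableaux \<mu>"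
      using permuted_tableau(1)[OF ts(1), of \<pi>] permuted_tableau(1)[OF ts(2), of \<pi>] p lam(2) mu(2) by simp_all
    ultimately have "act \<pi> x \<in> generators" unfolding generators_def by blast
    then show ?case
      unfolding induced_action_add induced_action_scale
      by (intro cfun.span_add[OF cfun.span_scale[OF cfun.span_base] step(2)])
  qed
qed

lemma pure_tensor_funs_on:
  "v \<in> funs_on (tabloids lam) \<Longrightarrow> w \<in> funs_on (tabloids \<mu>) \<Longrightarrow>
    pure_tensor v w \<in> funs_on (tabloids lam \<times> tabloids \<mu>)"
  unfolding funs_on_def pure_tensor_def by simp blast

lemma V_funs_on: "V \<subseteq> funs_on (tabloids lam \<times> tabloids \<mu>)"
  unfolding V_span
proof (rule cfun.span_minimal[OF _ subspace_funs_on])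
  show "generators \<subseteq> funs_on (tabloids lam \<times> tabloids \<mu>)"
    unfolding generators_def using pure_tensor_funs_on[OF polytabloid_funs_on polytabloid_funs_on] by blast
qed

abbreviation "tableau_poly t s blk \<equiv>
  pair_poly {..<n} (fst \<circ> pos lam t) (snd \<circ> pos lam t) (fst \<circ> pos \<mu> s) (snd \<circ> pos \<mu> s) blk"

text \<open>
  The value of the average at a pair of tabloids counts, with signs, the block permutations that
  carry a word of the antisymmetrised pair to the word \<open>W0\<close> of the given tabloids. The number of such
  permutations is the order of the stabilizer of \<open>W0\<close> if the contents agree and \<open>0\<close> otherwise.
\<close>

lemma avg_at_tabloids:
  fixes blk :: "nat \<Rightarrow> nat"
  assumes t: "t \<in> tableaux lam" and s: "s \<in> tableaux \<mu>"
    and t0: "t0 \<in> tableaux lam" and s0: "s0 \<in> tableaux \<mu>"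
  defines "W0 \<equiv> letter (fst \<circ> pos lam t0) (fst \<circ> pos \<mu> s0) blk"
  shows "avg blk (pure_tensor (polytabloid lam t) (polytabloid \<mu> s)) (tabloid lam t0, tabloid \<mu> s0)
    = of_nat (card (matchings {..<n} W0 W0)) *
      of_int (Poly_Mapping.lookup (tableau_poly t s blk) (content {..<n} W0))"
proof -
  let ?C = "fibre_perms {..<n} (snd \<circ> pos lam t)" and ?D = "fibre_perms {..<n} (snd \<circ> pos \<mu> s)"
    and ?B = "fibre_perms {..<n} blk"
  define W where "W \<pi> \<tau> = letter (fst \<circ> pos lam t \<circ> pinv \<pi>) (fst \<circ> pos \<mu> s \<circ> pinv \<tau>) blk" for \<pi> \<tau>
  define E where "E \<sigma> \<pi> \<tau> \<longleftrightarrow> tabloid lam (\<pi> \<circ> t) = tabloid lam (pinv \<sigma> \<circ> t0) \<and>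
      tabloid \<mu> (\<tau> \<circ> s) = tabloid \<mu> (pinv \<sigma> \<circ> s0)" for \<sigma> \<pi> \<tau>
  have act_value: "act \<sigma> (pure_tensor (polytabloid lam t) (polytabloid \<mu> s)) (tabloid lam t0, tabloid \<mu> s0)
      = (\<Sum>\<pi>\<in>?C. \<Sum>\<tau>\<in>?D. if E \<sigma> \<pi> \<tau> then of_int (sign \<pi> * sign \<tau>) else 0)" for \<sigma>
  proof -
    have "act \<sigma> (pure_tensor (polytabloid lam t) (polytabloid \<mu> s)) (tabloid lam t0, tabloid \<mu> s0)
        = polytabloid lam t (tabloid lam (pinv \<sigma> \<circ> t0)) * polytabloid \<mu> s (tabloid \<mu> (pinv \<sigma> \<circ> s0))"
      by (simp add: induced_action_def pure_tensor_def tabloid_action_tabloid)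
    also have "\<dots> = (\<Sum>\<pi>\<in>?C. \<Sum>\<tau>\<in>?D.
        (if tabloid lam (\<pi> \<circ> t) = tabloid lam (pinv \<sigma> \<circ> t0) then of_int (sign \<pi>) else 0) *
        (if tabloid \<mu> (\<tau> \<circ> s) = tabloid \<mu> (pinv \<sigma> \<circ> s0) then of_int (sign \<tau>) else 0))"
      unfolding polytabloid_def column_stabilizer_eq[OF t] column_stabilizer_eq[OF s] lam(2) mu(2)
      by (rule sum_product)
    also have "\<dots> = (\<Sum>\<pi>\<in>?C. \<Sum>\<tau>\<in>?D. if E \<sigma> \<pi> \<tau> then of_int (sign \<pi> * sign \<tau>) else 0)"
      by (intro sum.cong refl) (simp add: E_def)
    finally show ?thesis .
  qed
  have E_set: "{\<sigma> \<in> ?B. E \<sigma> \<pi> \<tau>} = matchings {..<n} (W \<pi> \<tau>) W0" if p: "\<pi> \<in> ?C" and q: "\<tau> \<in> ?D" for \<pi> \<tau>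
  proof -
    have "E \<sigma> \<pi> \<tau> \<longleftrightarrow> (\<forall>a<n. fst (pos lam t (pinv \<pi> a)) = fst (pos lam t0 (\<sigma> a)) \<and>
        fst (pos \<mu> s (pinv \<tau> a)) = fst (pos \<mu> s0 (\<sigma> a)))" if sp: "\<sigma> permutes {..<n}" for \<sigma>
    proof -
      have i: "pinv \<sigma> permutes {..<sum_list lam}" "pinv \<sigma> permutes {..<sum_list \<mu>}"
        using permutes_inv[OF sp] lam(2) mu(2) by simp_all
      have p': "\<pi> permutes {..<sum_list lam}" and q': "\<tau> permutes {..<sum_list \<mu>}"
        using fibre_permsD(1)[OF p] fibre_permsD(1)[OF q] lam(2) mu(2) by simp_all
      show ?thesis
        using permuted_tabloid_eq_iff[OF t permuted_tableau(1)[OF t0 i(1)] p', unfolded tabloid_restrict]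
          permuted_tabloid_eq_iff[OF s permuted_tableau(1)[OF s0 i(2)] q', unfolded tabloid_restrict]
          permuted_tableau(2)[OF t0 i(1)] permuted_tableau(2)[OF s0 i(2)]
        unfolding E_def permutes_inv_inv[OF sp] lam(2) mu(2) by auto
    qed
    then show ?thesis
      unfolding fibre_perms_def matchings_def W_def W0_def letter_eq_iff o_apply by auto
  qed
  have "avg blk (pure_tensor (polytabloid lam t) (polytabloid \<mu> s)) (tabloid lam t0, tabloid \<mu> s0)
      = (\<Sum>\<sigma>\<in>?B. \<Sum>\<pi>\<in>?C. \<Sum>\<tau>\<in>?D. if E \<sigma> \<pi> \<tau> then of_int (sign \<pi> * sign \<tau>) else 0)"
    unfolding avg_def sum_fun_apply by (rule sum.cong[OF refl act_value])
  also have "\<dots> = (\<Sum>\<pi>\<in>?C. \<Sum>\<sigma>\<in>?B. \<Sum>\<tau>\<in>?D. if E \<sigma> \<pi> \<tau> then of_int (sign \<pi> * sign \<tau>) else 0)"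
    by (rule sum.swap)
  also have "\<dots> = (\<Sum>\<pi>\<in>?C. \<Sum>\<tau>\<in>?D. \<Sum>\<sigma>\<in>?B. if E \<sigma> \<pi> \<tau> then of_int (sign \<pi> * sign \<tau>) else 0)"
    by (rule sum.cong[OF refl sum.swap])
  also have "\<dots> = (\<Sum>\<pi>\<in>?C. \<Sum>\<tau>\<in>?D. of_nat (card (matchings {..<n} W0 W0)) *
      of_int (if content {..<n} (W \<pi> \<tau>) = content {..<n} W0 then sign \<pi> * sign \<tau> else 0))"
  proof (rule sum.cong[OF refl], rule sum.cong[OF refl])
    fix \<pi> \<tau> assume pq: "\<pi> \<in> ?C" "\<tau> \<in> ?D"
    have "(\<Sum>\<sigma>\<in>?B. if E \<sigma> \<pi> \<tau> then complex_of_int (sign \<pi> * sign \<tau>) else 0)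
        = of_nat (card {\<sigma> \<in> ?B. E \<sigma> \<pi> \<tau>}) * of_int (sign \<pi> * sign \<tau>)"
      using sum.inter_filter[OF finite_fibre_perms[OF finite_lessThan[of n], of blk],
          of "\<lambda>_. complex_of_int (sign \<pi> * sign \<tau>)" "\<lambda>\<sigma>. E \<sigma> \<pi> \<tau>"] by simp
    then show "(\<Sum>\<sigma>\<in>?B. if E \<sigma> \<pi> \<tau> then complex_of_int (sign \<pi> * sign \<tau>) else 0)
        = of_nat (card (matchings {..<n} W0 W0)) *
          of_int (if content {..<n} (W \<pi> \<tau>) = content {..<n} W0 then sign \<pi> * sign \<tau> else 0)"
      unfolding E_set[OF pq] card_matchings[OF finite_lessThan, of n "W \<pi> \<tau>" W0] by simp
  qed
  also have "\<dots> = of_nat (card (matchings {..<n} W0 W0)) *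
      of_int (Poly_Mapping.lookup (tableau_poly t s blk) (content {..<n} W0))"
    unfolding lookup_pair_poly W_def[symmetric] of_int_sum sum_distrib_left ..
  finally show ?thesis .
qed

lemma avg_nonzero_iff:
  assumes t: "t \<in> tableaux lam" and s: "s \<in> tableaux \<mu>"
  shows "avg blk (pure_tensor (polytabloid lam t) (polytabloid \<mu> s)) \<noteq> 0 \<longleftrightarrow> tableau_poly t s blk \<noteq> 0"
proof
  let ?f = "pure_tensor (polytabloid lam t) (polytabloid \<mu> s)"
  assume "avg blk ?f \<noteq> 0"
  then obtain x where x: "avg blk ?f x \<noteq> 0" by (auto simp: fun_eq_iff)
  have "?f \<in> funs_on (tabloids lam \<times> tabloids \<mu>)"
    by (intro pure_tensor_funs_on polytabloid_funs_on t s)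
  then have "avg blk ?f \<in> funs_on (tabloids lam \<times> tabloids \<mu>)"
    unfolding avg_def by (intro cfun.subspace_sum[OF subspace_funs_on] act_funs_on) (rule fibre_permsD(1))
  then have "x \<in> tabloids lam \<times> tabloids \<mu>" using x unfolding funs_on_def by blast
  then obtain t0 s0 where "t0 \<in> tableaux lam" "s0 \<in> tableaux \<mu>" "x = (tabloid lam t0, tabloid \<mu> s0)"
    unfolding tabloids_def by blast
  then show "tableau_poly t s blk \<noteq> 0" using x avg_at_tabloids[OF t s] by auto
next
  let ?f = "pure_tensor (polytabloid lam t) (polytabloid \<mu> s)"
  assume "tableau_poly t s blk \<noteq> 0"
  then obtain m where m: "Poly_Mapping.lookup (tableau_poly t s blk) m \<noteq> 0"
    by (metis poly_mapping_eqI lookup_zero)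
  then obtain \<pi> where p: "\<pi> \<in> fibre_perms {..<n} (snd \<circ> pos lam t)"
    "(\<Sum>\<tau>\<in>fibre_perms {..<n} (snd \<circ> pos \<mu> s).
      if content {..<n} (letter (fst \<circ> pos lam t \<circ> pinv \<pi>) (fst \<circ> pos \<mu> s \<circ> pinv \<tau>) blk) = m
      then sign \<pi> * sign \<tau> else 0) \<noteq> 0"
    unfolding lookup_pair_poly using sum.not_neutral_contains_not_neutral by blast
  obtain \<tau> where q': "\<tau> \<in> fibre_perms {..<n} (snd \<circ> pos \<mu> s)"
    "(if content {..<n} (letter (fst \<circ> pos lam t \<circ> pinv \<pi>) (fst \<circ> pos \<mu> s \<circ> pinv \<tau>) blk) = m
      then sign \<pi> * sign \<tau> else 0) \<noteq> 0"
    using sum.not_neutral_contains_not_neutral[OF p(2)] by blast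
  have q: "\<tau> \<in> fibre_perms {..<n} (snd \<circ> pos \<mu> s)"
    "content {..<n} (letter (fst \<circ> pos lam t \<circ> pinv \<pi>) (fst \<circ> pos \<mu> s \<circ> pinv \<tau>) blk) = m"
    using q' by (simp_all split: if_splits)
  have pp: "\<pi> permutes {..<sum_list lam}" and qp: "\<tau> permutes {..<sum_list \<mu>}"
    using fibre_permsD(1)[OF p(1)] fibre_permsD(1)[OF q(1)] lam(2) mu(2) by simp_all
  define t0 where "t0 = restrict (\<pi> \<circ> t) (cells lam)"
  define s0 where "s0 = restrict (\<tau> \<circ> s) (cells \<mu>)"
  have t0: "t0 \<in> tableaux lam" and s0: "s0 \<in> tableaux \<mu>"
    unfolding t0_def s0_def by (rule permuted_tableau(1)[OF t pp], rule permuted_tableau(1)[OF s qp])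
  let ?W0 = "letter (fst \<circ> pos lam t0) (fst \<circ> pos \<mu> s0) blk"
  have "content {..<n} ?W0 = m"
    unfolding q(2)[symmetric]
    by (rule content_cong)
      (use permuted_tableau(2)[OF t pp] permuted_tableau(2)[OF s qp] lam(2) mu(2) in
        \<open>simp add: letter_def t0_def s0_def\<close>)
  moreover have "id \<in> matchings {..<n} ?W0 ?W0" by (simp add: matchings_def)
  then have "matchings {..<n} ?W0 ?W0 \<noteq> {}" by blast
  then have "card (matchings {..<n} ?W0 ?W0) \<noteq> 0"
    using finite_matchings[OF finite_lessThan[of n], of ?W0 ?W0] by (simp add: card_eq_0_iff)
  ultimately have "avg blk ?f (tabloid lam t0, tabloid \<mu> s0) \<noteq> 0"
    unfolding avg_at_tabloids[OF t s t0 s0] using m by simp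
  then show "avg blk ?f \<noteq> 0" by (rule contrapos_nn) (simp only: zero_fun_apply)
qed

lemma invariant_iff_poly:
  "(\<exists>v\<in>V. v \<noteq> 0 \<and> block_invariant blk v) \<longleftrightarrow>
    (\<exists>t\<in>tableaux lam. \<exists>s\<in>tableaux \<mu>. tableau_poly t s blk \<noteq> 0)"
  unfolding exists_invariant_iff[OF V_submodule V_span]
  using avg_nonzero_iff unfolding generators_def by blast

text \<open>
  If the coefficient is nonzero, then some \<open>S_\<nu>\<close> embeds into the tensor product and contains an
  invariant vector, which comes from a semistandard tableau. Conversely, an invariant vector of the tensor product has a
  nonzero projection to an irreducible summand, which is isomorphic to some \<open>S_\<nu>\<close>; the invariant
  vector of \<open>S_\<nu>\<close> obtained in this way yields a semistandard tableau.
\<close>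

theorem kronecker_product_nonzero_iff:
  "kronecker_product lam \<mu> \<alpha> \<noteq> 0 \<longleftrightarrow>
    (\<exists>t\<in>tableaux lam. \<exists>s\<in>tableaux \<mu>. \<exists>blk.
      (\<forall>m. Poly_Mapping.lookup \<alpha> m = card {a. a < n \<and> blk a = m}) \<and> tableau_poly t s blk \<noteq> 0)"
  (is "_ \<longleftrightarrow> ?R")
proof
  assume "kronecker_product lam \<mu> \<alpha> \<noteq> 0"
  then have "(\<Sum>\<nu>\<in>partitions_of n. int (kronecker_coeff lam \<mu> \<nu>) * schur \<nu> \<alpha>) \<noteq> 0"
    unfolding kronecker_product_def lam(2) .
  from sum.not_neutral_contains_not_neutral[OF this] obtain \<nu> where "\<nu> \<in> partitions_of n"
    "int (kronecker_coeff lam \<mu> \<nu>) * schur \<nu> \<alpha> \<noteq> 0" by blast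
  then have \<nu>: "\<nu> \<in> partitions_of n" "kronecker_coeff lam \<mu> \<nu> \<noteq> 0" "schur \<nu> \<alpha> \<noteq> 0" by simp_all
  have part: "is_partition \<nu>" "sum_list \<nu> = n" using \<nu>(1) by (simp_all add: partitions_of_def)
  obtain T where T: "T \<in> ssyt \<nu>" "\<And>m. Poly_Mapping.lookup \<alpha> m = card {c \<in> cells \<nu>. T c = m}"
    using \<nu>(3) unfolding schur_nonzero_iff by blast
  obtain t where t: "t \<in> tableaux \<nu>" using tableaux_nonempty by blast
  define blk where "blk a = T (pos \<nu> t a)" for a
  have counts: "Poly_Mapping.lookup \<alpha> m = card {a. a < n \<and> blk a = m}" for m
  proof -
    have bij: "bij_betw (pos \<nu> t) {..<n} (cells \<nu>)" using pos_bij[OF t] part(2) by simp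
    have e1: "{c \<in> cells \<nu>. T c = m} = pos \<nu> t ` {a. a < n \<and> blk a = m}"
      unfolding bij_betw_imp_surj_on[OF bij, symmetric] blk_def by blast
    have e2: "inj_on (pos \<nu> t) {a. a < n \<and> blk a = m}"
      using bij_betw_imp_inj_on[OF bij] by (rule inj_on_subset) auto
    show ?thesis unfolding T(2) e1 by (rule card_image[OF e2])
  qed
  obtain v where v: "v \<in> specht \<nu>" "v \<noteq> 0" "M.block_invariant \<nu> blk v"
    using specht_invariant_of_ssyt[OF t T(1)] unfolding blk_def by blast
  have irr: "irreducible_module n (induced_action tabloid_action) (specht \<nu>)"
    using irreducible_specht[OF part(1)] part(2) unfolding specht_action_def by simp
  have "0 < multiplicity_in n (induced_action tabloid_action) (specht \<nu>) act V"
    using \<nu>(2) unfolding kronecker_coeff_def specht_tensor_action_eq specht_action_def lam(2) by simp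
  then obtain W where W: "irreducible_module n act W" "W \<subseteq> V"
    "isomorphic_modules n (induced_action tabloid_action) (specht \<nu>) act W"
    unfolding multiplicity_pos_iff[OF V_submodule V_funs_on irr] by blast
  obtain \<phi> where \<phi>: "equivariant_map n (induced_action tabloid_action) (specht \<nu>) act W \<phi>" "bij_betw \<phi> (specht \<nu>) W"
    using isomorphic_modules_equivariant_map[OF W(3)] by blast
  have "\<phi> v \<in> V" using equivariant_mapD(1)[OF \<phi>(1) v(1)] W(2) by blast
  moreover have "\<phi> v \<noteq> 0"
  proof
    assume "\<phi> v = 0"
    then have "\<phi> v = \<phi> 0" using equivariant_map_zero[OF \<phi>(1) subspace_specht] by simp
    then show False
      using inj_onD[OF bij_betw_imp_inj_on[OF \<phi>(2)] _ v(1) cfun.subspace_0[OF subspace_specht]] v(2) by blast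
  qed
  moreover have "block_invariant blk (\<phi> v)"
    unfolding block_invariant_def
  proof
    fix \<sigma> assume s: "\<sigma> \<in> fibre_perms {..<n} blk"
    have "M.act \<sigma> v = v" using v(3) s part(2) unfolding M.block_invariant_def by simp
    then show "act \<sigma> (\<phi> v) = \<phi> v"
      using equivariant_mapD(4)[OF \<phi>(1) fibre_permsD(1)[OF s] v(1)] by simp
  qed
  ultimately show ?R using invariant_iff_poly counts by blast
next
  assume ?R
  then obtain blk where counts: "\<And>m. Poly_Mapping.lookup \<alpha> m = card {a. a < n \<and> blk a = m}"
    and ex: "\<exists>t\<in>tableaux lam. \<exists>s\<in>tableaux \<mu>. tableau_poly t s blk \<noteq> 0" by blast
  obtain v where v: "v \<in> V" "v \<noteq> 0" "block_invariant blk v" using ex unfolding invariant_iff_poly[symmetric] by blast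
  obtain Ws where Ws: "irreducible_decomposition n act V Ws" using maschke[OF V_submodule V_funs_on] by blast
  obtain W p where W: "W \<in> set Ws" "equivariant_map n act V act W p" "p v \<noteq> 0"
    using decomposition_projection[OF V_submodule Ws v(1,2)] by blast
  have irrW: "irreducible_module n act W" using Ws W(1) unfolding irreducible_decomposition_def by blast
  have WV: "W \<subseteq> V" by (rule decomposition_summand_subset[OF Ws W(1)])
  obtain \<nu> where \<nu>: "\<nu> \<in> partitions_of n" "isomorphic_modules n specht_action (specht \<nu>) act W"
    using irreducible_isomorphic_to_specht[OF irrW] WV V_funs_on by blast
  have part: "is_partition \<nu>" "sum_list \<nu> = n" using \<nu>(1) by (simp_all add: partitions_of_def)
  obtain \<phi> where \<phi>: "equivariant_map n specht_action (specht \<nu>) act W \<phi>" "bij_betw \<phi> (specht \<nu>) W"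
    using isomorphic_modules_equivariant_map[OF \<nu>(2)] by blast
  have "p v \<in> W" by (rule equivariant_mapD(1)[OF W(2) v(1)])
  then obtain u where u: "u \<in> specht \<nu>" "\<phi> u = p v" using bij_betw_imp_surj_on[OF \<phi>(2)] by (metis imageE)
  have "u \<noteq> 0" using equivariant_map_zero[OF \<phi>(1) subspace_specht] u(2) W(3) by auto
  have "M.block_invariant \<nu> blk u"
    unfolding M.block_invariant_def unfolding part(2)
  proof
    fix \<sigma> assume s: "\<sigma> \<in> fibre_perms {..<n} blk"
    note sp = fibre_permsD(1)[OF s]
    have "\<phi> (specht_action \<sigma> u) = act \<sigma> (p v)"
      unfolding equivariant_mapD(4)[OF \<phi>(1) sp u(1)] u(2) ..
    also have "\<dots> = p (act \<sigma> v)" by (rule equivariant_mapD(4)[OF W(2) sp v(1), symmetric])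
    also have "\<dots> = \<phi> u" using v(3) s u(2) unfolding block_invariant_def by simp
    finally have e: "\<phi> (specht_action \<sigma> u) = \<phi> u" .
    have "specht_action \<sigma> u \<in> specht \<nu>"
      using submodule_ofD(2)[OF submodule_specht[of \<nu>]] sp u(1) part(2) by simp
    then have "specht_action \<sigma> u = u"
      using e u(1) bij_betw_imp_inj_on[OF \<phi>(2)] unfolding inj_on_def by blast
    then show "M.act \<sigma> u = u" unfolding specht_action_def .
  qed
  from ssyt_of_specht_invariant[OF part(1) u(1) \<open>u \<noteq> 0\<close> this] obtain T where
    T: "T \<in> ssyt \<nu>" "\<And>m. card {c \<in> cells \<nu>. T c = m} = card {a. a < sum_list \<nu> \<and> blk a = m}" by blast
  have schur: "schur \<nu> \<alpha> \<noteq> 0"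
    unfolding schur_nonzero_iff by (intro bexI[of _ T] allI T(1)) (simp only: T(2) counts part(2))
  have irr: "irreducible_module n (induced_action tabloid_action) (specht \<nu>)"
    using irreducible_specht[OF part(1)] part(2) unfolding specht_action_def by simp
  have coeff: "0 < kronecker_coeff lam \<mu> \<nu>"
    unfolding kronecker_coeff_def specht_tensor_action_eq specht_action_def lam(2)
      multiplicity_pos_iff[OF V_submodule V_funs_on irr]
    using irrW WV \<nu>(2) unfolding specht_action_def by blast
  have nonneg: "0 \<le> schur \<kappa> \<alpha>" for \<kappa> unfolding schur_def by (rule of_nat_0_le_iff)
  have "0 < schur \<nu> \<alpha>" using nonneg[of \<nu>] schur by linarith
  then have pos: "0 < int (kronecker_coeff lam \<mu> \<nu>) * schur \<nu> \<alpha>" using coeff by (intro mult_pos_pos) simp_all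
  have "0 < (\<Sum>\<kappa>\<in>partitions_of n. int (kronecker_coeff lam \<mu> \<kappa>) * schur \<kappa> \<alpha>)"
    by (rule sum_pos2[where i = \<nu>], rule finite_partitions_of, rule \<nu>(1), rule pos)
      (intro mult_nonneg_nonneg nonneg of_nat_0_le_iff)
  then show "kronecker_product lam \<mu> \<alpha> \<noteq> 0" unfolding kronecker_product_def lam(2) by (rule less_imp_neq[symmetric])
qed

end


section \<open>Products of tableau polynomials\<close>

lemma fibre_perms_Un:
  assumes fin: "finite A" and disj: "A \<inter> B = {}"
    and sep: "c ` A \<inter> c ` B = {}"
  shows "bij_betw (\<lambda>(\<pi>, \<sigma>). \<pi> \<circ> \<sigma>) (fibre_perms A c \<times> fibre_perms B c) (fibre_perms (A \<union> B) c)"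
    and "\<pi> \<in> fibre_perms A c \<Longrightarrow> \<sigma> \<in> fibre_perms B c \<Longrightarrow> a \<in> A \<Longrightarrow> pinv (\<pi> \<circ> \<sigma>) a = pinv \<pi> a"
    and "\<pi> \<in> fibre_perms A c \<Longrightarrow> \<sigma> \<in> fibre_perms B c \<Longrightarrow> a \<in> B \<Longrightarrow> pinv (\<pi> \<circ> \<sigma>) a = pinv \<sigma> a"
proof -
  have on_A: "(\<pi> \<circ> \<sigma>) x = \<pi> x" if "\<sigma> \<in> fibre_perms B c" "x \<in> A" for \<pi> \<sigma> x
  proof -
    have "x \<notin> B" using that(2) disj by blast
    then show ?thesis using permutes_not_in[OF fibre_permsD(1)[OF that(1)]] by simp
  qed
  have on_B: "(\<pi> \<circ> \<sigma>) x = \<sigma> x" if "\<pi> \<in> fibre_perms A c" "\<sigma> \<in> fibre_perms B c" "x \<in> B" for \<pi> \<sigma> x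
  proof -
    have "\<sigma> x \<in> B" using permutes_in_image[OF fibre_permsD(1)[OF that(2)]] that(3) by blast
    then have "\<sigma> x \<notin> A" using disj by blast
    then show ?thesis using permutes_not_in[OF fibre_permsD(1)[OF that(1)]] by simp
  qed
  have comp_perm: "\<pi> \<circ> \<sigma> permutes A \<union> B" if "\<pi> \<in> fibre_perms A c" "\<sigma> \<in> fibre_perms B c" for \<pi> \<sigma>
    by (rule permutes_compose)
      (rule permutes_subset[OF fibre_permsD(1)[OF that(2)]], blast,
       rule permutes_subset[OF fibre_permsD(1)[OF that(1)]], blast)
  show "pinv (\<pi> \<circ> \<sigma>) a = pinv \<pi> a" if p: "\<pi> \<in> fibre_perms A c" "\<sigma> \<in> fibre_perms B c" "a \<in> A"
  proof -
    have i: "pinv \<pi> a \<in> A" using permutes_in_image[OF permutes_inv[OF fibre_permsD(1)[OF p(1)]]] p(3) by blast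
    have "(\<pi> \<circ> \<sigma>) (pinv \<pi> a) = a"
      unfolding on_A[OF p(2) i] by (rule permutes_inverses(1)[OF fibre_permsD(1)[OF p(1)]])
    then show ?thesis unfolding permutes_inv_eq[OF comp_perm[OF p(1,2)]] .
  qed
  show "pinv (\<pi> \<circ> \<sigma>) a = pinv \<sigma> a" if p: "\<pi> \<in> fibre_perms A c" "\<sigma> \<in> fibre_perms B c" "a \<in> B"
  proof -
    have i: "pinv \<sigma> a \<in> B" using permutes_in_image[OF permutes_inv[OF fibre_permsD(1)[OF p(2)]]] p(3) by blast
    have "(\<pi> \<circ> \<sigma>) (pinv \<sigma> a) = a"
      unfolding on_B[OF p(1,2) i] by (rule permutes_inverses(1)[OF fibre_permsD(1)[OF p(2)]])
    then show ?thesis unfolding permutes_inv_eq[OF comp_perm[OF p(1,2)]] .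
  qed
  show "bij_betw (\<lambda>(\<pi>, \<sigma>). \<pi> \<circ> \<sigma>) (fibre_perms A c \<times> fibre_perms B c) (fibre_perms (A \<union> B) c)"
    unfolding bij_betw_def
  proof
    show "inj_on (\<lambda>(\<pi>, \<sigma>). \<pi> \<circ> \<sigma>) (fibre_perms A c \<times> fibre_perms B c)"
    proof (rule inj_onI, clarify)
      fix \<pi> \<sigma> \<pi>' \<sigma>' assume h: "\<pi> \<in> fibre_perms A c" "\<sigma> \<in> fibre_perms B c"
        "\<pi>' \<in> fibre_perms A c" "\<sigma>' \<in> fibre_perms B c" "\<pi> \<circ> \<sigma> = \<pi>' \<circ> \<sigma>'"
      have "\<pi> x = \<pi>' x" for x
      proof (cases "x \<in> A")
        case True
        show ?thesis using fun_cong[OF h(5), of x] unfolding on_A[OF h(2) True] on_A[OF h(4) True] .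
      next
        case False
        then show ?thesis
          using permutes_not_in[OF fibre_permsD(1)[OF h(1)]] permutes_not_in[OF fibre_permsD(1)[OF h(3)]] by simp
      qed
      moreover have "\<sigma> x = \<sigma>' x" for x
      proof (cases "x \<in> B")
        case True
        show ?thesis using fun_cong[OF h(5), of x] unfolding on_B[OF h(1,2) True] on_B[OF h(3,4) True] .
      next
        case False
        then show ?thesis
          using permutes_not_in[OF fibre_permsD(1)[OF h(2)]] permutes_not_in[OF fibre_permsD(1)[OF h(4)]] by simp
      qed
      ultimately show "\<pi> = \<pi>' \<and> \<sigma> = \<sigma>'" by blast
    qed
    show "(\<lambda>(\<pi>, \<sigma>). \<pi> \<circ> \<sigma>) ` (fibre_perms A c \<times> fibre_perms B c) = fibre_perms (A \<union> B) c"
    proof (intro equalityI subsetI)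
      fix \<rho> assume "\<rho> \<in> (\<lambda>(\<pi>, \<sigma>). \<pi> \<circ> \<sigma>) ` (fibre_perms A c \<times> fibre_perms B c)"
      then obtain \<pi> \<sigma> where ps: "\<pi> \<in> fibre_perms A c" "\<sigma> \<in> fibre_perms B c" "\<rho> = \<pi> \<circ> \<sigma>" by auto
      have "c ((\<pi> \<circ> \<sigma>) x) = c x" if x: "x \<in> A \<union> B" for x
      proof (cases "x \<in> A")
        case True
        then show ?thesis unfolding on_A[OF ps(2) True] by (rule fibre_permsD(2)[OF ps(1)])
      next
        case False
        then have "x \<in> B" using x by blast
        then show ?thesis unfolding on_B[OF ps(1,2) \<open>x \<in> B\<close>] by (rule fibre_permsD(2)[OF ps(2)])
      qed
      then show "\<rho> \<in> fibre_perms (A \<union> B) c"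
        unfolding ps(3) fibre_perms_def using comp_perm[OF ps(1,2)] by blast
    next
      fix \<rho> assume r: "\<rho> \<in> fibre_perms (A \<union> B) c"
      note rp = fibre_permsD(1)[OF r]
      have rA: "\<rho> x \<in> A" if x: "x \<in> A" for x
      proof (rule ccontr)
        assume "\<rho> x \<notin> A"
        then have "\<rho> x \<in> B" using permutes_in_image[OF rp, of x] x by blast
        then have "c (\<rho> x) \<in> c ` B" by (rule imageI)
        moreover have "c (\<rho> x) \<in> c ` A" using fibre_permsD(2)[OF r, of x] x by simp
        ultimately show False using sep by blast
      qed
      obtain \<pi> \<sigma> where ps: "\<pi> permutes A" "\<sigma> permutes B" "\<rho> = \<pi> \<circ> \<sigma>"
        using permutes_Un_split[OF rp fin disj rA] by blast
      have "\<pi> \<in> fibre_perms A c"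
        unfolding fibre_perms_def
      proof (intro CollectI conjI ballI ps(1))
        fix x assume x: "x \<in> A"
        then have "\<sigma> x = x" using permutes_not_in[OF ps(2), of x] disj by blast
        then show "c (\<pi> x) = c x" using fibre_permsD(2)[OF r, of x] x ps(3) by simp
      qed
      moreover have "\<sigma> \<in> fibre_perms B c"
        unfolding fibre_perms_def
      proof (intro CollectI conjI ballI ps(2))
        fix x assume x: "x \<in> B"
        then have "\<sigma> x \<in> B" using permutes_in_image[OF ps(2)] by blast
        then have "\<sigma> x \<notin> A" using disj by blast
        then have "\<pi> (\<sigma> x) = \<sigma> x" by (rule permutes_not_in[OF ps(1)])
        then show "c (\<sigma> x) = c x" using fibre_permsD(2)[OF r, of x] x ps(3) by simp
      qed
      ultimately show "\<rho> \<in> (\<lambda>(\<pi>, \<sigma>). \<pi> \<circ> \<sigma>) ` (fibre_perms A c \<times> fibre_perms B c)"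
        using ps(3) by force
    qed
  qed
qed

lemma pair_poly_cong:
  assumes r: "\<And>a. a \<in> N \<Longrightarrow> r a = s a" and r': "\<And>a. a \<in> N \<Longrightarrow> r' a = s' a"
    and b: "\<And>a. a \<in> N \<Longrightarrow> blk a = bl a"
    and c: "\<And>a b. a \<in> N \<Longrightarrow> b \<in> N \<Longrightarrow> c a = c b \<longleftrightarrow> d a = d b"
    and c': "\<And>a b. a \<in> N \<Longrightarrow> b \<in> N \<Longrightarrow> c' a = c' b \<longleftrightarrow> d' a = d' b"
  shows "pair_poly N r c r' c' blk = pair_poly N s d s' d' bl"
proof -
  have e: "fibre_perms N c = fibre_perms N d" by (rule fibre_perms_cong) (rule c)
  have e': "fibre_perms N c' = fibre_perms N d'" by (rule fibre_perms_cong) (rule c')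
  show ?thesis
    unfolding pair_poly_def e e'
  proof (intro sum.cong refl arg_cong2[where f = Poly_Mapping.single] content_cong)
    fix \<pi> \<tau> a assume p: "\<pi> \<in> fibre_perms N d" and q: "\<tau> \<in> fibre_perms N d'" and a: "a \<in> N"
    have "pinv \<pi> a \<in> N" "pinv \<tau> a \<in> N"
      using permutes_in_image[OF permutes_inv[OF fibre_permsD(1)[OF p]], of a]
        permutes_in_image[OF permutes_inv[OF fibre_permsD(1)[OF q]], of a] a by simp_all
    then show "letter (r \<circ> pinv \<pi>) (r' \<circ> pinv \<tau>) blk a = letter (s \<circ> pinv \<pi>) (s' \<circ> pinv \<tau>) bl a"
      using r r' b a by (simp add: letter_def)
  qed
qed

text \<open>
  If no column meets both \<open>A\<close> and \<open>B\<close>, the column groups are direct products and the monomials of a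
  pair of words multiply.
\<close>

lemma pair_poly_Un:
  assumes fin: "finite A" "finite B" and disj: "A \<inter> B = {}"
    and sep: "c ` A \<inter> c ` B = {}" and sep': "c' ` A \<inter> c' ` B = {}"
  shows "pair_poly (A \<union> B) r c r' c' blk = pair_poly A r c r' c' blk * pair_poly B r c r' c' blk"
proof -
  note F = fibre_perms_Un[where c = c, OF fin(1) disj sep]
  note F' = fibre_perms_Un[where c = c', OF fin(1) disj sep']
  define X where "X N \<pi> \<tau> = Poly_Mapping.single (content N (letter (r \<circ> pinv \<pi>) (r' \<circ> pinv \<tau>) blk)) (sign \<pi> * sign \<tau>)"
    for N \<pi> \<tau>
  have split: "X (A \<union> B) (\<pi> \<circ> \<sigma>) (\<pi>' \<circ> \<sigma>') = X A \<pi> \<pi>' * X B \<sigma> \<sigma>'"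
    if p: "\<pi> \<in> fibre_perms A c" "\<sigma> \<in> fibre_perms B c" "\<pi>' \<in> fibre_perms A c'" "\<sigma>' \<in> fibre_perms B c'" for \<pi> \<sigma> \<pi>' \<sigma>'
  proof -
    let ?W = "letter (r \<circ> pinv (\<pi> \<circ> \<sigma>)) (r' \<circ> pinv (\<pi>' \<circ> \<sigma>')) blk"
    have "content (A \<union> B) ?W = content A ?W + content B ?W"
      unfolding content_def by (rule sum.union_disjoint[OF fin disj])
    also have "content A ?W = content A (letter (r \<circ> pinv \<pi>) (r' \<circ> pinv \<pi>') blk)"
      by (rule content_cong) (simp only: letter_def o_apply F(2)[OF p(1,2)] F'(2)[OF p(3,4)])
    also have "content B ?W = content B (letter (r \<circ> pinv \<sigma>) (r' \<circ> pinv \<sigma>') blk)"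
      by (rule content_cong) (simp only: letter_def o_apply F(3)[OF p(1,2)] F'(3)[OF p(3,4)])
    finally have 1: "content (A \<union> B) ?W = content A (letter (r \<circ> pinv \<pi>) (r' \<circ> pinv \<pi>') blk)
        + content B (letter (r \<circ> pinv \<sigma>) (r' \<circ> pinv \<sigma>') blk)" .
    have 2: "sign (\<pi> \<circ> \<sigma>) * sign (\<pi>' \<circ> \<sigma>') = (sign \<pi> * sign \<pi>') * (sign \<sigma> * sign \<sigma>')"
      using sign_compose[OF permutation_fibre_perms[OF fin(1) p(1)] permutation_fibre_perms[OF fin(2) p(2)]]
        sign_compose[OF permutation_fibre_perms[OF fin(1) p(3)] permutation_fibre_perms[OF fin(2) p(4)]]
      by (simp add: mult_ac)
    show ?thesis unfolding X_def 1 2 mult_single ..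
  qed
  have inner: "(\<Sum>\<tau>\<in>fibre_perms (A \<union> B) c'. X (A \<union> B) (\<pi> \<circ> \<sigma>) \<tau>)
      = (\<Sum>\<pi>'\<in>fibre_perms A c'. X A \<pi> \<pi>') * (\<Sum>\<sigma>'\<in>fibre_perms B c'. X B \<sigma> \<sigma>')"
    if p: "\<pi> \<in> fibre_perms A c" "\<sigma> \<in> fibre_perms B c" for \<pi> \<sigma>
  proof -
    have "(\<Sum>\<tau>\<in>fibre_perms (A \<union> B) c'. X (A \<union> B) (\<pi> \<circ> \<sigma>) \<tau>)
        = (\<Sum>(\<pi>', \<sigma>')\<in>fibre_perms A c' \<times> fibre_perms B c'. X (A \<union> B) (\<pi> \<circ> \<sigma>) (\<pi>' \<circ> \<sigma>'))"
      using sum.reindex_bij_betw[OF F'(1), of "X (A \<union> B) (\<pi> \<circ> \<sigma>)"] by (simp add: case_prod_beta')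
    also have "\<dots> = (\<Sum>\<pi>'\<in>fibre_perms A c'. \<Sum>\<sigma>'\<in>fibre_perms B c'. X A \<pi> \<pi>' * X B \<sigma> \<sigma>')"
      unfolding sum.cartesian_product[symmetric] by (intro sum.cong refl split p)
    finally show ?thesis unfolding sum_product .
  qed
  have "(\<Sum>\<rho>\<in>fibre_perms (A \<union> B) c. \<Sum>\<tau>\<in>fibre_perms (A \<union> B) c'. X (A \<union> B) \<rho> \<tau>)
      = (\<Sum>(\<pi>, \<sigma>)\<in>fibre_perms A c \<times> fibre_perms B c. \<Sum>\<tau>\<in>fibre_perms (A \<union> B) c'. X (A \<union> B) (\<pi> \<circ> \<sigma>) \<tau>)"
    using sum.reindex_bij_betw[OF F(1), of "\<lambda>\<rho>. \<Sum>\<tau>\<in>fibre_perms (A \<union> B) c'. X (A \<union> B) \<rho> \<tau>"]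
    by (simp add: case_prod_beta')
  also have "\<dots> = (\<Sum>\<pi>\<in>fibre_perms A c. \<Sum>\<sigma>\<in>fibre_perms B c.
      (\<Sum>\<pi>'\<in>fibre_perms A c'. X A \<pi> \<pi>') * (\<Sum>\<sigma>'\<in>fibre_perms B c'. X B \<sigma> \<sigma>'))"
    unfolding sum.cartesian_product[symmetric] by (intro sum.cong refl inner)
  finally show ?thesis unfolding pair_poly_def X_def sum_product .
qed

text \<open>
  Renaming the entries conjugates the column groups by \<open>h\<close>, which preserves signs.
\<close>

lemma pair_poly_image:
  assumes S: "finite S" "N \<subseteq> S" and h: "h permutes S"
  shows "pair_poly (h ` N) r c r' c' blk = pair_poly N (r \<circ> h) (c \<circ> h) (r' \<circ> h) (c' \<circ> h) (blk \<circ> h)"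
proof -
  note ih = permutes_inverses[OF h]
  have ph: "permutation h" unfolding permutation_permutes using S(1) h by blast
  have fN: "finite N" using S finite_subset by blast
  have injh: "inj_on h N" by (rule permutes_inj_on[OF h])
  let ?conj = "\<lambda>\<pi>. h \<circ> \<pi> \<circ> pinv h"
  have perm: "?conj \<pi> permutes h ` N" if p: "\<pi> permutes N" for \<pi>
  proof (rule bij_imp_permutes)
    have "bij_betw (pinv h) (h ` N) N" by (rule bij_betwI[where g = h]) (auto simp: ih)
    moreover have "bij_betw h N (h ` N)" using injh by (simp add: bij_betw_def)
    ultimately show "bij_betw (?conj \<pi>) (h ` N) (h ` N)"
      using permutes_imp_bij[OF p] bij_betw_trans by metis
    fix x assume "x \<notin> h ` N"
    then have "pinv h x \<notin> N" using ih(1)[of x] by (metis imageI)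
    then show "?conj \<pi> x = x" using permutes_not_in[OF p] ih(1) by simp
  qed
  have perm': "pinv h \<circ> \<rho> \<circ> h permutes N" if p: "\<rho> permutes h ` N" for \<rho>
  proof (rule bij_imp_permutes)
    have "bij_betw (pinv h) (h ` N) N" by (rule bij_betwI[where g = h]) (auto simp: ih)
    moreover have "bij_betw h N (h ` N)" using injh by (simp add: bij_betw_def)
    ultimately show "bij_betw (pinv h \<circ> \<rho> \<circ> h) N N"
      using permutes_imp_bij[OF p] bij_betw_trans by metis
    fix x assume "x \<notin> N"
    then have "h x \<notin> h ` N" using permutes_inj[OF h] by (simp add: inj_image_mem_iff)
    then show "(pinv h \<circ> \<rho> \<circ> h) x = x" using permutes_not_in[OF p] ih(2) by simp
  qed
  have bij: "bij_betw ?conj (fibre_perms N (d \<circ> h)) (fibre_perms (h ` N) d)" for d :: "nat \<Rightarrow> 'z"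
  proof (rule bij_betwI[where g = "\<lambda>\<rho>. pinv h \<circ> \<rho> \<circ> h"])
    show "?conj \<in> fibre_perms N (d \<circ> h) \<rightarrow> fibre_perms (h ` N) d"
      using perm ih by (auto simp: fibre_perms_def)
    show "(\<lambda>\<rho>. pinv h \<circ> \<rho> \<circ> h) \<in> fibre_perms (h ` N) d \<rightarrow> fibre_perms N (d \<circ> h)"
      using perm' ih by (auto simp: fibre_perms_def)
  qed (simp_all add: fun_eq_iff ih)
  have sg: "sign (?conj \<pi>) = sign \<pi>" if "\<pi> permutes N" for \<pi>
  proof -
    have pp: "permutation \<pi>" unfolding permutation_permutes using fN that by blast
    show ?thesis
      using sign_compose[OF permutation_compose[OF ph pp] permutation_inverse[OF ph]] sign_compose[OF ph pp]
        sign_inverse[OF ph] by (simp add: mult_ac)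
  qed
  have inv_conj: "pinv (?conj \<pi>) (h a) = h (pinv \<pi> a)" if p: "\<pi> permutes N" for \<pi> a
    unfolding permutes_inv_eq[OF perm[OF p]] by (simp add: ih permutes_inverses(1)[OF p])
  have summand: "Poly_Mapping.single (content (h ` N) (letter (r \<circ> pinv (?conj \<pi>)) (r' \<circ> pinv (?conj \<tau>)) blk))
        (sign (?conj \<pi>) * sign (?conj \<tau>))
      = Poly_Mapping.single (content N (letter (r \<circ> h \<circ> pinv \<pi>) (r' \<circ> h \<circ> pinv \<tau>) (blk \<circ> h))) (sign \<pi> * sign \<tau>)"
    if p: "\<pi> permutes N" "\<tau> permutes N" for \<pi> \<tau>
  proof -
    let ?W = "letter (r \<circ> pinv (?conj \<pi>)) (r' \<circ> pinv (?conj \<tau>)) blk"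
    have "content (h ` N) ?W = content N (?W \<circ> h)"
      unfolding content_def sum.reindex[OF injh] by (simp only: o_def)
    also have "\<dots> = content N (letter (r \<circ> h \<circ> pinv \<pi>) (r' \<circ> h \<circ> pinv \<tau>) (blk \<circ> h))"
      by (rule content_cong) (simp only: letter_def o_apply[of ?W] o_apply[of r] o_apply[of r'] o_apply[of blk]
          inv_conj[OF p(1)] inv_conj[OF p(2)] o_apply[of "r \<circ> h"] o_apply[of "r' \<circ> h"])
    finally show ?thesis unfolding sg[OF p(1)] sg[OF p(2)] by (rule arg_cong2[where f = Poly_Mapping.single]) simp
  qed
  show ?thesis
    unfolding pair_poly_def
    unfolding sum.reindex_bij_betw[OF bij, symmetric]
    by (intro sum.cong refl summand) (rule fibre_permsD(1), assumption)+
qed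


section \<open>Interleaving the columns of scaled tableaux\<close>

text \<open>
  Each column of \<open>lam\<close> occurs \<open>p\<close> times in \<open>p lam\<close> and \<open>m\<close> times in \<open>m lam\<close>. Copy number \<open>r\<close> of a column
  of \<open>lam\<close> in the first diagram becomes its copy number \<open>d + r\<close> in the second one; rows do not change.
\<close>

definition interleave :: "nat \<Rightarrow> nat \<Rightarrow> nat \<Rightarrow> nat \<times> nat \<Rightarrow> nat \<times> nat" where
  "interleave p m d x = (fst x, snd x div p * m + d + snd x mod p)"

lemma interleave_column:
  assumes "0 < p" "d + p \<le> m"
  shows "snd (interleave p m d x) div m = snd x div p" "snd (interleave p m d x) mod m = d + snd x mod p"
proof -
  have "d + snd x mod p < m" using assms mod_less_divisor[of p "snd x"] by linarith
  moreover have "snd (interleave p m d x) = (d + snd x mod p) + snd x div p * m" by (simp add: interleave_def)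
  ultimately show "snd (interleave p m d x) div m = snd x div p" "snd (interleave p m d x) mod m = d + snd x mod p"
    by simp_all
qed

lemma interleave_column_eq_iff:
  assumes "0 < p" "d + p \<le> m"
  shows "snd (interleave p m d x) = snd (interleave p m d y) \<longleftrightarrow> snd x = snd y"
proof
  assume "snd (interleave p m d x) = snd (interleave p m d y)"
  then have "snd x div p = snd y div p" "snd x mod p = snd y mod p"
    using interleave_column[OF assms, of x] interleave_column[OF assms, of y] by auto
  then show "snd x = snd y" by (metis div_mult_mod_eq)
qed (simp add: interleave_def)

lemma interleave_column_separate:
  assumes "0 < p" "0 < p'"
  shows "snd (interleave p (p + p') 0 x) \<noteq> snd (interleave p' (p + p') p y)"
proof
  assume "snd (interleave p (p + p') 0 x) = snd (interleave p' (p + p') p y)"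
  then have "snd x mod p = p + snd y mod p'"
    using interleave_column(2)[of p 0 "p + p'" x] interleave_column(2)[of p' p "p + p'" y] assms by simp
  then show False using mod_less_divisor[OF assms(1), of "snd x"] by linarith
qed

lemma interleave_cells:
  assumes "0 < p" "d + p \<le> m" and x: "x \<in> cells (scale_partition p lam)"
  shows "interleave p m d x \<in> cells (scale_partition m lam)"
proof -
  obtain i j where ij: "x = (i, j)" by (cases x)
  then have i: "i < length lam" "j < p * lam ! i" using x by (auto simp: mem_cells scale_partition_def)
  have "j div p < lam ! i" using i(2) by (simp add: less_mult_imp_div_less mult.commute)
  then have "Suc (j div p) * m \<le> lam ! i * m" by (intro mult_le_mono1) simp
  moreover have "d + j mod p < m" using assms(1,2) mod_less_divisor[of p j] by linarith
  ultimately have "j div p * m + d + j mod p < m * lam ! i" by (simp add: mult.commute)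
  then show ?thesis using i(1) by (simp add: ij interleave_def mem_cells scale_partition_def)
qed

lemma sum_list_scale_partition: "sum_list (scale_partition p lam) = p * sum_list lam"
  unfolding scale_partition_def by (induction lam) (simp_all add: algebra_simps)

lemma is_partition_scale:
  assumes "is_partition lam" "0 < p"
  shows "is_partition (scale_partition p lam)"
  using assms unfolding is_partition_def scale_partition_def
  by (auto simp: sorted_wrt_map intro: sorted_wrt_mono_rel[of _ "(\<ge>)"])

definition join_at :: "nat \<Rightarrow> (nat \<Rightarrow> 'a) \<Rightarrow> (nat \<Rightarrow> 'a) \<Rightarrow> nat \<Rightarrow> 'a" where
  "join_at n f g a = (if a < n then f a else g (a - n))"

lemma join_at_simps [simp]:
  "a < n \<Longrightarrow> join_at n f g a = f a" "join_at n f g (a + n) = g a" "n \<le> a \<Longrightarrow> join_at n f g a = g (a - n)"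
  by (auto simp: join_at_def)

lemma joined_tableau:
  fixes lam :: "nat list"
  assumes p: "0 < p" "0 < p'"
    and t: "t \<in> tableaux (scale_partition p lam)" and t': "t' \<in> tableaux (scale_partition p' lam)"
  defines "n \<equiv> p * sum_list lam" and "n' \<equiv> p' * sum_list lam"
  defines "q \<equiv> join_at n (\<lambda>a. interleave p (p + p') 0 (pos (scale_partition p lam) t a))
      (\<lambda>a. interleave p' (p + p') p (pos (scale_partition p' lam) t' a))"
  obtains u where "u \<in> tableaux (scale_partition (p + p') lam)"
    "\<And>a. a < n + n' \<Longrightarrow> pos (scale_partition (p + p') lam) u a = q a"
proof -
  let ?L = "scale_partition p lam" and ?L' = "scale_partition p' lam" and ?M = "scale_partition (p + p') lam"
  have sums: "sum_list ?L = n" "sum_list ?L' = n'" "sum_list ?M = n + n'"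
    by (simp_all add: sum_list_scale_partition n_def n'_def algebra_simps)
  have bt: "bij_betw (pos ?L t) {..<n} (cells ?L)" "bij_betw (pos ?L' t') {..<n'} (cells ?L')"
    using pos_bij[OF t] pos_bij[OF t'] sums by simp_all
  have q1: "q a = interleave p (p + p') 0 (pos ?L t a)" if "a < n" for a using that by (simp add: q_def)
  have q2: "q a = interleave p' (p + p') p (pos ?L' t' (a - n))" if "n \<le> a" for a using that by (simp add: q_def)
  have ileq: "x = y" if "interleave p m d x = interleave p m d y" "0 < p" "d + p \<le> m" for p m d x y
  proof -
    have "snd x = snd y" using interleave_column_eq_iff[OF that(2,3), of x y] that(1) by simp
    moreover have "fst x = fst y" using that(1) by (simp add: interleave_def)
    ultimately show ?thesis by (simp add: prod_eq_iff)
  qed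
  have inj: "inj_on q {..<n + n'}"
  proof (rule inj_onI)
    fix a b assume ab: "a \<in> {..<n + n'}" "b \<in> {..<n + n'}" "q a = q b"
    consider "a < n" "b < n" | "n \<le> a" "n \<le> b" | "a < n" "n \<le> b" | "n \<le> a" "b < n" by linarith
    then show "a = b"
    proof cases
      case 1
      have "pos ?L t a = pos ?L t b"
        by (rule ileq[OF ab(3)[unfolded q1[OF 1(1)] q1[OF 1(2)]]]) (use p in simp_all)
      then show ?thesis using bij_betw_imp_inj_on[OF bt(1)] 1 unfolding inj_on_def by blast
    next
      case 2
      have "pos ?L' t' (a - n) = pos ?L' t' (b - n)"
        by (rule ileq[OF ab(3)[unfolded q2[OF 2(1)] q2[OF 2(2)]]]) (use p in simp_all)
      moreover have "a - n < n'" "b - n < n'" using ab(1,2) 2 by auto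
      ultimately have "a - n = b - n" using bij_betw_imp_inj_on[OF bt(2)] unfolding inj_on_def by blast
      then show ?thesis using 2 by simp
    next
      case 3
      then show ?thesis using ab(3) interleave_column_separate[OF p] by (metis q1 q2)
    next
      case 4
      then show ?thesis using ab(3) interleave_column_separate[OF p] by (metis q1 q2)
    qed
  qed
  have "q ` {..<n + n'} \<subseteq> cells ?M"
  proof
    fix x assume "x \<in> q ` {..<n + n'}"
    then obtain a where a: "a < n + n'" "x = q a" by auto
    show "x \<in> cells ?M"
    proof (cases "a < n")
      case True
      have "pos ?L t a \<in> cells ?L" using bij_betwE[OF bt(1)] True by blast
      then show ?thesis unfolding a(2) q1[OF True] using p by (intro interleave_cells) simp_all
    next
      case False
      then have "pos ?L' t' (a - n) \<in> cells ?L'" using bij_betwE[OF bt(2)] a(1) by auto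
      then show ?thesis using False p unfolding a(2) by (simp add: q2 interleave_cells)
    qed
  qed
  moreover have "card (q ` {..<n + n'}) = card (cells ?M)"
    unfolding card_image[OF inj] card_cells sums by simp
  ultimately have "q ` {..<n + n'} = cells ?M" by (intro card_subset_eq finite_cells)
  then have "bij_betw q {..<sum_list ?M} (cells ?M)" using inj unfolding sums bij_betw_def by simp
  then show ?thesis using tableau_of_positions[of q ?M] that unfolding sums by blast
qed

text \<open>
  The entries of the second pair of tableaux are shifted by \<open>n\<close> and their columns placed beside those
  of the first pair. The polynomial of the joined pair is the product of the two given ones, so it
  is nonzero, and the block sizes add up.
\<close>

theorem kronecker_product_semigroup:
  assumes lam: "is_partition lam" and mu: "is_partition \<mu>" and size: "sum_list lam = sum_list \<mu>"
    and p: "0 < p" "0 < p'"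
    and a: "kronecker_product (scale_partition p lam) (scale_partition p \<mu>) \<alpha> \<noteq> 0"
    and b: "kronecker_product (scale_partition p' lam) (scale_partition p' \<mu>) \<beta> \<noteq> 0"
  shows "kronecker_product (scale_partition (p + p') lam) (scale_partition (p + p') \<mu>) (\<alpha> + \<beta>) \<noteq> 0"
proof -
  define n where "n = p * sum_list lam"
  define n' where "n' = p' * sum_list lam"
  have pair: "tabloid_pair (scale_partition m lam) (scale_partition m \<mu>) (m * sum_list lam)" if "0 < m" for m
    using that lam mu size by unfold_locales (simp_all add: is_partition_scale sum_list_scale_partition)
  let ?L = "scale_partition p lam" and ?L' = "scale_partition p' lam" and ?LL = "scale_partition (p + p') lam"
  let ?M = "scale_partition p \<mu>" and ?M' = "scale_partition p' \<mu>" and ?MM = "scale_partition (p + p') \<mu>"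
  have nn: "(p + p') * sum_list lam = n + n'" by (simp add: n_def n'_def algebra_simps)
  obtain t s blk where ts: "t \<in> tableaux ?L" "s \<in> tableaux ?M"
    "\<And>m. Poly_Mapping.lookup \<alpha> m = card {a. a < n \<and> blk a = m}"
    "pair_poly {..<n} (fst \<circ> pos ?L t) (snd \<circ> pos ?L t) (fst \<circ> pos ?M s) (snd \<circ> pos ?M s) blk \<noteq> 0"
    using a unfolding tabloid_pair.kronecker_product_nonzero_iff[OF pair[OF p(1)]] n_def[symmetric] by blast
  obtain t' s' blk' where ts': "t' \<in> tableaux ?L'" "s' \<in> tableaux ?M'"
    "\<And>m. Poly_Mapping.lookup \<beta> m = card {a. a < n' \<and> blk' a = m}"
    "pair_poly {..<n'} (fst \<circ> pos ?L' t') (snd \<circ> pos ?L' t') (fst \<circ> pos ?M' s') (snd \<circ> pos ?M' s') blk' \<noteq> 0"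
    using b unfolding tabloid_pair.kronecker_product_nonzero_iff[OF pair[OF p(2)]] n'_def[symmetric] by blast
  let ?q = "\<lambda>P P' t t'. join_at n (\<lambda>a. interleave p (p + p') 0 (pos P t a)) (\<lambda>a. interleave p' (p + p') p (pos P' t' a))"
  obtain u where u: "u \<in> tableaux ?LL" "\<And>a. a < n + n' \<Longrightarrow> pos ?LL u a = ?q ?L ?L' t t' a"
    using joined_tableau[OF p ts(1) ts'(1)] unfolding n_def[symmetric] n'_def[symmetric] by metis
  obtain v where v: "v \<in> tableaux ?MM" "\<And>a. a < n + n' \<Longrightarrow> pos ?MM v a = ?q ?M ?M' s s' a"
    using joined_tableau[OF p ts(2) ts'(2)] unfolding size[symmetric] n_def[symmetric] n'_def[symmetric] by metis
  define bb where "bb = join_at n blk blk'"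
  \<comment> \<open>A rotation of \<open>{..<n + n'}\<close> that moves the entries of the second pair behind those of the first.\<close>
  define h where "h x = (if x < n' then x + n else if x < n + n' then x - n' else x)" for x
  have hp: "h permutes {..<n + n'}"
  proof (rule bij_imp_permutes)
    show "bij_betw h {..<n + n'} {..<n + n'}"
      by (rule bij_betwI[where g = "\<lambda>x. if x < n then x + n' else x - n"]) (auto simp: h_def)
  qed (auto simp: h_def)
  have img: "h ` {..<n'} = {n..<n + n'}"
  proof (intro equalityI subsetI)
    fix x assume "x \<in> {n..<n + n'}"
    then show "x \<in> h ` {..<n'}" by (intro image_eqI[of _ _ "x - n"]) (auto simp: h_def)
  qed (auto simp: h_def)
  have Un: "{..<n + n'} = {..<n} \<union> h ` {..<n'}" unfolding img by auto
  let ?P = "\<lambda>N. pair_poly N (fst \<circ> pos ?LL u) (snd \<circ> pos ?LL u) (fst \<circ> pos ?MM v) (snd \<circ> pos ?MM v) bb"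
  have sepL: "(snd \<circ> pos ?LL u) x \<noteq> (snd \<circ> pos ?LL u) y" and sepM: "(snd \<circ> pos ?MM v) x \<noteq> (snd \<circ> pos ?MM v) y"
    if "x \<in> {..<n}" "y \<in> h ` {..<n'}" for x y
    using that interleave_column_separate[OF p] unfolding img by (simp_all add: u(2) v(2))
  have "?P {..<n + n'} = ?P {..<n} * ?P (h ` {..<n'})"
    unfolding Un
  proof (rule pair_poly_Un)
    show "{..<n} \<inter> h ` {..<n'} = {}" unfolding img by auto
    show "(snd \<circ> pos ?LL u) ` {..<n} \<inter> (snd \<circ> pos ?LL u) ` h ` {..<n'} = {}" using sepL by blast
    show "(snd \<circ> pos ?MM v) ` {..<n} \<inter> (snd \<circ> pos ?MM v) ` h ` {..<n'} = {}" using sepM by blast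
  qed simp_all
  also have "?P {..<n} = pair_poly {..<n} (fst \<circ> pos ?L t) (snd \<circ> pos ?L t) (fst \<circ> pos ?M s) (snd \<circ> pos ?M s) blk"
    by (rule pair_poly_cong)
      (use p in \<open>auto simp: u(2) v(2) bb_def interleave_column_eq_iff\<close>, auto simp: interleave_def)
  also have "?P (h ` {..<n'}) = pair_poly {..<n'} (fst \<circ> pos ?LL u \<circ> h) (snd \<circ> pos ?LL u \<circ> h)
      (fst \<circ> pos ?MM v \<circ> h) (snd \<circ> pos ?MM v \<circ> h) (bb \<circ> h)"
    by (rule pair_poly_image[OF _ _ hp]) auto
  also have "\<dots> = pair_poly {..<n'} (fst \<circ> pos ?L' t') (snd \<circ> pos ?L' t') (fst \<circ> pos ?M' s') (snd \<circ> pos ?M' s') blk'"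
    by (rule pair_poly_cong)
      (use p in \<open>auto simp: u(2) v(2) bb_def h_def interleave_column_eq_iff\<close>, auto simp: interleave_def)
  also have "pair_poly {..<n} (fst \<circ> pos ?L t) (snd \<circ> pos ?L t) (fst \<circ> pos ?M s) (snd \<circ> pos ?M s) blk * \<dots> \<noteq> 0"
    by (rule no_zero_divisors[OF ts(4) ts'(4)])
  finally have "?P {..<n + n'} \<noteq> 0" .
  moreover have "Poly_Mapping.lookup (\<alpha> + \<beta>) m = card {a. a < n + n' \<and> bb a = m}" for m
  proof -
    have "{a. a < n + n' \<and> bb a = m} = {a. a < n \<and> blk a = m} \<union> (\<lambda>a. a + n) ` {a. a < n' \<and> blk' a = m}"
    proof (intro equalityI subsetI)
      fix a assume a: "a \<in> {a. a < n + n' \<and> bb a = m}"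
      show "a \<in> {a. a < n \<and> blk a = m} \<union> (\<lambda>a. a + n) ` {a. a < n' \<and> blk' a = m}"
      proof (cases "a < n")
        case False
        then have "a \<in> (\<lambda>a. a + n) ` {a. a < n' \<and> blk' a = m}"
          using a by (intro image_eqI[of _ _ "a - n"]) (auto simp: bb_def)
        then show ?thesis by blast
      qed (use a in \<open>simp add: bb_def\<close>)
    qed (auto simp: bb_def)
    moreover have "card ((\<lambda>a. a + n) ` {a. a < n' \<and> blk' a = m}) = card {a. a < n' \<and> blk' a = m}"
      by (intro card_image) simp
    moreover have "{a. a < n \<and> blk a = m} \<inter> (\<lambda>a. a + n) ` {a. a < n' \<and> blk' a = m} = {}" by auto
    ultimately show ?thesis
      unfolding lookup_add ts(3) ts'(3) by (simp add: card_Un_disjoint)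
  qed
  moreover have "0 < p + p'" using p by simp
  ultimately show ?thesis
    unfolding tabloid_pair.kronecker_product_nonzero_iff[OF pair[OF \<open>0 < p + p'\<close>]] nn
    using u(1) v(1) by blast
qed


section \<open>Rational points of convex combinations\<close>

global_interpretation rat_real: vector_space "\<lambda>(q :: rat) (x :: real). of_rat q * x"
  by unfold_locales (simp_all add: algebra_simps of_rat_add of_rat_mult)

global_interpretation rat_rat: vector_space "\<lambda>(q :: rat) (x :: rat). q * x"
  by unfold_locales (simp_all add: algebra_simps)

global_interpretation rat_real_rat: vector_space_pair "\<lambda>(q :: rat) (x :: real). of_rat q * x"
  "\<lambda>(q :: rat) (x :: rat). q * x" ..

text \<open>
  Extend \<open>1\<close> to a basis of the reals over the rationals and map every basis element to a rational
  number close to it, fixing \<open>1\<close>. On finitely many numbers the total error is controlled by their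
  finitely many coordinates.
\<close>

lemma rational_functional_near_identity:
  fixes C :: "real set"
  assumes C: "finite C" and e: "0 < \<epsilon>"
  obtains \<phi> :: "real \<Rightarrow> rat" where
    "\<And>x y. \<phi> (x + y) = \<phi> x + \<phi> y" "\<And>q x. \<phi> (of_rat q * x) = q * \<phi> x" "\<phi> 1 = 1"
    "\<And>c. c \<in> C \<Longrightarrow> \<bar>of_rat (\<phi> c) - c\<bar> < \<epsilon>"
proof -
  have ind1: "rat_real.independent {1}" by (simp add: rat_real.independent_insert)
  define B where "B = rat_real.extend_basis {1}"
  have B: "{1} \<subseteq> B" "rat_real.independent B" "rat_real.span B = UNIV"
    unfolding B_def
    using rat_real.extend_basis_superset[OF ind1] rat_real.independent_extend_basis[OF ind1]
      rat_real.span_extend_basis[OF ind1] by auto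
  define supp where "supp c = {b. rat_real.representation B c b \<noteq> 0}" for c
  define M where "M = (\<Sum>c\<in>C. \<Sum>b\<in>supp c. \<bar>of_rat (rat_real.representation B c b) :: real\<bar>)"
  have M0: "0 \<le> M" unfolding M_def by (intro sum_nonneg) simp
  \<comment> \<open>The denominator is \<open>M + 1\<close> because \<open>M\<close> may be \<open>0\<close>.\<close>
  define \<delta> where "\<delta> = \<epsilon> / (M + 1)"
  have d: "0 < \<delta>" "\<delta> * M < \<epsilon>" unfolding \<delta>_def using e M0 by (simp_all add: field_simps)
  have "\<exists>q. \<bar>of_rat q - b\<bar> < \<delta> \<and> (b = 1 \<longrightarrow> q = 1)" for b :: real
  proof (cases "b = 1")
    case False
    obtain q where "b < of_rat q" "of_rat q < b + \<delta>" using of_rat_dense[of b "b + \<delta>"] d(1) by auto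
    then show ?thesis using False by (intro exI[of _ q]) auto
  qed (use d(1) in \<open>auto intro!: exI[of _ 1]\<close>)
  then obtain g where g: "\<And>b. \<bar>of_rat (g b) - b\<bar> < \<delta>" "g (1 :: real) = 1" by metis
  define \<phi> where "\<phi> = rat_real_rat.construct B g"
  have lin: "Vector_Spaces.linear (\<lambda>q x. of_rat q * x) (\<lambda>q x. q * x) \<phi>"
    unfolding \<phi>_def by (rule rat_real_rat.linear_construct[OF B(2)])
  have basis: "\<phi> b = g b" if "b \<in> B" for b
    unfolding \<phi>_def by (rule rat_real_rat.construct_basis[OF B(2) that])
  have add: "\<phi> (x + y) = \<phi> x + \<phi> y" for x y by (rule rat_real_rat.linear_add[OF lin])
  have scale: "\<phi> (of_rat q * x) = q * \<phi> x" for q x by (rule rat_real_rat.linear_scale[OF lin])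
  have "\<phi> 1 = 1" using basis[of 1] B(1) g(2) by simp
  moreover have "\<bar>of_rat (\<phi> c) - c\<bar> < \<epsilon>" if c: "c \<in> C" for c
  proof -
    let ?r = "rat_real.representation B c"
    have fin: "finite (supp c)" unfolding supp_def by (rule rat_real.finite_representation)
    have expand: "c = (\<Sum>b\<in>supp c. of_rat (?r b) * b)"
      unfolding supp_def using rat_real.sum_nonzero_representation_eq[OF B(2), of c] B(3) by simp
    have suppB: "b \<in> B" if "b \<in> supp c" for b using that rat_real.representation_ne_zero unfolding supp_def by blast
    have "\<phi> c = (\<Sum>b\<in>supp c. \<phi> (of_rat (?r b) * b))"
      using rat_real_rat.linear_sum[OF lin, of "\<lambda>b. of_rat (?r b) * b" "supp c"] expand by metis
    also have "\<dots> = (\<Sum>b\<in>supp c. ?r b * g b)" by (rule sum.cong) (simp_all add: scale basis suppB)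
    finally have "of_rat (\<phi> c) = (\<Sum>b\<in>supp c. of_rat (?r b) * of_rat (g b))" by (simp add: of_rat_sum of_rat_mult)
    then have "of_rat (\<phi> c) - c = (\<Sum>b\<in>supp c. of_rat (?r b) * (of_rat (g b) - b))"
      using expand by (simp add: right_diff_distrib sum_subtractf)
    then have "\<bar>of_rat (\<phi> c) - c\<bar> \<le> (\<Sum>b\<in>supp c. \<bar>of_rat (?r b) * (of_rat (g b) - b)\<bar>)"
      using sum_abs by metis
    also have "\<dots> \<le> (\<Sum>b\<in>supp c. \<bar>of_rat (?r b)\<bar> * \<delta>)"
      unfolding abs_mult using g(1) by (intro sum_mono mult_left_mono) (auto intro: less_imp_le)
    also have "\<dots> = \<delta> * (\<Sum>b\<in>supp c. \<bar>of_rat (?r b)\<bar>)" by (simp add: sum_distrib_left mult.commute)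
    also have "\<dots> \<le> \<delta> * M"
      unfolding M_def using C c d(1) by (intro mult_left_mono member_le_sum[of c C] sum_nonneg) auto
    also have "\<dots> < \<epsilon>" by (rule d(2))
    finally show ?thesis .
  qed
  ultimately show ?thesis using that add scale by blast
qed

text \<open>
  A linear functional over the rationals that fixes \<open>1\<close> preserves the given equations. If it moves
  the coefficients by less than the smallest positive one, their signs are preserved too.
\<close>

lemma rational_convex_coefficients:
  fixes c :: "'a \<Rightarrow> real" and z :: "'a \<Rightarrow> 'i \<Rightarrow> rat"
  assumes F: "finite F" and nonneg: "\<And>x. x \<in> F \<Longrightarrow> 0 \<le> c x" and sum1: "(\<Sum>x\<in>F. c x) = 1"
    and eq: "\<And>i. i \<in> I \<Longrightarrow> of_rat (q i) = (\<Sum>x\<in>F. c x * of_rat (z x i))"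
  shows "\<exists>d :: 'a \<Rightarrow> rat. (\<forall>x\<in>F. 0 \<le> d x) \<and> (\<Sum>x\<in>F. d x) = 1 \<and>
    (\<forall>i\<in>I. q i = (\<Sum>x\<in>F. d x * z x i))"
proof -
  define \<epsilon> where "\<epsilon> = Min (insert 1 (c ` {x\<in>F. 0 < c x}))"
  have e: "0 < \<epsilon>" "\<And>x. x \<in> F \<Longrightarrow> 0 < c x \<Longrightarrow> \<epsilon> \<le> c x"
    unfolding \<epsilon>_def using F by (auto simp: Min_gr_iff)
  obtain \<phi> :: "real \<Rightarrow> rat" where \<phi>: "\<And>x y. \<phi> (x + y) = \<phi> x + \<phi> y" "\<And>q x. \<phi> (of_rat q * x) = q * \<phi> x" "\<phi> 1 = 1"
    "\<And>y. y \<in> c ` F \<Longrightarrow> \<bar>of_rat (\<phi> y) - y\<bar> < \<epsilon>"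
    using rational_functional_near_identity[OF finite_imageI[OF F] e(1)] by blast
  have zero: "\<phi> 0 = 0" using \<phi>(2)[of 0 0] by simp
  have sum: "\<phi> (\<Sum>x\<in>A. f x) = (\<Sum>x\<in>A. \<phi> (f x))" for A :: "'a set" and f
    by (induction A rule: infinite_finite_induct) (simp_all add: zero \<phi>(1))
  have rat: "\<phi> (of_rat r) = r" for r using \<phi>(2)[of r 1] \<phi>(3) by simp
  show ?thesis
  proof (intro exI[of _ "\<lambda>x. \<phi> (c x)"] conjI ballI)
    show "0 \<le> \<phi> (c x)" if x: "x \<in> F" for x
    proof (cases "c x = 0")
      case False
      then have "\<epsilon> \<le> c x" using nonneg[OF x] e(2)[OF x] by simp
      moreover have "\<bar>of_rat (\<phi> (c x)) - c x\<bar> < \<epsilon>" using \<phi>(4) x by blast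
      ultimately have "0 < (of_rat (\<phi> (c x)) :: real)" by linarith
      then show ?thesis by simp
    qed (simp add: zero)
    show "(\<Sum>x\<in>F. \<phi> (c x)) = 1" unfolding sum[symmetric] sum1 by (rule \<phi>(3))
    show "q i = (\<Sum>x\<in>F. \<phi> (c x) * z x i)" if i: "i \<in> I" for i
    proof -
      have "q i = \<phi> (\<Sum>x\<in>F. c x * of_rat (z x i))" unfolding eq[OF i, symmetric] rat ..
      also have "\<dots> = (\<Sum>x\<in>F. \<phi> (c x) * z x i)"
        unfolding sum by (rule sum.cong[OF refl]) (metis \<phi>(2) mult.commute)
      finally show ?thesis .
    qed
  qed
qed


section \<open>Convexity of the normalised points of a graded semigroup\<close>

text \<open>
  Some positive integral multiple of \<open>(r, x)\<close> is a point \<open>(p, \<alpha>)\<close> with \<open>\<alpha> \<in> S p\<close>. These pairs form a cone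
  over the rationals, and the points with \<open>r = 1\<close> are the normalised points \<open>\<alpha> / p\<close>.
\<close>

definition on_ray :: "nat \<Rightarrow> (nat \<Rightarrow> nat vec set) \<Rightarrow> rat \<Rightarrow> (nat \<Rightarrow> rat) \<Rightarrow> bool" where
  "on_ray k S r x \<longleftrightarrow> (\<exists>N\<ge>1. \<exists>p\<ge>1. \<exists>\<alpha>\<in>S p. of_nat N * r = of_nat p \<and> (\<forall>i<k. of_nat N * x i = of_nat (\<alpha> $ i)))"

lemma on_rayI:
  assumes "1 \<le> N" "1 \<le> p" "\<alpha> \<in> S p" "of_nat N * r = of_nat p"
    and "\<And>i. i < k \<Longrightarrow> of_nat N * x i = of_nat (\<alpha> $ i)"
  shows "on_ray k S r x"
  unfolding on_ray_def using assms by blast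

context
  fixes k :: nat and S :: "nat \<Rightarrow> nat vec set"
  assumes carrier: "\<And>p \<alpha>. \<alpha> \<in> S p \<Longrightarrow> \<alpha> \<in> carrier_vec k"
    and add: "\<And>p q \<alpha> \<beta>. 1 \<le> p \<Longrightarrow> 1 \<le> q \<Longrightarrow> \<alpha> \<in> S p \<Longrightarrow> \<beta> \<in> S q \<Longrightarrow> \<alpha> + \<beta> \<in> S (p + q)"
begin

lemma multiple_in_semigroup:
  assumes "1 \<le> p" "\<alpha> \<in> S p" "1 \<le> m"
  shows "\<exists>\<beta>\<in>S (m * p). \<forall>i<k. \<beta> $ i = m * \<alpha> $ i"
  using assms(3)
proof (induction m rule: dec_induct)
  case base
  then show ?case using assms(2) by auto
next
  case (step m)
  then obtain \<beta> where b: "\<beta> \<in> S (m * p)" "\<forall>i<k. \<beta> $ i = m * \<alpha> $ i" by blast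
  have "1 \<le> m * p" using step.hyps assms(1) by simp
  then have "\<alpha> + \<beta> \<in> S (p + m * p)" using add[OF assms(1) _ assms(2) b(1)] by simp
  moreover have "(\<alpha> + \<beta>) $ i = Suc m * \<alpha> $ i" if "i < k" for i
    using that b(2) carrier[OF b(1)] by simp
  ultimately show ?case by auto
qed

lemma on_ray_scale:
  assumes r: "on_ray k S r x" and c: "0 < c"
  shows "on_ray k S (c * r) (\<lambda>i. c * x i)"
proof -
  obtain N p \<alpha> where h: "1 \<le> N" "1 \<le> p" "\<alpha> \<in> S p" "of_nat N * r = of_nat p" "\<forall>i<k. of_nat N * x i = of_nat (\<alpha> $ i)"
    using r unfolding on_ray_def by blast
  obtain a b where q: "quotient_of c = (a, b)" by fastforce
  have "c = of_int a / of_int b" "0 < b" using quotient_of_div[OF q] quotient_of_denom_pos[OF q] by auto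
  moreover have "0 < a" using c calculation by (simp add: zero_less_divide_iff)
  ultimately have ab: "c = of_nat (nat a) / of_nat (nat b)" "1 \<le> nat a" "1 \<le> nat b" by auto
  obtain \<beta> where b: "\<beta> \<in> S (nat a * p)" "\<forall>i<k. \<beta> $ i = nat a * \<alpha> $ i"
    using multiple_in_semigroup[OF h(2,3) ab(2)] by blast
  have cancel: "of_nat (nat b * N) * (c * y) = of_nat (nat a) * (of_nat N * y)" for y :: rat
    using ab(3) unfolding ab(1) by simp
  show ?thesis
  proof (rule on_rayI[of "nat b * N" "nat a * p" \<beta> S, OF _ _ b(1)])
    show "of_nat (nat b * N) * (c * r) = of_nat (nat a * p)" unfolding cancel h(4) by simp
    show "of_nat (nat b * N) * (c * x i) = of_nat (\<beta> $ i)" if "i < k" for i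
      unfolding cancel using h(5) b(2) that by simp
  qed (use h(1,2) ab(2,3) in auto)
qed

lemma on_ray_add:
  assumes x: "on_ray k S r x" and y: "on_ray k S s y"
  shows "on_ray k S (r + s) (\<lambda>i. x i + y i)"
proof -
  obtain N p \<alpha> where h: "1 \<le> N" "1 \<le> p" "\<alpha> \<in> S p" "of_nat N * r = of_nat p" "\<forall>i<k. of_nat N * x i = of_nat (\<alpha> $ i)"
    using x unfolding on_ray_def by blast
  obtain M q \<beta> where g: "1 \<le> M" "1 \<le> q" "\<beta> \<in> S q" "of_nat M * s = of_nat q" "\<forall>i<k. of_nat M * y i = of_nat (\<beta> $ i)"
    using y unfolding on_ray_def by blast
  obtain \<alpha>' where a: "\<alpha>' \<in> S (M * p)" "\<forall>i<k. \<alpha>' $ i = M * \<alpha> $ i"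
    using multiple_in_semigroup[OF h(2,3) g(1)] by blast
  obtain \<beta>' where b: "\<beta>' \<in> S (N * q)" "\<forall>i<k. \<beta>' $ i = N * \<beta> $ i"
    using multiple_in_semigroup[OF g(2,3) h(1)] by blast
  have pos: "1 \<le> M * p" "1 \<le> N * q" using h g by simp_all
  have cancel: "of_nat (N * M) * (u + v) = of_nat M * (of_nat N * u) + of_nat N * (of_nat M * v)" for u v :: rat
    by (simp only: of_nat_mult distrib_left mult_ac)
  show ?thesis
  proof (rule on_rayI[of "N * M" "M * p + N * q" "\<alpha>' + \<beta>'" S, OF _ _ add[OF pos a(1) b(1)]])
    show "of_nat (N * M) * (r + s) = of_nat (M * p + N * q)" unfolding cancel h(4) g(4) by simp
    show "of_nat (N * M) * (x i + y i) = of_nat ((\<alpha>' + \<beta>') $ i)" if "i < k" for i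
      unfolding cancel using h(5) g(5) a(2) b(2) that carrier[OF b(1)] by simp
    show "1 \<le> M * p + N * q" using pos(1) by (rule trans_le_add1)
  qed (use h(1) g(1) in auto)
qed

lemma on_ray_sum:
  assumes "finite F" "F \<noteq> {}" "\<And>x. x \<in> F \<Longrightarrow> on_ray k S (r x) (z x)"
  shows "on_ray k S (\<Sum>x\<in>F. r x) (\<lambda>i. \<Sum>x\<in>F. z x i)"
  using assms
proof (induction F rule: finite_ne_induct)
  case (singleton x)
  then show ?case by simp
next
  case (insert x F)
  have "on_ray k S (r x + (\<Sum>x\<in>F. r x)) (\<lambda>i. z x i + (\<Sum>x\<in>F. z x i))"
    by (rule on_ray_add) (use insert in auto)
  then show ?case using insert.hyps by simp
qed

text \<open>
  With rational coefficients \<open>d\<close>, the point \<open>(1, q)\<close> is a positive rational combination of the points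
  \<open>(1, x)\<close> with \<open>d x > 0\<close>, and so it lies in the cone.
\<close>

theorem convex_subset_rat_of_semigroup:
  "convex_subset_rat k (\<Union>p\<in>{1::nat..}. (\<lambda>\<alpha>. (1 / of_nat p) \<cdot>\<^sub>v map_vec of_nat \<alpha>) ` S p)"
  (is "convex_subset_rat k ?X")
  unfolding convex_subset_rat_def
proof (intro conjI allI impI)
  show "?X \<subseteq> carrier_vec k" using carrier by auto
  fix F :: "rat vec set" and c :: "rat vec \<Rightarrow> real" and q :: "rat vec"
  assume "finite F \<and> F \<subseteq> ?X \<and> (\<forall>x\<in>F. 0 \<le> c x) \<and> (\<Sum>x\<in>F. c x) = 1 \<and> q \<in> carrier_vec k \<and>
    (\<forall>i<k. of_rat (q $ i) = (\<Sum>x\<in>F. c x * of_rat (x $ i)))"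
  then have F: "finite F" "F \<subseteq> ?X" "\<And>x. x \<in> F \<Longrightarrow> 0 \<le> c x" "(\<Sum>x\<in>F. c x) = 1"
    and q: "q \<in> carrier_vec k" "\<And>i. i \<in> {..<k} \<Longrightarrow> of_rat (q $ i) = (\<Sum>x\<in>F. c x * of_rat (x $ i))" by auto
  obtain d where "(\<forall>x\<in>F. 0 \<le> d x) \<and> (\<Sum>x\<in>F. d x) = 1 \<and> (\<forall>i\<in>{..<k}. q $ i = (\<Sum>x\<in>F. d x * x $ i))"
    using rational_convex_coefficients[of F c "{..<k}" "\<lambda>i. q $ i" "\<lambda>x i. x $ i", OF F(1,3,4) q(2)] by fast
  then have d: "\<And>x. x \<in> F \<Longrightarrow> 0 \<le> d x" "(\<Sum>x\<in>F. d x) = 1"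
    "\<And>i. i \<in> {..<k} \<Longrightarrow> q $ i = (\<Sum>x\<in>F. d x * x $ i)" by blast+
  define G where "G = {x\<in>F. 0 < d x}"
  have G: "finite G" "G \<subseteq> F" unfolding G_def using F(1) by auto
  have restrict: "(\<Sum>x\<in>F. d x * f x) = (\<Sum>x\<in>G. d x * f x)" for f :: "rat vec \<Rightarrow> rat"
    by (rule sum.mono_neutral_right[OF F(1) G(2)]) (use d(1) in \<open>force simp: G_def\<close>)
  have one: "(\<Sum>x\<in>G. d x * 1) = 1" using restrict[of "\<lambda>_. 1"] d(2) by simp
  then have "G \<noteq> {}" by auto
  have ray: "on_ray k S (d x * 1) (\<lambda>i. d x * x $ i)" if x: "x \<in> G" for x
  proof (rule on_ray_scale)
    show "0 < d x" using x by (simp add: G_def)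
    obtain p \<alpha> where p: "1 \<le> p" "\<alpha> \<in> S p" "x = (1 / of_nat p) \<cdot>\<^sub>v map_vec of_nat \<alpha>"
      using x G(2) F(2) by fastforce
    have "of_nat p * x $ i = of_nat (\<alpha> $ i)" if "i < k" for i
      unfolding p(3) using p(1) carrier[OF p(2)] that by simp
    then show "on_ray k S 1 (\<lambda>i. x $ i)" unfolding on_ray_def using p(1,2) by fastforce
  qed
  have "on_ray k S (\<Sum>x\<in>G. d x * 1) (\<lambda>i. \<Sum>x\<in>G. d x * x $ i)"
    by (rule on_ray_sum[OF G(1) \<open>G \<noteq> {}\<close> ray])
  then obtain N p \<alpha> where h: "1 \<le> N" "1 \<le> p" "\<alpha> \<in> S p" "of_nat N * (1 :: rat) = of_nat p"
    "\<forall>i<k. of_nat N * (\<Sum>x\<in>G. d x * x $ i) = of_nat (\<alpha> $ i)"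
    unfolding one on_ray_def by blast
  have Np: "N = p" using h(4) by simp
  have "q = (1 / of_nat p) \<cdot>\<^sub>v map_vec of_nat \<alpha>"
  proof (rule eq_vecI)
    fix i assume "i < dim_vec ((1 / rat_of_nat p) \<cdot>\<^sub>v map_vec rat_of_nat \<alpha>)"
    then have i: "i < k" using carrier[OF h(3)] by simp
    have "q $ i = (\<Sum>x\<in>G. d x * x $ i)" using d(3)[of i] i unfolding restrict by simp
    then have "of_nat p * q $ i = of_nat (\<alpha> $ i)" using h(5) i unfolding Np by simp
    then show "q $ i = ((1 / rat_of_nat p) \<cdot>\<^sub>v map_vec rat_of_nat \<alpha>) $ i"
      using h(2) i carrier[OF h(3)] by (simp add: field_simps)
  qed (use q(1) carrier[OF h(3)] in simp)
  then show "q \<in> ?X" using h(2,3) by auto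
qed

end


theorem theorem1p7:
  fixes lam \<mu> :: "nat list" and k :: nat
  assumes "is_partition lam" and "is_partition \<mu>" and "sum_list lam = sum_list \<mu>"
  shows "convex_subset_rat k
    (\<Union>p\<in>{1::nat..}.
       (\<lambda>\<alpha>. (1 / of_nat p) \<cdot>\<^sub>v map_vec of_nat \<alpha>) `
         exponent_set k (kronecker_product (scale_partition p lam) (scale_partition p \<mu>)))"
proof (rule convex_subset_rat_of_semigroup)
  let ?f = "\<lambda>p. kronecker_product (scale_partition p lam) (scale_partition p \<mu>)"
  show "\<alpha> \<in> carrier_vec k" if "\<alpha> \<in> exponent_set k (?f p)" for p \<alpha>
    using that unfolding exponent_set_def by auto
  fix p q :: nat and \<alpha> \<beta> :: "nat vec"
  assume pos: "1 \<le> p" "1 \<le> q" and "\<alpha> \<in> exponent_set k (?f p)" "\<beta> \<in> exponent_set k (?f q)"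
  then obtain a b where a: "\<alpha> = vec k (Poly_Mapping.lookup a)" "specialize k (?f p) a \<noteq> 0"
    and b: "\<beta> = vec k (Poly_Mapping.lookup b)" "specialize k (?f q) b \<noteq> 0"
    unfolding exponent_set_def by blast
  have keys: "Poly_Mapping.keys a \<subseteq> {..<k}" "Poly_Mapping.keys b \<subseteq> {..<k}"
    and nonzero: "?f p a \<noteq> 0" "?f q b \<noteq> 0"
    using a(2) b(2) by (auto simp: specialize_def split: if_splits)
  have "?f (p + q) (a + b) \<noteq> 0"
    using kronecker_product_semigroup[OF assms _ _ nonzero] pos by simp
  moreover have "Poly_Mapping.keys (a + b) \<subseteq> {..<k}"
    using keys Poly_Mapping.keys_add[of a b] by blast
  ultimately have "specialize k (?f (p + q)) (a + b) \<noteq> 0" by (simp add: specialize_def)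
  moreover have "\<alpha> + \<beta> = vec k (Poly_Mapping.lookup (a + b))"
    unfolding a(1) b(1) by (rule eq_vecI) (simp_all add: lookup_add)
  ultimately show "\<alpha> + \<beta> \<in> exponent_set k (?f (p + q))"
    unfolding exponent_set_def by blast
qed

end
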